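(* There exists an absolute constant $C>0$ such that the following holds. Let $m,n\in\mathbb{N}$, let $A=(a_{ij})_{i,j=1}^{m,n}\in\mathbb{R}^{m\times n}$, let $1<p^*\le 2\le q<\infty$, and let $p$ be defined by $1/p+1/p^*=1$. Let $g_{ij}$ ($i\le m$, $j\le n$) be independent standard Gaussian random variables and let $G=(a_{ij}g_{ij})_{i,j=1}^{m,n}$, regarded as a random linear operator from $\mathbb{R}^n$ to $\mathbb{R}^m$. Then $$ \mathbb{E}\,\big\|G:\ell_{p^*}^n\to\ell_q^m\big\|\le\Big(\mathbb{E}\,\big\|G:\ell_{p^*}^n\to\ell_q^m\big\|^q\Big)^{1/q} $$ and $$ \Big(\mathbb{E}\,\big\|G:\ell_{p^*}^n\to\ell_q^m\big\|^q\Big)^{1/q}\le C\,p^{5/q}(\log m)^{1/q}\Big[\gamma_p\max_{i\le m}\|(a_{ij})_{j=1}^n\|_p+\gamma_q\,\mathbb{E}\max_{i\le m,\,j\le n}|a_{ij}g_{ij}|\Big]+2^{1/q}\gamma_q\max_{j\le n}\|(a_{ij})_{i=1}^m\|_q . $$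
   Context: For $r\ge1$, $\gamma_r=(\mathbb{E}|g|^r)^{1/r}$ denotes the $L_r$-norm of a standard Gaussian random variable $g$. For $1\le r<\infty$ and $x\in\mathbb{R}^k$, $\|x\|_r=(\sum_{i=1}^k|x_i|^r)^{1/r}$, and $\ell_r^k=(\mathbb{R}^k,\|\cdot\|_r)$. The norm $\|G:\ell_{p^*}^n\to\ell_q^m\|=\sup\{\|Gy\|_q : y\in\mathbb{R}^n,\ \|y\|_{p^*}\le1\}$ is the operator norm. "Absolute constant" means that $C$ does not depend on $m,n,A,p,q$. $\log$ is the natural logarithm.
   Formalization: The second inequality is asserted only for m ≥ 2: for m = 1 the factor (log m)^{1/q} is 0 and the claim fails, e.g. p = q = 2, n = 3, all a_{1j} = 1 gives √3 on the left and √2 on the right. The first inequality is asserted for all m, n ≥ 1. *)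

theory Defs
  imports "HOL-Probability.Probability"
begin

text \<open>
  Dimensions are natural numbers, so that a constant can be chosen uniformly in them: vectors of
  length \<open>k\<close> are functions of which only the values at indices below \<open>k\<close> matter, and
  \<open>m \<times> n\<close> matrices are functions of two such indices.
\<close>

definition ell_norm :: "real \<Rightarrow> nat \<Rightarrow> (nat \<Rightarrow> real) \<Rightarrow> real" where
  "ell_norm r k x = (\<Sum>i<k. \<bar>x i\<bar> powr r) powr (1 / r)"

definition mat_op_norm :: "real \<Rightarrow> real \<Rightarrow> nat \<Rightarrow> nat \<Rightarrow> (nat \<Rightarrow> nat \<Rightarrow> real) \<Rightarrow> real" where
  "mat_op_norm s q m n B =
     (SUP y\<in>{y. ell_norm s n y \<le> 1}. ell_norm q m (\<lambda>i. \<Sum>j<n. B i j * y j))"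

definition gauss_norm :: "real \<Rightarrow> real" where
  "gauss_norm r = (\<integral>x. \<bar>x\<bar> powr r \<partial>std_normal_distribution) powr (1 / r)"

definition iid_std_gaussian ::
    "'w measure \<Rightarrow> nat \<Rightarrow> nat \<Rightarrow> (nat \<Rightarrow> nat \<Rightarrow> 'w \<Rightarrow> real) \<Rightarrow> bool" where
  "iid_std_gaussian M m n g \<longleftrightarrow>
     prob_space M \<and>
     prob_space.indep_vars M (\<lambda>_. borel) (\<lambda>(i, j). g i j) ({..<m} \<times> {..<n}) \<and>
     (\<forall>i<m. \<forall>j<n. distributed M lborel (g i j) std_normal_density)"

end

theory Submission
  imports Defs
begin

text \<open>
  Let \<open>X\<^sub>i\<close> be the rows of \<open>G\<close> and \<open>F y = (\<Sum>i. \<bar>\<langle>X\<^sub>i, y\<rangle>\<bar> powr q)\<close>. For fixed \<open>y\<close> in the unit ball of the dual norm,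
  Gaussian stability gives \<open>E (F y) \<le> (\<gamma>\<^sub>q max\<^sub>j \<parallel>(a\<^sub>i\<^sub>j)\<^sub>i\<parallel>\<^sub>q) powr q\<close>. To control the supremum over \<open>y\<close>,
  one symmetrizes with an offset \<open>\<delta>\<close>, which reduces the matter to bounding
  \<open>sup\<^sub>y (\<Sum>i. (\<epsilon>\<^sub>i - \<delta>) \<bar>\<langle>x\<^sub>i, y\<rangle>\<bar> powr q)\<close> for fixed rows of norm at most \<open>R\<close> by \<open>C powr q * p * ln m * R powr q\<close>.
  Mirror descent for the smooth potential \<open>\<parallel>\<cdot>\<parallel>\<^sub>p\<^sup>2 / 2\<close> codes every \<open>y\<close>, at every scale \<open>R / 2 ^ l\<close>, by a list of
  steps along the rows; the total decrease of the potential bounds the code lengths, weighted by \<open>4 powr (- l)\<close>, by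
  a multiple of \<open>p\<close>. A union bound over codewords, weighted by their lengths, then loses only one factor \<open>ln m\<close>
  because \<open>q \<ge> 2\<close>.

  What remains is the moment of \<open>max\<^sub>i \<parallel>X\<^sub>i\<parallel>\<^sub>p\<close>. A truncation argument shows that \<open>\<parallel>X\<^sub>i\<parallel>\<^sub>p\<close> exceeds a multiple of
  \<open>\<gamma>\<^sub>p \<parallel>a\<^sub>i\<parallel>\<^sub>p\<close> with Gaussian tails of width \<open>b\<^sub>i = max\<^sub>j \<bar>a\<^sub>i\<^sub>j\<bar>\<close>, and independence of the entries gives
  \<open>(\<Sum>i. exp (- 4 T\<^sup>2 / b\<^sub>i\<^sup>2)) \<le> 16\<close> for \<open>T = E max \<bar>a\<^sub>i\<^sub>j g\<^sub>i\<^sub>j\<bar>\<close>, so the tails are summable at the scale \<open>T\<close>.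
\<close>

section \<open>Mirror descent and nets in the dual ball\<close>

text \<open>Factors of the form \<open>c powr q\<close> cost nothing, because the
  \<open>q\<close>-th root taken at the end turns them into absolute constants; this is why bases
  such as 4, 256 and 30 are chosen generously. Three things do cost something and shape the proof:
  the factor in front of the column term, the power of \<open>ln m\<close>, and growth like
  \<open>q powr (q / 2)\<close>. The offset in the symmetrization serves all of the first: it keeps
  the factor of the column term explicit, it pays for the variance of the Rademacher sums, so that
  their exponential moments are at most 1, and it absorbs discretization errors proportional to
  \<open>\<bar>v\<bar> powr q\<close>. The growth in \<open>q\<close>, which appears when
  exponential tails are turned into moments, is absorbed by \<open>gauss_norm q\<close>, which is
  itself of order \<open>sqrt q\<close>. Suprema are taken over finite sets of points, with bounds
  that do not depend on the set, and only at the end over the whole ball.\<close>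

lemma Holder_inequality_sum:
  fixes u v :: "'a \<Rightarrow> real"
  assumes pq: "p > 1" "q > 1" "1 / p + 1 / q = 1"
  shows "(\<Sum>i\<in>A. \<bar>u i * v i\<bar>) \<le>
    (\<Sum>i\<in>A. \<bar>u i\<bar> powr p) powr (1 / p) * (\<Sum>i\<in>A. \<bar>v i\<bar> powr q) powr (1 / q)"
proof (cases "finite A")
  case True
  define U where "U = (\<Sum>i\<in>A. \<bar>u i\<bar> powr p) powr (1 / p)"
  define V where "V = (\<Sum>i\<in>A. \<bar>v i\<bar> powr q) powr (1 / q)"
  have UV: "U \<ge> 0" "V \<ge> 0" by (auto simp: U_def V_def)
  consider "U = 0" | "V = 0" | "U > 0" "V > 0" using UV by linarith
  then show ?thesis
  proof cases
    case 1
    then have "\<forall>i\<in>A. u i = 0"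
      using True by (simp add: U_def sum_nonneg_eq_0_iff)
    then show ?thesis by simp
  next
    case 2
    then have "\<forall>i\<in>A. v i = 0"
      using True by (simp add: V_def sum_nonneg_eq_0_iff)
    then show ?thesis by simp
  next
    case 3
    have Up: "U powr p = (\<Sum>i\<in>A. \<bar>u i\<bar> powr p)" and Vq: "V powr q = (\<Sum>i\<in>A. \<bar>v i\<bar> powr q)"
      using pq by (simp_all add: U_def V_def powr_powr sum_nonneg)
    have "(\<Sum>i\<in>A. \<bar>u i * v i\<bar>) / (U * V) = (\<Sum>i\<in>A. (\<bar>u i\<bar> / U) * (\<bar>v i\<bar> / V))"
      by (simp add: sum_divide_distrib abs_mult)
    also have "\<dots> \<le> (\<Sum>i\<in>A. (\<bar>u i\<bar> / U) powr p / p + (\<bar>v i\<bar> / V) powr q / q)"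
      using pq 3 by (intro sum_mono Youngs_inequality) (auto simp: UV)
    also have "\<dots> = (\<Sum>i\<in>A. \<bar>u i\<bar> powr p) / U powr p / p + (\<Sum>i\<in>A. \<bar>v i\<bar> powr q) / V powr q / q"
      using 3 by (simp add: powr_divide sum.distrib flip: sum_divide_distrib)
    also have "\<dots> = 1"
      using 3 pq(3) by (simp flip: Up Vq)
    finally show ?thesis using 3 by (simp add: U_def V_def)
  qed
qed auto

lemma ell_norm_nonneg: "ell_norm r k x \<ge> 0"
  by (simp add: ell_norm_def)

lemma ell_norm_powr: "r > 0 \<Longrightarrow> ell_norm r k x powr r = (\<Sum>i<k. \<bar>x i\<bar> powr r)"
  by (simp add: ell_norm_def powr_powr sum_nonneg)

lemma ell_norm_scale: "r > 0 \<Longrightarrow> ell_norm r k (\<lambda>i. c * x i) = \<bar>c\<bar> * ell_norm r k x"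
  by (simp add: ell_norm_def abs_mult powr_mult sum_nonneg powr_powr flip: sum_distrib_left)

lemma ell_norm_Holder:
  assumes "p > 1" "q > 1" "1 / p + 1 / q = 1"
  shows "\<bar>\<Sum>i<k. x i * y i\<bar> \<le> ell_norm p k x * ell_norm q k y"
  unfolding ell_norm_def
  by (rule order_trans[OF sum_abs Holder_inequality_sum[OF assms]])

section \<open>Smoothness of the squared p-norm\<close>

lemma second_order_upper_bound:
  fixes f f' f'' :: "real \<Rightarrow> real"
  assumes "\<And>s. (f has_real_derivative f' s) (at s)" "\<And>s. (f' has_real_derivative f'' s) (at s)"
    and "\<And>s. f'' s \<le> B"
  shows "f 1 \<le> f 0 + f' 0 + B / 2"
proof -
  have "\<exists>t. (if 1 < (0::real) then 1 < t \<and> t < 0 else 0 < t \<and> t < 1) \<and>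
    f 1 = (\<Sum>k<2. (case k of 0 \<Rightarrow> f | Suc 0 \<Rightarrow> f' | _ \<Rightarrow> f'') 0 / fact k * (1 - 0) ^ k) +
      (case 2 of 0 \<Rightarrow> f | Suc 0 \<Rightarrow> f' | Suc (Suc _) \<Rightarrow> f'') t / fact 2 * (1 - 0) ^ 2"
    by (rule Taylor[where a = 0 and b = 1]) (use assms in \<open>auto simp: less_Suc_eq numeral_2_eq_2 split: nat.splits\<close>)
  then obtain t where "f 1 = f 0 + f' 0 + f'' t / 2"
    by (auto simp: numeral_2_eq_2)
  with assms(3)[of t] show ?thesis by simp
qed

text \<open>
  A smoothed version of \<open>\<theta> \<mapsto> \<parallel>\<theta>\<parallel>\<^sub>p\<^sup>2 / 2\<close> and its gradient; the parameter \<open>\<kappa> > 0\<close> removes the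
  singularity at the origin and is chosen later so that the potential at \<open>0\<close> is \<open>1 / 2\<close>.
\<close>

definition smooth_pot :: "real \<Rightarrow> nat \<Rightarrow> real \<Rightarrow> (nat \<Rightarrow> real) \<Rightarrow> real" where
  "smooth_pot p n \<kappa> \<theta> = (\<Sum>j<n. ((\<theta> j)\<^sup>2 + \<kappa>) powr (p / 2)) powr (2 / p) / 2"

definition smooth_grad :: "real \<Rightarrow> nat \<Rightarrow> real \<Rightarrow> (nat \<Rightarrow> real) \<Rightarrow> nat \<Rightarrow> real" where
  "smooth_grad p n \<kappa> \<theta> j =
     (\<Sum>k<n. ((\<theta> k)\<^sup>2 + \<kappa>) powr (p / 2)) powr (2 / p - 1) * ((\<theta> j)\<^sup>2 + \<kappa>) powr (p / 2 - 1) * \<theta> j"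

text \<open>The squared p-norm is 2-smooth with constant \<open>p - 1\<close>, and the smoothing by
  \<open>\<kappa>\<close> preserves this. Along the segment in direction \<open>h\<close>, the
  second derivative is a nonpositive term from the outer power \<open>2 / p\<close>, which is
  dropped, plus a weighted sum of \<open>(h j)\<^sup>2\<close>, which is bounded by Hoelder's
  inequality. The constant is where the factor \<open>p\<close> of the final moment bound comes
  from.\<close>

lemma smooth_pot_upper_bound:
  assumes p: "p \<ge> 2" and \<kappa>: "\<kappa> > 0" and n: "n \<ge> 1"
  shows "smooth_pot p n \<kappa> (\<lambda>j. \<theta> j + h j) \<le>
    smooth_pot p n \<kappa> \<theta> + (\<Sum>j<n. smooth_grad p n \<kappa> \<theta> j * h j) + (p - 1) / 2 * (ell_norm p n h)\<^sup>2"
proof -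
  define w where "w s j = (\<theta> j + s * h j)\<^sup>2 + \<kappa>" for s j
  have w: "w s j > 0" for s j using \<kappa> by (simp add: w_def add_nonneg_pos)
  define N where "N s = (\<Sum>j<n. w s j powr (p / 2))" for s
  define N1 where "N1 s = (\<Sum>j<n. p * w s j powr (p / 2 - 1) * (\<theta> j + s * h j) * h j)" for s
  define N2 where "N2 s = (\<Sum>j<n. p * w s j powr (p / 2 - 1) * (h j)\<^sup>2 +
      p * (p - 2) * w s j powr (p / 2 - 2) * (\<theta> j + s * h j)\<^sup>2 * (h j)\<^sup>2)" for s
  have N: "N s > 0" for s
  proof -
    have "0 < w s j powr (p / 2)" for j using w[of s j] by simp
    moreover have "{..<n} \<noteq> {}" using n by (auto simp: lessThan_empty_iff)
    ultimately show ?thesis unfolding N_def by (intro sum_pos) auto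
  qed
  have w': "((\<lambda>s. w s j) has_real_derivative 2 * (\<theta> j + s * h j) * h j) (at s)" for s j
    unfolding w_def by (auto intro!: derivative_eq_intros)
  have wr: "((\<lambda>s. w s j powr r) has_real_derivative
      2 * r * w s j powr (r - 1) * (\<theta> j + s * h j) * h j) (at s)" for s j r
    using w[of s j] by (auto intro!: derivative_eq_intros w' simp: powr_diff)
  have N': "(N has_real_derivative N1 s) (at s)" for s
    unfolding N_def[abs_def] N1_def
    by (rule DERIV_sum, rule DERIV_cong, rule wr) (simp)
  have "((\<lambda>s. p * w s j powr (p / 2 - 1) * (\<theta> j + s * h j) * h j) has_real_derivative
      p * w s j powr (p / 2 - 1) * (h j)\<^sup>2 +
      p * (p - 2) * w s j powr (p / 2 - 2) * (\<theta> j + s * h j)\<^sup>2 * (h j)\<^sup>2) (at s)" for s j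
    by (rule derivative_eq_intros wr refl | simp)+ (simp add: algebra_simps power2_eq_square)
  then have N1': "(N1 has_real_derivative N2 s) (at s)" for s
    unfolding N1_def[abs_def] N2_def by (intro DERIV_sum)
  define f where "f s = N s powr (2 / p) / 2" for s
  define f' where "f' s = N s powr (2 / p - 1) * N1 s / p" for s
  define f'' where "f'' s = N s powr (2 / p - 1) * N2 s / p
    + (2 / p - 1) * N s powr (2 / p - 2) * (N1 s)\<^sup>2 / p" for s
  have Nr: "((\<lambda>s. N s powr r) has_real_derivative r * N s powr (r - 1) * N1 s) (at s)" for s r
    using N[of s] by (auto intro!: derivative_eq_intros N' simp: powr_diff)
  have f1: "(f has_real_derivative f' s) (at s)" for s
    unfolding f_def[abs_def] f'_def
    by (rule DERIV_cong[OF DERIV_cdivide[OF Nr]]) (use p in simp)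
  have f2: "(f' has_real_derivative f'' s) (at s)" for s
    unfolding f'_def[abs_def] f''_def
    by (rule DERIV_cong[OF DERIV_cdivide[OF DERIV_mult[OF Nr N1']]])
      (simp add: power2_eq_square add_divide_distrib mult_ac)
  \<comment> \<open>The exponents are \<open>p / (p - 2)\<close> and \<open>p / 2\<close>; the power
    of \<open>N s\<close> so produced cancels the prefactor exactly. At \<open>p = 2\<close> the
    first exponent degenerates.\<close>
  have hold: "N s powr (2 / p - 1) * (\<Sum>j<n. w s j powr (p / 2 - 1) * (h j)\<^sup>2) \<le> (ell_norm p n h)\<^sup>2" for s
  proof (cases "p = 2")
    case True
    have "w s j \<noteq> 0" for j using w[of s j] by simp
    with True show ?thesis using N[of s]
      by (simp add: ell_norm_def powr_half_sqrt sum_nonneg)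
  next
    case False
    with p have p2: "p > 2" by simp
    have "(\<Sum>j<n. w s j powr (p / 2 - 1) * (h j)\<^sup>2) \<le> (\<Sum>j<n. \<bar>w s j powr (p / 2 - 1) * (h j)\<^sup>2\<bar>)"
      by (intro sum_mono) simp
    also have "\<dots> \<le> (\<Sum>j<n. \<bar>w s j powr (p / 2 - 1)\<bar> powr (p / (p - 2))) powr (1 / (p / (p - 2))) *
        (\<Sum>j<n. \<bar>(h j)\<^sup>2\<bar> powr (p / 2)) powr (1 / (p / 2))"
      using p2 by (intro Holder_inequality_sum) (auto simp: field_simps)
    also have "(\<Sum>j<n. \<bar>w s j powr (p / 2 - 1)\<bar> powr (p / (p - 2))) = N s"
    proof -
      have "(p / 2 - 1) * (p / (p - 2)) = (p - 2) / 2 * (p / (p - 2))" by (simp add: diff_divide_distrib)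
      also have "\<dots> = p / 2" using p2 by (simp add: divide_simps)
      finally show ?thesis by (simp only: N_def powr_powr abs_of_nonneg powr_ge_zero)
    qed
    also have "(\<Sum>j<n. \<bar>(h j)\<^sup>2\<bar> powr (p / 2)) powr (1 / (p / 2)) = (ell_norm p n h)\<^sup>2"
    proof -
      have "\<bar>(h j)\<^sup>2\<bar> powr (p / 2) = \<bar>h j\<bar> powr p" for j
        using powr_powr[of "\<bar>h j\<bar>" 2 "p/2"] by simp
      then show ?thesis
        using p2 powr_powr[of "\<Sum>j<n. \<bar>h j\<bar> powr p" "1/p" 2]
        by (simp add: ell_norm_def sum_nonneg)
    qed
    finally have "N s powr (2 / p - 1) * (\<Sum>j<n. w s j powr (p / 2 - 1) * (h j)\<^sup>2)
        \<le> N s powr (2 / p - 1) * (N s powr (1 / (p / (p - 2))) * (ell_norm p n h)\<^sup>2)"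
      by (intro mult_left_mono) auto
    also have "\<dots> = N s powr (2 / p - 1 + (p - 2) / p) * (ell_norm p n h)\<^sup>2"
      by (simp add: powr_add)
    also have "2 / p - 1 + (p - 2) / p = 0" using p2 by (simp add: field_simps)
    finally show ?thesis using N[of s] by simp
  qed
  have N2: "N2 s \<le> p * (p - 1) * (\<Sum>j<n. w s j powr (p / 2 - 1) * (h j)\<^sup>2)" for s
    unfolding N2_def sum_distrib_left
  proof (rule sum_mono)
    fix j
    have "w s j powr (p / 2 - 2) * (\<theta> j + s * h j)\<^sup>2 \<le> w s j powr (p / 2 - 2) * w s j"
      using \<kappa> by (intro mult_left_mono) (auto simp: w_def)
    also have "\<dots> = w s j powr (p / 2 - 1)"
      using w[of s j] by (simp add: powr_mult_base[of "w s j" "p/2-2"] mult.commute)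
    finally have "p * (p - 2) * (h j)\<^sup>2 * (w s j powr (p / 2 - 2) * (\<theta> j + s * h j)\<^sup>2)
       \<le> p * (p - 2) * (h j)\<^sup>2 * w s j powr (p / 2 - 1)"
      using p by (intro mult_left_mono) auto
    then show "p * w s j powr (p / 2 - 1) * (h j)\<^sup>2 +
         p * (p - 2) * w s j powr (p / 2 - 2) * (\<theta> j + s * h j)\<^sup>2 * (h j)\<^sup>2
         \<le> p * (p - 1) * (w s j powr (p / 2 - 1) * (h j)\<^sup>2)"
      by (simp add: algebra_simps)
  qed
  have f3: "f'' s \<le> (p - 1) * (ell_norm p n h)\<^sup>2" for s
  proof -
    have "(2 / p - 1) * N s powr (2 / p - 2) * (N1 s)\<^sup>2 / p \<le> 0"
      using p by (intro divide_nonpos_pos mult_nonpos_nonneg) (auto simp: field_simps)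
    then have "f'' s \<le> N s powr (2 / p - 1) * N2 s / p"
      by (simp add: f''_def)
    also have "\<dots> \<le> N s powr (2 / p - 1) * (p * (p - 1) * (\<Sum>j<n. w s j powr (p / 2 - 1) * (h j)\<^sup>2)) / p"
      using p by (intro divide_right_mono mult_left_mono N2) auto
    also have "\<dots> = (p - 1) * (N s powr (2 / p - 1) * (\<Sum>j<n. w s j powr (p / 2 - 1) * (h j)\<^sup>2))"
      using p by simp
    also have "\<dots> \<le> (p - 1) * (ell_norm p n h)\<^sup>2"
      using p by (intro mult_left_mono hold) auto
    finally show ?thesis .
  qed
  have "f 1 \<le> f 0 + f' 0 + (p - 1) * (ell_norm p n h)\<^sup>2 / 2"
    by (rule second_order_upper_bound[OF f1 f2 f3])
  moreover have "f 1 = smooth_pot p n \<kappa> (\<lambda>j. \<theta> j + h j)" "f 0 = smooth_pot p n \<kappa> \<theta>"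
    by (simp_all add: f_def N_def w_def smooth_pot_def)
  moreover have "f' 0 = (\<Sum>j<n. smooth_grad p n \<kappa> \<theta> j * h j)"
    using p by (simp add: f'_def N_def N1_def w_def smooth_grad_def sum_distrib_left sum_divide_distrib mult_ac)
  ultimately show ?thesis by simp
qed

lemma smooth_pot_ge:
  assumes "p \<ge> 2" "\<kappa> > 0"
  shows "(ell_norm p n \<theta>)\<^sup>2 / 2 \<le> smooth_pot p n \<kappa> \<theta>"
proof -
  have "\<bar>\<theta> j\<bar> powr p \<le> ((\<theta> j)\<^sup>2 + \<kappa>) powr (p / 2)" for j
  proof -
    have "\<bar>\<theta> j\<bar> powr p = ((\<theta> j)\<^sup>2) powr (p / 2)"
      using powr_powr[of "\<bar>\<theta> j\<bar>" 2 "p/2"] by simp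
    also have "\<dots> \<le> ((\<theta> j)\<^sup>2 + \<kappa>) powr (p / 2)"
      using assms by (intro powr_mono2) auto
    finally show ?thesis .
  qed
  then have "(\<Sum>j<n. \<bar>\<theta> j\<bar> powr p) powr (2 / p) \<le> (\<Sum>j<n. ((\<theta> j)\<^sup>2 + \<kappa>) powr (p / 2)) powr (2 / p)"
    using assms by (intro powr_mono2 sum_mono sum_nonneg) auto
  moreover have "(ell_norm p n \<theta>)\<^sup>2 = (\<Sum>j<n. \<bar>\<theta> j\<bar> powr p) powr (2 / p)"
    using powr_powr[of "\<Sum>j<n. \<bar>\<theta> j\<bar> powr p" "1/p" 2] by (simp add: ell_norm_def sum_nonneg)
  ultimately show ?thesis by (simp add: smooth_pot_def)
qed

text \<open>Every failure of \<open>ok\<close> buys a decrease of at least \<open>d\<close>, which a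
  potential bounded below can pay for only finitely often. Lengths are compared with the starting
  word \<open>c\<close> instead of the empty one so that runs can be chained.\<close>

lemma greedy_descent:
  fixes \<Phi> :: "'a list \<Rightarrow> real"
  assumes d: "d > 0"
    and lower: "\<And>c. set c \<subseteq> A \<Longrightarrow> lo \<le> \<Phi> c"
    and step: "\<And>c. set c \<subseteq> A \<Longrightarrow> \<not> ok c \<Longrightarrow> \<exists>\<tau>\<in>A. \<Phi> (\<tau> # c) \<le> \<Phi> c - d"
    and c: "set c \<subseteq> A"
  shows "\<exists>c'. set c' \<subseteq> A \<and> ok c' \<and> d * (real (length c') - real (length c)) \<le> \<Phi> c - \<Phi> c'"
proof -
  have "\<exists>c'. set c' \<subseteq> A \<and> ok c' \<and> d * (real (length c') - real (length c)) \<le> \<Phi> c - \<Phi> c'"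
    if "\<Phi> c - lo \<le> real N * d" "set c \<subseteq> A" for N c
    using that
  proof (induction N arbitrary: c)
    case 0
    have "ok c"
    proof (rule ccontr)
      assume "\<not> ok c"
      with step 0 obtain \<tau> where "\<tau> \<in> A" "\<Phi> (\<tau> # c) \<le> \<Phi> c - d" by blast
      with lower[of "\<tau> # c"] 0 d show False by auto
    qed
    with 0 show ?case by (intro exI[of _ c]) auto
  next
    case (Suc N)
    show ?case
    proof (cases "ok c")
      case True
      with Suc show ?thesis by (intro exI[of _ c]) auto
    next
      case False
      with step Suc obtain \<tau> where \<tau>: "\<tau> \<in> A" "\<Phi> (\<tau> # c) \<le> \<Phi> c - d" by blast
      with Suc.prems have "\<Phi> (\<tau> # c) - lo \<le> real N * d" "set (\<tau> # c) \<subseteq> A"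
        by (auto simp: algebra_simps)
      from Suc.IH[OF this] obtain c' where "set c' \<subseteq> A" "ok c'"
        "d * (real (length c') - real (length (\<tau> # c))) \<le> \<Phi> (\<tau> # c) - \<Phi> c'" by blast
      with \<tau> show ?thesis by (intro exI[of _ c']) (auto simp: algebra_simps)
    qed
  qed
  moreover obtain N where "\<Phi> c - lo \<le> real N * d"
    using reals_Archimedean3[OF d] less_imp_le by metis
  ultimately show ?thesis using c by blast
qed

text \<open>The run at scale \<open>l + 1\<close> continues from the word where scale
  \<open>l\<close> stopped, so a step made at scale \<open>k\<close> is counted again at all later
  scales. The weights \<open>(1/4) ^ l\<close> with \<open>l \<ge> k\<close> sum to at most
  \<open>4/3 * (1/4) ^ k\<close>, proportional to the decrease that the step achieved; hence a total
  bound independent of \<open>L\<close>.\<close>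

lemma multiscale_descent:
  fixes \<Phi> :: "'a list \<Rightarrow> real"
  assumes d: "d > 0"
    and lower: "\<And>c. set c \<subseteq> A \<Longrightarrow> lo \<le> \<Phi> c"
    and step: "\<And>l c. l < L \<Longrightarrow> set c \<subseteq> A \<Longrightarrow> \<not> ok l c \<Longrightarrow> \<exists>\<tau>\<in>A. \<Phi> (\<tau> # c) \<le> \<Phi> c - d * (1/4) ^ l"
  shows "\<exists>c. (\<forall>l<L. set (c l) \<subseteq> A \<and> ok l (c l)) \<and>
    (\<Sum>l<L. (1/4) ^ l * real (length (c l))) \<le> 4 / 3 * (\<Phi> [] - lo) / d"
proof -
  \<comment> \<open>The term with the current word \<open>e\<close> prepays its letters at all
    scales from \<open>k\<close> on: \<open>4/3 * (1/4) ^ k\<close> is the tail of the geometric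
    series.\<close>
  have "\<exists>c e. (\<forall>l<k. set (c l) \<subseteq> A \<and> ok l (c l)) \<and> set e \<subseteq> A \<and>
    d * ((\<Sum>l<k. (1/4) ^ l * real (length (c l))) + 4/3 * (1/4) ^ k * real (length e)) \<le> 4/3 * (\<Phi> [] - \<Phi> e)"
    if "k \<le> L" for k
    using that
  proof (induction k)
    case 0
    then show ?case by (intro exI[of _ "\<lambda>_. []"] exI[of _ "[]"]) auto
  next
    case (Suc k)
    then obtain c e where ce: "\<forall>l<k. set (c l) \<subseteq> A \<and> ok l (c l)" "set e \<subseteq> A"
      "d * ((\<Sum>l<k. (1/4) ^ l * real (length (c l))) + 4/3 * (1/4) ^ k * real (length e)) \<le> 4/3 * (\<Phi> [] - \<Phi> e)"
      by auto
    have "\<exists>e'. set e' \<subseteq> A \<and> ok k e' \<and> d * (1/4) ^ k * (real (length e') - real (length e)) \<le> \<Phi> e - \<Phi> e'"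
      using d Suc.prems by (intro greedy_descent[OF _ lower step ce(2)]) auto
    then obtain e' where e': "set e' \<subseteq> A" "ok k e'"
      "d * (1/4) ^ k * (real (length e') - real (length e)) \<le> \<Phi> e - \<Phi> e'" by blast
    have "(\<Sum>l<k. (1/4) ^ l * real (length ((c(k := e')) l))) = (\<Sum>l<k. (1/4) ^ l * real (length (c l)))"
      by (intro sum.cong) auto
    with ce e' show ?case
      by (intro exI[of _ "c(k := e')"] exI[of _ e']) (auto simp: algebra_simps less_Suc_eq)
  qed
  from this[OF order_refl] obtain c e where ce: "\<forall>l<L. set (c l) \<subseteq> A \<and> ok l (c l)" "set e \<subseteq> A"
    "d * ((\<Sum>l<L. (1/4) ^ l * real (length (c l))) + 4/3 * (1/4) ^ L * real (length e)) \<le> 4/3 * (\<Phi> [] - \<Phi> e)"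
    by blast
  have "d * (\<Sum>l<L. (1/4) ^ l * real (length (c l))) \<le> 
      d * ((\<Sum>l<L. (1/4) ^ l * real (length (c l))) + 4/3 * (1/4) ^ L * real (length e))"
    using d by (intro mult_left_mono) auto
  also have "\<dots> \<le> 4/3 * (\<Phi> [] - lo)" using ce(3) lower[OF ce(2)] by simp
  finally show ?thesis using ce d by (intro exI[of _ c]) (auto simp: field_simps)
qed

lemma conjugate_exponent_gt_one:
  fixes p ps :: real
  assumes p: "p \<ge> 2" and pps: "1 / p + 1 / ps = 1"
  shows "ps > 1"
proof -
  have "1 / p > 0" "1 / p \<le> 1 / 2" using p by (auto simp: field_simps)
  then have "1 / ps \<ge> 1/2" "1 / ps < 1" using pps by linarith+
  then have "ps > 0" by (metis divide_nonneg_nonpos half_gt_zero_iff not_le order_less_le_trans zero_le_one zero_less_one)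
  with \<open>1 / ps < 1\<close> show ?thesis by (simp add: field_simps)
qed

text \<open>
  The potential \<open>smooth_pot \<theta> - \<langle>\<theta>, y\<rangle>\<close> is at least \<open>- 1 / 2\<close> by the Hoelder inequality. Whenever the gradient at \<open>\<theta>\<close>
  fails to approximate \<open>y\<close> within \<open>t\<close> when tested on some \<open>x\<^sub>i\<close>, a step along \<open>\<plusminus> x\<^sub>i\<close> lowers the potential
  by \<open>t\<^sup>2 / (2 (p - 1) R\<^sup>2)\<close>. The list of steps is a codeword for \<open>y\<close>, so long codewords at fine scales are
  paid for by the potential. This plays the role of the majorizing measure on the 2-convex ball.
\<close>

lemma mirror_descent_net:
  fixes x :: "nat \<Rightarrow> nat \<Rightarrow> real"
  assumes p: "p \<ge> 2" and pps: "1 / p + 1 / ps = 1" and n: "n \<ge> 1" and R: "R > 0" and K: "K > 0"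
    and x: "\<And>i. i < m \<Longrightarrow> ell_norm p n (x i) \<le> R"
  shows "\<exists>v :: (nat \<times> bool \<times> nat) list \<Rightarrow> nat \<Rightarrow> real. \<forall>y. ell_norm ps n y \<le> 1 \<longrightarrow>
    (\<exists>c. (\<forall>l<L. set (c l) \<subseteq> {..<m} \<times> UNIV \<times> {..<L} \<and>
               (\<forall>i<m. \<bar>(\<Sum>j<n. x i j * y j) - v (c l) i\<bar> \<le> R / 2 ^ l / K)) \<and>
         (\<Sum>l<L. (1/4) ^ l * real (length (c l))) \<le> 8 / 3 * (p - 1) * K\<^sup>2)"
proof -
  define sg where "sg b = (if b then 1 else -1 :: real)" for b
  \<comment> \<open>This step length minimizes \<open>(p - 1) / 2 * (\<eta> l * R)\<^sup>2 - \<eta>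
    l * (R / 2 ^ l / K)\<close>, the quadratic bound on the change of the potential.\<close>
  define \<eta> where "\<eta> l = 1 / (2 ^ l * K * (p - 1) * R)" for l
  define \<Theta> where "\<Theta> c j = sum_list (map (\<lambda>(i, b, l). sg b * \<eta> l * x i j) c)" for c j
  define \<kappa> where "\<kappa> = real n powr (-2/p)"
  \<comment> \<open>The approximant is decoded from the word and the rows alone. It does not involve
    \<open>y\<close>, so the later union bound runs over words instead of points of the
    ball.\<close>
  define v where "v c i = (\<Sum>j<n. x i j * smooth_grad p n \<kappa> (\<Theta> c) j)" for c i
  define A where "A = {..<m} \<times> (UNIV :: bool set) \<times> {..<L}"
  have \<kappa>: "\<kappa> > 0" using n by (simp add: \<kappa>_def)
  have ps: "ps > 1" by (rule conjugate_exponent_gt_one[OF p pps])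
  have pot0: "smooth_pot p n \<kappa> (\<lambda>j. 0) \<le> 1 / 2"
  proof -
    have "smooth_pot p n \<kappa> (\<lambda>j. 0) = (real n * \<kappa> powr (p / 2)) powr (2 / p) / 2"
      by (simp add: smooth_pot_def)
    also have "real n * \<kappa> powr (p / 2) = real n powr 1 * real n powr (-1)"
      using n p by (simp add: \<kappa>_def powr_powr)
    also have "\<dots> = 1" using n by (simp flip: powr_add)
    finally show ?thesis by simp
  qed
  have "\<exists>c. (\<forall>l<L. set (c l) \<subseteq> A \<and> (\<forall>i<m. \<bar>(\<Sum>j<n. x i j * y j) - v (c l) i\<bar> \<le> R / 2 ^ l / K)) \<and>
         (\<Sum>l<L. (1/4) ^ l * real (length (c l))) \<le> 8 / 3 * (p - 1) * K\<^sup>2" if y: "ell_norm ps n y \<le> 1" for y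
  proof -
    define \<Phi> where "\<Phi> c = smooth_pot p n \<kappa> (\<Theta> c) - (\<Sum>j<n. \<Theta> c j * y j)" for c
    define d where "d = 1 / (2 * (p - 1) * K\<^sup>2)"
    have d: "d > 0" using p K by (simp add: d_def)
    have lower: "-1/2 \<le> \<Phi> c" for c
    proof -
      have "(\<Sum>j<n. \<Theta> c j * y j) \<le> ell_norm p n (\<Theta> c) * ell_norm ps n y"
        using ell_norm_Holder[of p ps "\<Theta> c" y n] p ps pps by linarith
      also have "\<dots> \<le> ell_norm p n (\<Theta> c)"
        using y ell_norm_nonneg mult_left_le by blast
      also have "\<dots> \<le> (ell_norm p n (\<Theta> c))\<^sup>2 / 2 + 1/2"
        using zero_le_power2[of "ell_norm p n (\<Theta> c) - 1"] by (simp add: power2_diff)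
      also have "\<dots> \<le> smooth_pot p n \<kappa> (\<Theta> c) + 1/2"
        using smooth_pot_ge[OF p \<kappa>] by simp
      finally show ?thesis by (simp add: \<Phi>_def)
    qed
    have step: "\<exists>\<tau>\<in>A. \<Phi> (\<tau> # c) \<le> \<Phi> c - d * (1/4) ^ l"
      if l: "l < L" and nok: "\<not> (\<forall>i<m. \<bar>(\<Sum>j<n. x i j * y j) - v c i\<bar> \<le> R / 2 ^ l / K)" for l c
    proof -
      obtain i where i: "i < m" "\<bar>(\<Sum>j<n. x i j * y j) - v c i\<bar> > R / 2 ^ l / K"
        using nok by (auto simp: not_le)
      define b where "b = ((\<Sum>j<n. x i j * y j) \<ge> v c i)"
      define h where "h j = sg b * \<eta> l * x i j" for j
      have \<eta>: "\<eta> l > 0" using p K R by (simp add: \<eta>_def)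
      have T: "\<Theta> ((i, b, l) # c) = (\<lambda>j. \<Theta> c j + h j)"
        by (auto simp: \<Theta>_def h_def)
      have "\<Phi> ((i, b, l) # c) - \<Phi> c \<le>
          (\<Sum>j<n. smooth_grad p n \<kappa> (\<Theta> c) j * h j) + (p - 1) / 2 * (ell_norm p n h)\<^sup>2 - (\<Sum>j<n. h j * y j)"
        using smooth_pot_upper_bound[OF p \<kappa> n, of "\<Theta> c" h]
        by (simp add: \<Phi>_def T sum.distrib algebra_simps)
      also have "(\<Sum>j<n. smooth_grad p n \<kappa> (\<Theta> c) j * h j) = sg b * \<eta> l * v c i"
        by (simp add: v_def h_def sum_distrib_left mult_ac)
      also have "(\<Sum>j<n. h j * y j) = sg b * \<eta> l * (\<Sum>j<n. x i j * y j)"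
        by (simp add: h_def sum_distrib_left mult_ac)
      also have "(ell_norm p n h)\<^sup>2 \<le> (\<eta> l * R)\<^sup>2"
      proof -
        have "ell_norm p n h = \<eta> l * ell_norm p n (x i)"
          using p \<eta> ell_norm_scale[of p n "sg b * \<eta> l" "x i"] by (simp add: h_def[abs_def] sg_def abs_mult)
        also have "\<dots> \<le> \<eta> l * R" using x[OF i(1)] \<eta> by simp
        finally show ?thesis using ell_norm_nonneg by (intro power_mono)
      qed
      also have "sg b * \<eta> l * v c i + (p - 1) / 2 * (\<eta> l * R)\<^sup>2 - sg b * \<eta> l * (\<Sum>j<n. x i j * y j)
        = (p - 1) / 2 * (\<eta> l * R)\<^sup>2 - \<eta> l * \<bar>(\<Sum>j<n. x i j * y j) - v c i\<bar>"
        by (auto simp: sg_def b_def right_diff_distrib)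
      also have "\<dots> \<le> (p - 1) / 2 * (\<eta> l * R)\<^sup>2 - \<eta> l * (R / 2 ^ l / K)"
        using i(2) \<eta> by (intro diff_left_mono mult_left_mono) auto
      also have "\<dots> = - (d * (1/4) ^ l)"
      proof -
        have "(4::real) ^ l = 2 ^ l * 2 ^ l" by (simp flip: power_mult_distrib)
        moreover have "(P / 2) * ((1 / (z * K * P * R)) * R)\<^sup>2 - (1 / (z * K * P * R)) * (R / z / K)
          = - ((1 / (2 * P * K\<^sup>2)) * (1 / (z * z)))" if "P > 0" "z > 0" for P z
          using that K R by (simp add: power2_eq_square field_simps)
        from this[of "p - 1" "2 ^ l"] p have "(p - 1) / 2 * (\<eta> l * R)\<^sup>2 - \<eta> l * (R / 2 ^ l / K)
          = - (d * (1 / (2 ^ l * 2 ^ l)))" by (simp add: \<eta>_def d_def)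
        ultimately show ?thesis by (simp add: power_divide)
      qed
      finally have "\<Phi> ((i, b, l) # c) \<le> \<Phi> c - d * (1/4) ^ l"
        using p by simp
      with i l show ?thesis by (intro bexI[of _ "(i, b, l)"]) (auto simp: A_def)
    qed
    have "\<exists>c. (\<forall>l<L. set (c l) \<subseteq> A \<and> (\<forall>i<m. \<bar>(\<Sum>j<n. x i j * y j) - v (c l) i\<bar> \<le> R / 2 ^ l / K)) \<and>
      (\<Sum>l<L. (1/4) ^ l * real (length (c l))) \<le> 4/3 * (\<Phi> [] - (-1/2)) / d"
      by (rule multiscale_descent[OF d lower step])
    then obtain c where c: "\<forall>l<L. set (c l) \<subseteq> A \<and> (\<forall>i<m. \<bar>(\<Sum>j<n. x i j * y j) - v (c l) i\<bar> \<le> R / 2 ^ l / K)"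
      "(\<Sum>l<L. (1/4) ^ l * real (length (c l))) \<le> 4/3 * (\<Phi> [] - (-1/2)) / d"
      by (elim exE conjE)
    have "\<Phi> [] \<le> 1/2" using pot0 by (simp add: \<Phi>_def \<Theta>_def[abs_def])
    then have "4/3 * (\<Phi> [] - (-1/2)) / d \<le> 4/3 * 1 / d"
      using d by (intro divide_right_mono) auto
    also have "\<dots> = 8 / 3 * (p - 1) * K\<^sup>2" by (simp add: d_def)
    finally have "(\<Sum>l<L. (1/4) ^ l * real (length (c l))) \<le> 8 / 3 * (p - 1) * K\<^sup>2"
      using c(2) by linarith
    with c(1) show ?thesis by (intro exI[of _ c] conjI)
  qed
  then show ?thesis unfolding A_def by (intro exI[of _ v] allI impI)
qed

section \<open>Rademacher sums over adaptive nets\<close>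

text \<open>Young's inequality for \<open>x\<close> and \<open>y powr (q - 1)\<close>. This tangent
  form of convexity stands in for Jensen's inequality later, both for weighted sums and for
  expectations.\<close>

lemma powr_tangent:
  fixes x y q :: real
  assumes "q > 1" "x \<ge> 0" "y \<ge> 0"
  shows "y powr q + q * y powr (q - 1) * (x - y) \<le> x powr q"
proof (cases "y = 0")
  case False
  with assms have y: "y > 0" by simp
  have "x * y powr (q - 1) \<le> x powr q / q + (y powr (q - 1)) powr (q / (q - 1)) / (q / (q - 1))"
    using assms by (intro Youngs_inequality) (auto simp: field_simps)
  also have "(y powr (q - 1)) powr (q / (q - 1)) = y powr q"
    using assms by (simp add: powr_powr)
  finally have "q * (x * y powr (q - 1)) \<le> q * (x powr q / q + y powr q / (q / (q - 1)))"
    using assms by (intro mult_left_mono) auto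
  also have "\<dots> = x powr q + (q - 1) * y powr q"
    using assms by (simp add: field_simps)
  finally have "q * (x * y powr (q - 1)) \<le> x powr q + (q - 1) * y powr q" .
  moreover have "y powr (q - 1) * y = y powr q"
    using y by (simp add: powr_mult_base mult.commute)
  moreover have "q * y powr (q - 1) * (x - y) = q * (x * y powr (q - 1)) - q * (y powr (q - 1) * y)"
    by (simp add: algebra_simps)
  moreover have "(q - 1) * y powr q = q * y powr q - y powr q"
    by (simp add: left_diff_distrib)
  ultimately show ?thesis by simp
qed (use assms in auto)

lemma powr_diff_le:
  fixes a b s q :: real
  assumes "q > 1" "0 \<le> a" "0 \<le> b" "a \<le> s" "b \<le> s"
  shows "\<bar>a powr q - b powr q\<bar> \<le> q * s powr (q - 1) * \<bar>a - b\<bar>"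
proof -
  have *: "v powr q - u powr q \<le> q * s powr (q - 1) * (v - u)" if "0 \<le> u" "u \<le> v" "v \<le> s" for u v
  proof -
    have "v powr q - u powr q \<le> q * v powr (q - 1) * (v - u)"
      using powr_tangent[of q u v] that assms(1) by (simp add: algebra_simps)
    also have "\<dots> \<le> q * s powr (q - 1) * (v - u)"
      using that assms(1) by (intro mult_right_mono mult_left_mono powr_mono2) auto
    finally show ?thesis .
  qed
  show ?thesis
  proof (cases "a \<le> b")
    case True
    with assms have "a powr q \<le> b powr q" by (intro powr_mono2) auto
    with *[of a b] True assms show ?thesis by (simp add: abs_if)
  next
    case False
    with assms have "b powr q \<le> a powr q" by (intro powr_mono2) auto
    with *[of b a] False assms show ?thesis by (simp add: abs_if)
  qed
qed

text \<open>A sign vector is coded by the set where it is positive, so an average over Rademacher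
  signs is a sum over \<open>Pow I\<close> divided by \<open>2 ^ card I\<close>.\<close>

definition rsign :: "'a set \<Rightarrow> 'a \<Rightarrow> real" where
  "rsign S i = (if i \<in> S then 1 else -1)"

text \<open>With \<open>t = \<delta> * \<psi> i / B\<close>, the average over one sign is at most
  \<open>exp (t * t - t * \<delta>)\<close>, and \<open>t \<le> \<delta>\<close> makes this at most
  1. The offset thus pays for the variance completely.\<close>

lemma rademacher_mgf:
  fixes \<psi> :: "'a \<Rightarrow> real"
  assumes I: "finite I" and \<psi>: "\<And>i. i \<in> I \<Longrightarrow> 0 \<le> \<psi> i \<and> \<psi> i \<le> B" and B: "B > 0" and \<delta>: "0 < \<delta>" "\<delta> \<le> 1"
  shows "(\<Sum>S\<in>Pow I. exp (\<delta> / B * (\<Sum>i\<in>I. (rsign S i - \<delta>) * \<psi> i))) \<le> 2 ^ card I"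
proof -
  define f where "f e i = exp (\<delta> / B * ((e - \<delta>) * \<psi> i))" for e :: real and i
  have "(\<Sum>S\<in>Pow I. exp (\<delta> / B * (\<Sum>i\<in>I. (rsign S i - \<delta>) * \<psi> i)))
      = (\<Sum>S\<in>Pow I. (\<Prod>i\<in>S. f 1 i) * (\<Prod>i\<in>I - S. f (-1) i))"
  proof (rule sum.cong[OF refl])
    fix S assume S: "S \<in> Pow I"
    have "exp (\<delta> / B * (\<Sum>i\<in>I. (rsign S i - \<delta>) * \<psi> i)) = (\<Prod>i\<in>I. f (rsign S i) i)"
      using I by (simp add: f_def sum_distrib_left exp_sum)
    also have "\<dots> = (\<Prod>i\<in>S. f (rsign S i) i) * (\<Prod>i\<in>I - S. f (rsign S i) i)"
      using S I by (subst prod.subset_diff[of S I]) (auto simp: mult.commute)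
    also have "\<dots> = (\<Prod>i\<in>S. f 1 i) * (\<Prod>i\<in>I - S. f (-1) i)"
      by (intro arg_cong2[where f = "(*)"] prod.cong) (auto simp: rsign_def)
    finally show "exp (\<delta> / B * (\<Sum>i\<in>I. (rsign S i - \<delta>) * \<psi> i)) = (\<Prod>i\<in>S. f 1 i) * (\<Prod>i\<in>I - S. f (-1) i)" .
  qed
  also have "\<dots> = (\<Prod>i\<in>I. f 1 i + f (-1) i)"
    using I by (simp add: prod_add)
  also have "\<dots> \<le> (\<Prod>i\<in>I. 2)"
  proof (rule prod_mono)
    fix i assume i: "i \<in> I"
    define t where "t = \<delta> * \<psi> i / B"
    have t: "0 \<le> t" "t \<le> \<delta>"
      using \<psi>[OF i] B \<delta> by (auto simp: t_def field_simps)
    have "f 1 i + f (-1) i = exp (- (t * \<delta>)) * (exp t + exp (- t))"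
      unfolding f_def t_def using B by (simp add: distrib_left flip: exp_add) (simp add: field_simps)
    also have "\<dots> \<le> exp (- (t * \<delta>)) * (2 * exp (t * t))"
    proof (intro mult_left_mono)
      have "exp t \<le> 1 + t + t\<^sup>2"
        using t \<delta> by (intro exp_bound) auto
      moreover have "exp (- t) \<le> 1 - t + t\<^sup>2"
      proof -
        have "1 \<le> (1 - t + t\<^sup>2) * (1 + t)"
          using t by (simp add: algebra_simps power2_eq_square)
        also have "\<dots> \<le> (1 - t + t\<^sup>2) * exp t"
          using exp_ge_add_one_self[of t] zero_le_power2[of "t - 1/2"]
          by (intro mult_left_mono) (auto simp: power2_eq_square algebra_simps)
        finally show ?thesis by (simp add: exp_minus field_simps)
      qed
      moreover have "1 + t\<^sup>2 \<le> exp (t * t)"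
        using exp_ge_add_one_self[of "t * t"] by (simp only: power2_eq_square)
      ultimately show "exp t + exp (- t) \<le> 2 * exp (t * t)" by linarith
    qed simp
    also have "\<dots> = 2 * exp (t * t - t * \<delta>)"
      by (simp add: exp_diff exp_minus field_simps)
    also have "\<dots> \<le> 2 * 1"
      using t by (intro mult_left_mono) (auto simp: mult_left_mono)
    finally show "0 \<le> f 1 i + f (-1) i \<and> f 1 i + f (-1) i \<le> 2"
      by (simp add: f_def add_nonneg_nonneg)
  qed
  finally show ?thesis by simp
qed

text \<open>
  The differences \<open>cut q s v - cut q (s / 2) v\<close> over dyadic \<open>s\<close> split \<open>\<bar>v\<bar> powr q\<close> into layers. Each layer has a
  small Lipschitz constant and vanishes for \<open>\<bar>v\<bar> \<le> s / 2\<close>, so the error of replacing \<open>v\<close> by an approximant at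
  scale \<open>s / K\<close> is absorbed into a fraction of \<open>\<bar>v\<bar> powr q\<close> itself.
\<close>

definition cut :: "real \<Rightarrow> real \<Rightarrow> real \<Rightarrow> real" where
  "cut q s v = min \<bar>v\<bar> s powr q"

text \<open>The scales not exceeding \<open>z\<close> form a geometric series of ratio
  \<open>2 powr (- q) \<le> 1/4\<close>. Truncating every scale at \<open>z\<close> lets the terms
  telescope without naming the first scale below \<open>z\<close>.\<close>

lemma sum_scales_below:
  fixes q R z :: real
  assumes q: "q \<ge> 2" and R: "R > 0" and z: "z \<ge> 0"
  shows "(\<Sum>l<L. if R / 2 ^ l \<le> z then (R / 2 ^ l) powr q else 0) \<le> 4 / 3 * z powr q"
proof -
  define t where "t l = min (R / 2 ^ l) z powr q" for l :: nat
  have "(if R / 2 ^ l \<le> z then (R / 2 ^ l) powr q else 0) \<le> 4 / 3 * (t l - t (Suc l))" for l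
  proof (cases "R / 2 ^ l \<le> z")
    case True
    have "(R / 2 ^ Suc l) powr q = (R / 2 ^ l) powr q / 2 powr q"
      using R by (simp add: powr_divide powr_mult)
    also have "\<dots> \<le> (R / 2 ^ l) powr q / 2 powr 2"
      using q by (intro divide_left_mono powr_mono) auto
    finally have "(R / 2 ^ Suc l) powr q \<le> (R / 2 ^ l) powr q / 4" by simp
    moreover have "R / 2 ^ Suc l \<le> R / 2 ^ l" using R by (simp add: field_simps)
    then have "t (Suc l) = (R / 2 ^ Suc l) powr q" using True by (simp add: t_def min_def)
    ultimately show ?thesis using True by (simp add: t_def min_def)
  next
    case False
    have "R / 2 ^ Suc l \<le> R / 2 ^ l" using R by (simp add: field_simps)
    then have "t (Suc l) \<le> t l"
      unfolding t_def using R z q by (intro powr_mono2) (auto simp: min_def)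
    then show ?thesis using False by simp
  qed
  then have "(\<Sum>l<L. if R / 2 ^ l \<le> z then (R / 2 ^ l) powr q else 0) \<le> (\<Sum>l<L. 4 / 3 * (t l - t (Suc l)))"
    by (intro sum_mono)
  also have "\<dots> = 4 / 3 * (\<Sum>l<L. t l - t (Suc l))"
    by (simp only: sum_distrib_left)
  also have "\<dots> = 4 / 3 * (t 0 - t L)"
    by (simp only: sum_lessThan_telescope')
  also have "\<dots> \<le> 4 / 3 * z powr q"
  proof -
    have "t 0 \<le> z powr q" "t L \<ge> 0"
      unfolding t_def using R z q by (auto intro!: powr_mono2)
    then show ?thesis by simp
  qed
  finally show ?thesis .
qed

text \<open>Weakening \<open>e - \<delta>\<close> to \<open>e - \<delta> / 2\<close> frees
  \<open>\<delta> / 2 * \<bar>v\<bar> powr q\<close>, which absorbs the errors of using a different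
  approximant \<open>u l\<close> in each layer. These errors are summable because only scales up to
  \<open>4 * \<bar>v\<bar>\<close> contribute. What lies below the scale \<open>R / 2 ^ L\<close> is
  not approximated and costs the last term.\<close>

lemma layered_offset_bound:
  fixes u :: "nat \<Rightarrow> real"
  assumes q: "q \<ge> 2" and R: "R > 0" and v: "\<bar>v\<bar> \<le> R" and \<delta>: "0 < \<delta>" "\<delta> \<le> 1" and e: "\<bar>e\<bar> \<le> 1"
    and K: "K = 11 * q * 4 powr q / \<delta>"
    and u: "\<And>l. l < L \<Longrightarrow> \<bar>v - u l\<bar> \<le> R / 2 ^ l / K"
  shows "(e - \<delta>) * \<bar>v\<bar> powr q \<le>
    (\<Sum>l<L. (e - \<delta> / 2) * (cut q (R / 2 ^ l) (u l) - cut q (R / 2 ^ Suc l) (u l))) + 2 * (R / 2 ^ L) powr q"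
proof -
  define s where "s l = R / 2 ^ l" for l :: nat
  define \<psi> where "\<psi> l z = cut q (s l) z - cut q (s (Suc l)) z" for l z
  have s: "s l > 0" "s (Suc l) = s l / 2" for l using R by (simp_all add: s_def)
  have K4: "K \<ge> 4" 
  proof -
    have "1 \<le> (4::real) powr q" using q by (intro ge_one_powr_ge_zero) auto
    then have "2 * 1 \<le> q * 4 powr q" using q by (intro mult_mono) auto
    then have "22 * \<delta> \<le> 11 * q * 4 powr q" using \<delta> by linarith
    then show ?thesis using \<delta> by (simp add: K field_simps)
  qed
  have cut_lip: "\<bar>cut q t a - cut q t b\<bar> \<le> q * t powr (q - 1) * \<bar>a - b\<bar>" if "t > 0" for t a b
  proof -
    have "\<bar>cut q t a - cut q t b\<bar> \<le> q * t powr (q - 1) * \<bar>min \<bar>a\<bar> t - min \<bar>b\<bar> t\<bar>"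
      unfolding cut_def using q that by (intro powr_diff_le) auto
    also have "\<dots> \<le> q * t powr (q - 1) * \<bar>a - b\<bar>"
      using q by (intro mult_left_mono) (auto simp: min_def)
    finally show ?thesis .
  qed
  have cut_lip': "\<bar>cut q t v - cut q t (u l)\<bar> \<le> q * s l powr q / K" if "l < L" "0 < t" "t \<le> s l" for l t
  proof -
    have "\<bar>cut q t v - cut q t (u l)\<bar> \<le> q * t powr (q - 1) * \<bar>v - u l\<bar>"
      by (rule cut_lip[OF that(2)])
    also have "\<dots> \<le> q * s l powr (q - 1) * (s l / K)"
      using q that u[OF that(1)] by (intro mult_mono powr_mono2) (auto simp: s_def)
    also have "\<dots> = q * s l powr q / K"
      using s(1)[of l] powr_mult_base[of "s l" "q - 1"] by (simp add: mult.commute)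
    finally show ?thesis .
  qed
  \<comment> \<open>At larger scales the error is at most \<open>s l / 4\<close>, since
    \<open>K \<ge> 4\<close>, so \<open>v\<close> and \<open>u l\<close> are both at most
    \<open>s l / 2\<close> in absolute value and the layer vanishes at both.\<close>
  have \<Delta>: "\<bar>\<psi> l v - \<psi> l (u l)\<bar> \<le> 2 * q / K * (if s l \<le> 4 * \<bar>v\<bar> then s l powr q else 0)" if l: "l < L" for l
  proof (cases "s l \<le> 4 * \<bar>v\<bar>")
    case True
    have "\<bar>\<psi> l v - \<psi> l (u l)\<bar> \<le> \<bar>cut q (s l) v - cut q (s l) (u l)\<bar> + \<bar>cut q (s (Suc l)) v - cut q (s (Suc l)) (u l)\<bar>"
      by (simp add: \<psi>_def)
    also have "\<dots> \<le> q * s l powr q / K + q * s l powr q / K"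
      using s(1)[of l] by (intro add_mono cut_lip' l) (auto simp: s(2))
    finally show ?thesis using True by simp
  next
    case False
    have "s l / K \<le> s l / 4" using s(1)[of l] K4 by (intro divide_left_mono) auto
    moreover have "\<bar>v - u l\<bar> \<le> s l / K" using u[OF l] by (simp add: s_def)
    ultimately have "\<bar>v\<bar> \<le> s l / 2" "\<bar>u l\<bar> \<le> s l / 2" using False by linarith+
    then have "\<psi> l v = 0" "\<psi> l (u l) = 0" using s(1)[of l]
      by (auto simp: \<psi>_def cut_def s(2) min_def)
    then show ?thesis using False by simp
  qed
  have "(\<Sum>l<L. \<bar>\<psi> l v - \<psi> l (u l)\<bar>) \<le> (\<Sum>l<L. 2 * q / K * (if s l \<le> 4 * \<bar>v\<bar> then s l powr q else 0))"
    by (intro sum_mono \<Delta>) auto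
  also have "\<dots> = 2 * q / K * (\<Sum>l<L. if s l \<le> 4 * \<bar>v\<bar> then s l powr q else 0)"
    by (simp add: sum_distrib_left)
  \<comment> \<open>Here the choice of \<open>K\<close> enters:
    \<open>2 * q / K * 4 / 3 * 4 powr q\<close> equals \<open>\<delta> * 8 / 33\<close>, just below
    \<open>\<delta> / 4\<close>.\<close>
  also have "\<dots> \<le> 2 * q / K * (4 / 3 * (4 * \<bar>v\<bar>) powr q)"
    using q K4 unfolding s_def by (intro mult_left_mono sum_scales_below R) auto
  also have "\<dots> = \<delta> * (8 / 33) * \<bar>v\<bar> powr q"
    using q \<delta> by (simp add: K powr_mult)
  also have "\<dots> \<le> \<delta> * (1 / 4) * \<bar>v\<bar> powr q"
    using \<delta> by (intro mult_right_mono mult_left_mono) auto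
  finally have D: "(\<Sum>l<L. \<bar>\<psi> l v - \<psi> l (u l)\<bar>) \<le> \<delta> / 4 * \<bar>v\<bar> powr q" by simp
  have tel: "(\<Sum>l<L. \<psi> l v) = \<bar>v\<bar> powr q - cut q (s L) v"
  proof -
    have "(\<Sum>l<L. \<psi> l v) = cut q (s 0) v - cut q (s L) v"
      unfolding \<psi>_def by (rule sum_lessThan_telescope')
    also have "cut q (s 0) v = \<bar>v\<bar> powr q" using v by (simp add: cut_def s_def)
    finally show ?thesis .
  qed
  have cutL: "0 \<le> cut q (s L) v" "cut q (s L) v \<le> s L powr q"
    using q s(1)[of L] by (auto simp: cut_def intro!: powr_mono2)
  have "(e - \<delta> / 2) * (\<psi> l v - \<psi> l (u l)) \<le> 2 * \<bar>\<psi> l v - \<psi> l (u l)\<bar>" for l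
  proof -
    have "\<bar>e - \<delta> / 2\<bar> \<le> 2" using e \<delta> by linarith
    then have "\<bar>e - \<delta> / 2\<bar> * \<bar>\<psi> l v - \<psi> l (u l)\<bar> \<le> 2 * \<bar>\<psi> l v - \<psi> l (u l)\<bar>"
      by (intro mult_right_mono) auto
    then show ?thesis by (simp flip: abs_mult)
  qed
  then have "(\<Sum>l<L. (e - \<delta> / 2) * (\<psi> l v - \<psi> l (u l))) \<le> (\<Sum>l<L. 2 * \<bar>\<psi> l v - \<psi> l (u l)\<bar>)"
    by (intro sum_mono)
  also have "\<dots> \<le> \<delta> / 2 * \<bar>v\<bar> powr q"
    using D by (simp flip: sum_distrib_left)
  finally have 1: "(e - \<delta> / 2) * (\<Sum>l<L. \<psi> l v) - (\<Sum>l<L. (e - \<delta> / 2) * \<psi> l (u l)) \<le> \<delta> / 2 * \<bar>v\<bar> powr q"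
    by (simp add: right_diff_distrib sum_subtractf flip: sum_distrib_left)
  have 2: "(e - \<delta> / 2) * cut q (s L) v \<le> 1 * cut q (s L) v"
    using e \<delta> cutL by (intro mult_right_mono) auto
  have "(e - \<delta>) * \<bar>v\<bar> powr q = (e - \<delta> / 2) * (\<bar>v\<bar> powr q - cut q (s L) v) 
     + (e - \<delta> / 2) * cut q (s L) v - \<delta> / 2 * \<bar>v\<bar> powr q"
    by (simp add: algebra_simps)
  also have "\<dots> \<le> (\<Sum>l<L. (e - \<delta> / 2) * \<psi> l (u l)) + cut q (s L) v"
    using 1 2 unfolding tel by linarith
  also have "\<dots> \<le> (\<Sum>l<L. (e - \<delta> / 2) * \<psi> l (u l)) + 2 * s L powr q"
    using cutL by linarith
  finally show ?thesis by (simp add: \<psi>_def s_def)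
qed

text \<open>A Kraft-type inequality: there are \<open>card A ^ k\<close> words of length
  \<open>k\<close>, so together they weigh at most \<open>(1/2) ^ k\<close>.\<close>

lemma sum_list_weights_le:
  fixes C :: "'a list set"
  assumes A: "finite A" "A \<noteq> {}" and C: "finite C" "\<And>c. c \<in> C \<Longrightarrow> set c \<subseteq> A"
  shows "(\<Sum>c\<in>C. (1 / (2 * real (card A))) ^ length c) \<le> 2"
proof -
  define N where "N = Max (insert 0 (length ` C))"
  define T where "T = {c. set c \<subseteq> A \<and> length c \<le> N}"
  define r where "r = 1 / (2 * real (card A))"
  have T: "finite T" unfolding T_def by (rule finite_lists_length_le[OF A(1)])
  have "C \<subseteq> T" using C by (auto simp: T_def N_def)
  then have "(\<Sum>c\<in>C. r ^ length c) \<le> (\<Sum>c\<in>T. r ^ length c)"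
    using T by (intro sum_mono2) (auto simp: r_def)
  also have "\<dots> = (\<Sum>k\<le>N. \<Sum>c\<in>{c \<in> T. length c = k}. r ^ length c)"
    using T by (intro sum.group[symmetric]) (auto simp: T_def)
  also have "\<dots> = (\<Sum>k\<le>N. (1/2) ^ k)"
  proof (rule sum.cong[OF refl])
    fix k assume "k \<in> {..N}"
    then have "{c \<in> T. length c = k} = {c. set c \<subseteq> A \<and> length c = k}" by (auto simp: T_def)
    then have "card {c \<in> T. length c = k} = card A ^ k"
      using card_lists_length_eq[OF A(1)] by simp
    then have "(\<Sum>c\<in>{c \<in> T. length c = k}. r ^ length c) = (real (card A) * r) ^ k"
      by (simp add: power_mult_distrib)
    also have "real (card A) * r = 1/2" using A by (simp add: r_def card_gt_0_iff)
    finally show "(\<Sum>c\<in>{c \<in> T. length c = k}. r ^ length c) = (1/2) ^ k" .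
  qed
  also have "\<dots> \<le> 2" using sum_gp[of "1/2::real" 0 N] by (simp add: atMost_atLeast0)
  finally show ?thesis by (simp add: r_def)
qed

text \<open>
  The union bound gives a codeword \<open>c\<close> the weight \<open>(2 card A) powr (- length c)\<close>. A layer at scale \<open>R / 2 ^ l\<close>
  then costs at most \<open>R powr q * (1/4) ^ l * length c\<close>, up to logarithms, because \<open>q \<ge> 2\<close>; the sum over the layers
  is bounded by \<open>H\<close>, with no loss from the number of scales.
\<close>

lemma rademacher_chaining:
  fixes V :: "(nat \<Rightarrow> real) set" and w :: "'a list \<Rightarrow> nat \<Rightarrow> real"
  assumes V: "finite V" "V \<noteq> {}" and m: "m \<ge> 1" and q: "q \<ge> 2" and R: "R > 0"
    and A: "finite A" "A \<noteq> {}" and \<delta>: "0 < \<delta>" "\<delta> \<le> 1" and K: "K = 11 * q * 4 powr q / \<delta>"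
    and VR: "\<And>v i. v \<in> V \<Longrightarrow> i < m \<Longrightarrow> \<bar>v i\<bar> \<le> R"
    and net: "\<And>v. v \<in> V \<Longrightarrow> \<exists>c. (\<forall>l<m. set (c l) \<subseteq> A \<and> (\<forall>i<m. \<bar>v i - w (c l) i\<bar> \<le> R / 2 ^ l / K)) \<and>
      (\<Sum>l<m. (1/4) ^ l * real (length (c l))) \<le> H"
  shows "(\<Sum>S\<in>Pow {..<m}. MAX v\<in>V. \<Sum>i<m. (rsign S i - \<delta>) * \<bar>v i\<bar> powr q) \<le>
    2 ^ m * (R powr q * (2 / \<delta> * (4 + 2 * ln (real m) + H * ln (2 * real (card A))) + 2))"
proof -
  define good where "good v c \<longleftrightarrow> (\<forall>l<m. set (c l) \<subseteq> A \<and> (\<forall>i<m. \<bar>v i - w (c l) i\<bar> \<le> R / 2 ^ l / K)) \<and>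
      (\<Sum>l<m. (1/4) ^ l * real (length (c l))) \<le> H" for v c
  have "\<forall>v\<in>V. \<exists>c. good v c" using net by (simp add: good_def)
  then have "\<exists>c. \<forall>v\<in>V. good v (c v)" by (rule bchoice)
  then obtain c where "\<forall>v\<in>V. good v (c v)" ..
  then have c: "\<And>v l. v \<in> V \<Longrightarrow> l < m \<Longrightarrow> set (c v l) \<subseteq> A"
    "\<And>v l i. v \<in> V \<Longrightarrow> l < m \<Longrightarrow> i < m \<Longrightarrow> \<bar>v i - w (c v l) i\<bar> \<le> R / 2 ^ l / K"
    "\<And>v. v \<in> V \<Longrightarrow> (\<Sum>l<m. (1/4) ^ l * real (length (c v l))) \<le> H"
    by (simp_all add: good_def)
  define C where "C = (\<Union>v\<in>V. c v ` {..<m})"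
  have C: "finite C" "\<And>a. a \<in> C \<Longrightarrow> set a \<subseteq> A" "C \<noteq> {}"
    using V c(1) m by (auto simp: C_def lessThan_empty_iff)
  define \<Lambda> where "\<Lambda> = ln (2 * real (card A))"
  have cA: "card A \<ge> 1" using A by (simp add: Suc_le_eq card_gt_0_iff)
  have \<Lambda>: "\<Lambda> \<ge> 0" using cA by (simp add: \<Lambda>_def)
  define s where "s l = R / 2 ^ l" for l :: nat
  have s: "s l > 0" for l using R by (simp add: s_def)
  have sq: "s l powr q \<le> R powr q * (1/4) ^ l" for l
  proof -
    have "s l powr q = R powr q / (2 ^ l) powr q" using R by (simp add: s_def powr_divide)
    also have "\<dots> \<le> R powr q / (2 ^ l) powr 2"
      using q by (intro divide_left_mono powr_mono) auto
    also have "(2 ^ l) powr 2 = (4::real) ^ l"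
      by (simp add: power2_eq_square flip: power_mult_distrib)
    finally show ?thesis by (simp add: power_divide)
  qed
  define \<psi> where "\<psi> l z = cut q (s l) z - cut q (s (Suc l)) z" for l z
  have \<psi>: "0 \<le> \<psi> l z \<and> \<psi> l z \<le> s l powr q" for l z
  proof -
    have "s (Suc l) \<le> s l" using R by (simp add: s_def field_simps)
    then have "cut q (s (Suc l)) z \<le> cut q (s l) z"
      unfolding cut_def using q s[of "Suc l"] by (intro powr_mono2) auto
    moreover have "cut q (s l) z \<le> s l powr q" "0 \<le> cut q (s (Suc l)) z"
      unfolding cut_def using q s[of l] by (auto intro!: powr_mono2)
    ultimately show ?thesis by (simp add: \<psi>_def)
  qed
  \<comment> \<open>One half of the offset is spent in \<open>layered_offset_bound\<close>; the
    other half drives the exponential moments.\<close>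
  define \<delta>' where "\<delta>' = \<delta> / 2"
  have \<delta>': "0 < \<delta>'" "\<delta>' \<le> 1" using \<delta> by (auto simp: \<delta>'_def)
  define Z where "Z S l a = (\<Sum>i<m. (rsign S i - \<delta>') * \<psi> l (w a i))" for S l a
  define r where "r = 1 / (2 * real (card A))"
  have r: "r > 0" "ln r = - \<Lambda>" using cA by (simp_all add: r_def \<Lambda>_def ln_div)
  \<comment> \<open>A single quantity that controls all layers and all words at once; its average
    over \<open>S\<close> is at most \<open>2 * m\<close>.\<close>
  define E where "E S = (\<Sum>l<m. \<Sum>a\<in>C. exp (\<delta>' / s l powr q * Z S l a) * r ^ length a)" for S
  have E_ge: "exp (\<delta>' / s l powr q * Z S l a) * r ^ length a \<le> E S" if "l < m" "a \<in> C" for S l a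
  proof -
    have "exp (\<delta>' / s l powr q * Z S l a) * r ^ length a
      \<le> (\<Sum>a\<in>C. exp (\<delta>' / s l powr q * Z S l a) * r ^ length a)"
      using that C r by (intro member_le_sum) (auto intro!: mult_nonneg_nonneg)
    also have "\<dots> \<le> E S"
      unfolding E_def using that r
      by (intro member_le_sum[of l]) (auto intro!: sum_nonneg mult_nonneg_nonneg)
    finally show ?thesis .
  qed
  have E0: "E S > 0" for S
  proof -
    obtain a where "a \<in> C" using C by blast
    then have "exp (\<delta>' / s 0 powr q * Z S 0 a) * r ^ length a \<le> E S"
      using m by (intro E_ge) auto
    moreover have "exp (\<delta>' / s 0 powr q * Z S 0 a) * r ^ length a > 0" using r by simp
    ultimately show ?thesis by linarith
  qed
  have Z_le: "Z S l a \<le> R powr q / \<delta>' * ((1/4) ^ l * (E S / m + ln m) + (1/4) ^ l * real (length a) * \<Lambda>)"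
    if "l < m" "a \<in> C" for S l a
  proof -
    have pos: "exp (\<delta>' / s l powr q * Z S l a) * r ^ length a > 0" using r by simp
    have "\<delta>' / s l powr q * Z S l a - real (length a) * \<Lambda> = ln (exp (\<delta>' / s l powr q * Z S l a) * r ^ length a)"
      using r by (simp add: ln_mult ln_realpow)
    also have "\<dots> \<le> ln (E S)"
      using E_ge[OF that] pos by (intro ln_mono) auto
    \<comment> \<open>Dividing by \<open>m\<close> before using \<open>ln x \<le> x\<close> leaves a
      term linear in \<open>E S\<close> with average at most 2. This replaces Jensen's inequality
      for the logarithm, at the price of one \<open>ln m\<close>.\<close>
    also have "\<dots> = ln (E S / m) + ln m" using E0[of S] m by (simp add: ln_div)
    also have "ln (E S / m) \<le> E S / m" using E0[of S] m by (intro ln_bound) auto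
    finally have "\<delta>' / s l powr q * Z S l a \<le> E S / m + ln m + real (length a) * \<Lambda>" by simp
    then have "Z S l a \<le> s l powr q / \<delta>' * (E S / m + ln m + real (length a) * \<Lambda>)"
      using s[of l] \<delta>' by (simp add: field_simps)
    also have "\<dots> \<le> R powr q * (1/4) ^ l / \<delta>' * (E S / m + ln m + real (length a) * \<Lambda>)"
      using sq[of l] \<delta>' \<Lambda> m E0[of S]
      by (intro mult_right_mono divide_right_mono) (auto intro!: add_nonneg_nonneg)
    finally show ?thesis by (simp add: algebra_simps add_divide_distrib)
  qed
  have geo: "(\<Sum>l<m. (1/4::real) ^ l) \<le> 2"
  proof -
    have "(\<Sum>l<m. (1/4::real) ^ l) * 3 = 4 - (1/4) ^ m * 4"
      using sum_gp_strict[of "1/4::real" m] by simp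
    then show ?thesis using zero_le_power[of "1/4::real" m] by linarith
  qed
  \<comment> \<open>Stopping after \<open>m\<close> scales is enough: the remainders of all
    \<open>m\<close> rows together are of order \<open>R powr q\<close>.\<close>
  have msq: "real m * s m powr q \<le> R powr q"
  proof -
    have "real m \<le> 4 ^ m"
      using less_exp[of m] power_mono[of "2::real" 4 m] of_nat_less_iff[of m "2^m", where 'a = real] by simp
    then have "real m * s m powr q \<le> 4 ^ m * (R powr q * (1/4) ^ m)"
      using sq[of m] by (intro mult_mono) auto
    also have "\<dots> = R powr q" by (simp add: power_divide)
    finally show ?thesis .
  qed
  have main: "(MAX v\<in>V. \<Sum>i<m. (rsign S i - \<delta>) * \<bar>v i\<bar> powr q) \<le>
      R powr q / \<delta>' * (2 * (E S / m + ln m) + H * \<Lambda>) + 2 * R powr q" for S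
  proof (rule Max.boundedI)
    show "finite ((\<lambda>v. \<Sum>i<m. (rsign S i - \<delta>) * \<bar>v i\<bar> powr q) ` V)" using V by simp
    show "(\<lambda>v. \<Sum>i<m. (rsign S i - \<delta>) * \<bar>v i\<bar> powr q) ` V \<noteq> {}" using V by simp
    fix t assume "t \<in> (\<lambda>v. \<Sum>i<m. (rsign S i - \<delta>) * \<bar>v i\<bar> powr q) ` V"
    then obtain v where v: "v \<in> V" "t = (\<Sum>i<m. (rsign S i - \<delta>) * \<bar>v i\<bar> powr q)" by blast
    have "t \<le> (\<Sum>i<m. (\<Sum>l<m. (rsign S i - \<delta>') * \<psi> l (w (c v l) i)) + 2 * s m powr q)"
      unfolding v(2)
    proof (rule sum_mono)
      fix i assume i: "i \<in> {..<m}"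
      then show "(rsign S i - \<delta>) * \<bar>v i\<bar> powr q \<le> (\<Sum>l<m. (rsign S i - \<delta>') * \<psi> l (w (c v l) i)) + 2 * s m powr q"
        unfolding \<psi>_def s_def \<delta>'_def
        using v VR c(2) by (intro layered_offset_bound[OF q R _ \<delta> _ K]) (auto simp: rsign_def)
    qed
    also have "\<dots> = (\<Sum>l<m. Z S l (c v l)) + 2 * (real m * s m powr q)"
      by (simp add: sum.distrib Z_def) (rule sum.swap)
    also have "\<dots> \<le> (\<Sum>l<m. R powr q / \<delta>' * ((1/4) ^ l * (E S / m + ln m) + (1/4) ^ l * real (length (c v l)) * \<Lambda>)) + 2 * R powr q"
      using msq v by (intro add_mono sum_mono Z_le) (auto simp: C_def)
    also have "\<dots> = R powr q / \<delta>' * ((\<Sum>l<m. (1/4) ^ l) * (E S / m + ln m) + (\<Sum>l<m. (1/4) ^ l * real (length (c v l))) * \<Lambda>) + 2 * R powr q"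
      by (simp only: sum.distrib sum_distrib_left[symmetric] sum_distrib_right[symmetric])
    also have "\<dots> \<le> R powr q / \<delta>' * (2 * (E S / m + ln m) + H * \<Lambda>) + 2 * R powr q"
      using geo c(3)[OF v(1)] \<Lambda> \<delta>' E0[of S] m
      by (intro add_right_mono mult_left_mono add_mono mult_right_mono) (auto intro!: add_nonneg_nonneg)
    finally show "t \<le> R powr q / \<delta>' * (2 * (E S / m + ln m) + H * \<Lambda>) + 2 * R powr q" .
  qed
  have EE: "(\<Sum>S\<in>Pow {..<m}. E S) \<le> 2 ^ m * 2 * real m"
  proof -
    have "(\<Sum>S\<in>Pow {..<m}. E S) = (\<Sum>l<m. \<Sum>S\<in>Pow {..<m}. \<Sum>a\<in>C. exp (\<delta>' / s l powr q * Z S l a) * r ^ length a)"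
      unfolding E_def by (rule sum.swap)
    also have "\<dots> = (\<Sum>l<m. \<Sum>a\<in>C. (\<Sum>S\<in>Pow {..<m}. exp (\<delta>' / s l powr q * Z S l a)) * r ^ length a)"
      unfolding sum_distrib_right by (intro sum.cong[OF refl] sum.swap)
    also have "\<dots> \<le> (\<Sum>l<m. \<Sum>a\<in>C. 2 ^ m * r ^ length a)"
    proof (intro sum_mono mult_right_mono)
      fix l a
      show "(\<Sum>S\<in>Pow {..<m}. exp (\<delta>' / s l powr q * Z S l a)) \<le> 2 ^ m"
        unfolding Z_def using rademacher_mgf[of "{..<m}" "\<lambda>i. \<psi> l (w a i)" "s l powr q" \<delta>'] \<psi> s[of l] \<delta>' by simp
    qed (use r in auto)
    also have "\<dots> = real m * (2 ^ m * (\<Sum>a\<in>C. r ^ length a))"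
      by (simp flip: sum_distrib_left)
    also have "\<dots> \<le> real m * (2 ^ m * 2)"
      using sum_list_weights_le[OF A C(1,2)] by (intro mult_left_mono) (auto simp: r_def)
    finally show ?thesis by (simp add: mult_ac)
  qed
  have "(\<Sum>S\<in>Pow {..<m}. MAX v\<in>V. \<Sum>i<m. (rsign S i - \<delta>) * \<bar>v i\<bar> powr q) \<le>
    (\<Sum>S\<in>Pow {..<m}. R powr q / \<delta>' * (2 * (E S / m + ln m) + H * \<Lambda>) + 2 * R powr q)"
    by (intro sum_mono main)
  also have "\<dots> = R powr q / \<delta>' * (2 * ((\<Sum>S\<in>Pow {..<m}. E S) / m) + 2 ^ m * (2 * ln m + H * \<Lambda>)) + 2 ^ m * (2 * R powr q)"
    by (simp add: sum.distrib card_Pow algebra_simps sum_distrib_left sum_distrib_right sum_divide_distrib)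
  also have "\<dots> \<le> R powr q / \<delta>' * (2 * ((2 ^ m * 2 * real m) / m) + 2 ^ m * (2 * ln m + H * \<Lambda>)) + 2 ^ m * (2 * R powr q)"
    using EE \<delta>' by (intro add_right_mono mult_left_mono divide_right_mono) auto
  also have "\<dots> = 2 ^ m * (R powr q * (2 / \<delta> * (4 + 2 * ln (real m) + H * ln (2 * real (card A))) + 2))"
    using m by (simp add: \<delta>'_def \<Lambda>_def algebra_simps add_divide_distrib)
  finally show ?thesis .
qed

text \<open>\<open>mirror_descent_net\<close> supplies the words and
  \<open>rademacher_chaining\<close> the union bound, with offset 1/3. The precision
  \<open>K\<close> grows exponentially in \<open>q\<close>, which is harmless. Using a bound
  \<open>r\<close> for the \<open>q\<close>-th powers of the row norms makes the estimate linear in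
  \<open>r\<close>, so it can be integrated over random rows.\<close>

lemma rademacher_rows:
  fixes x :: "nat \<Rightarrow> nat \<Rightarrow> real"
  assumes p: "p \<ge> 2" and pps: "1 / p + 1 / ps = 1" and n: "n \<ge> 1" and m: "m \<ge> 2" and q: "q \<ge> 2"
    and x: "\<And>i. i < m \<Longrightarrow> ell_norm p n (x i) powr q \<le> r"
    and Y: "finite Y" "Y \<noteq> {}" "\<And>y. y \<in> Y \<Longrightarrow> ell_norm ps n y \<le> 1"
  shows "(\<Sum>S\<in>Pow {..<m}. MAX y\<in>Y. \<Sum>i<m. (rsign S i - 1 / 3) * \<bar>\<Sum>j<n. x i j * y j\<bar> powr q) \<le>
    2 ^ m * (300000 * 256 powr q * p * ln (real m) * r)"
proof -
  have ps: "ps > 1" by (rule conjugate_exponent_gt_one[OF p pps])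
  have r0: "r \<ge> 0" using x[of 0] m powr_ge_zero order_trans by (metis less_le_trans pos2)
  have vR: "\<bar>\<Sum>j<n. x i j * y j\<bar> \<le> r powr (1 / q)" and xR: "ell_norm p n (x i) \<le> r powr (1 / q)"
    if "i < m" "y \<in> Y" for i y
  proof -
    have "ell_norm p n (x i) = (ell_norm p n (x i) powr q) powr (1 / q)"
      using q ell_norm_nonneg by (simp add: powr_powr)
    also have "\<dots> \<le> r powr (1 / q)" using q x that by (intro powr_mono2) auto
    finally show xR: "ell_norm p n (x i) \<le> r powr (1 / q)" .
    have "\<bar>\<Sum>j<n. x i j * y j\<bar> \<le> ell_norm p n (x i) * ell_norm ps n y"
      using p ps pps by (intro ell_norm_Holder) auto
    also have "\<dots> \<le> ell_norm p n (x i)" using Y(3)[OF that(2)] ell_norm_nonneg mult_left_le by blast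
    finally show "\<bar>\<Sum>j<n. x i j * y j\<bar> \<le> r powr (1 / q)" using xR by linarith
  qed
  obtain y0 where y0: "y0 \<in> Y" using Y by blast
  show ?thesis
  proof (cases "r = 0")
    case True
    have "(\<Sum>j<n. x i j * y j) = 0" if "i < m" "y \<in> Y" for i y
      using vR[OF that] True q by simp
    then have "(\<lambda>y. \<Sum>i<m. (rsign S i - 1 / 3) * \<bar>\<Sum>j<n. x i j * y j\<bar> powr q) ` Y = {0}" for S
      using y0 q by (auto simp: image_iff intro!: sum.neutral)
    then show ?thesis using True by simp
  next
    case False
    define R where "R = r powr (1 / q)"
    define K where "K = 11 * q * 4 powr q / (1 / 3)"
    define A where "A = {..<m} \<times> (UNIV :: bool set) \<times> {..<m}"
    define H where "H = 8 / 3 * (p - 1) * K\<^sup>2"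
    have R: "R > 0" "R powr q = r" using False r0 q by (simp_all add: R_def powr_powr)
    have q4: "q \<le> 4 powr q"
    proof -
      have "1 \<le> ln (4::real)" using ln2_ge_two_thirds ln_realpow[of 2 2] by simp
      then have "q * 1 \<le> q * ln 4" using q by (intro mult_left_mono) auto
      also have "q * ln 4 \<le> exp (q * ln 4)" using exp_ge_add_one_self[of "q * ln 4"] by linarith
      finally show ?thesis by (simp add: powr_def)
    qed
    have K2: "K\<^sup>2 \<le> 1089 * 256 powr q"
    proof -
      have "K \<le> 33 * 4 powr q * 4 powr q"
        using q4 by (simp add: K_def)
      also have "\<dots> = 33 * 16 powr q" by (simp add: powr_mult[symmetric])
      finally have "K\<^sup>2 \<le> (33 * 16 powr q)\<^sup>2" using q by (intro power_mono) (auto simp: K_def)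
      also have "\<dots> = 1089 * 256 powr q" by (simp add: power_mult_distrib power2_eq_square powr_mult[symmetric])
      finally show ?thesis .
    qed
    have K: "K > 0" using q by (simp add: K_def)
    obtain w :: "(nat \<times> bool \<times> nat) list \<Rightarrow> nat \<Rightarrow> real" where w: "\<forall>y. ell_norm ps n y \<le> 1 \<longrightarrow>
      (\<exists>c. (\<forall>l<m. set (c l) \<subseteq> A \<and> (\<forall>i<m. \<bar>(\<Sum>j<n. x i j * y j) - w (c l) i\<bar> \<le> R / 2 ^ l / K)) \<and>
         (\<Sum>l<m. (1/4) ^ l * real (length (c l))) \<le> H)"
      using mirror_descent_net[OF p pps n R(1) K, of m x m] xR[OF _ y0] unfolding A_def H_def R_def by blast
    define V where "V = (\<lambda>y i. \<Sum>j<n. x i j * y j) ` Y"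
    have "(\<Sum>S\<in>Pow {..<m}. MAX v\<in>V. \<Sum>i<m. (rsign S i - 1 / 3) * \<bar>v i\<bar> powr q) \<le>
      2 ^ m * (R powr q * (2 / (1/3) * (4 + 2 * ln (real m) + H * ln (2 * real (card A))) + 2))"
    proof (rule rademacher_chaining)
      show "finite V" "V \<noteq> {}" using Y by (auto simp: V_def)
      show "finite A" "A \<noteq> {}" using m by (auto simp: A_def lessThan_empty_iff)
      show "K = 11 * q * 4 powr q / (1/3)" by (simp add: K_def)
      show "\<bar>v i\<bar> \<le> R" if "v \<in> V" "i < m" for v i
        using vR that by (auto simp: V_def R_def)
      show "\<exists>c. (\<forall>l<m. set (c l) \<subseteq> A \<and> (\<forall>i<m. \<bar>v i - w (c l) i\<bar> \<le> R / 2 ^ l / K)) \<and>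
        (\<Sum>l<m. (1/4) ^ l * real (length (c l))) \<le> H" if "v \<in> V" for v
        using w Y(3) that by (auto simp: V_def)
    qed (use m q R in auto)
    also have "\<dots> \<le> 2 ^ m * (R powr q * (300000 * 256 powr q * p * ln (real m)))"
    proof (intro mult_left_mono)
      show "2 / (1/3) * (4 + 2 * ln (real m) + H * ln (2 * real (card A))) + 2
        \<le> 300000 * 256 powr q * p * ln (real m)"
      proof -
      define lm where "lm = ln (real m)"
      have "ln 2 \<le> lm" using m by (simp add: lm_def)
      then have lm: "lm \<ge> 1/2" using ln2_ge_two_thirds by linarith
      \<comment> \<open>With \<open>m\<close> scales the alphabet has \<open>2 * m\<^sup>2\<close>
        letters (row, sign, scale), so a letter costs at most \<open>4 * ln m\<close>.\<close>
      have "ln (2 * real (card A)) = 2 * (ln 2 + lm)"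
        using m by (simp add: A_def card_cartesian_product ln_mult lm_def ln_realpow[of 2 2, simplified, symmetric])
      then have lA: "ln (2 * real (card A)) \<le> 4 * lm" using \<open>ln 2 \<le> lm\<close> by simp
      have "finite A" "A \<noteq> {}" using m by (auto simp: A_def lessThan_empty_iff)
      then have "card A > 0" by (simp add: card_gt_0_iff)
      then have cA: "1 \<le> 2 * real (card A)" by linarith
      have "1 \<le> (256::real) powr q" using q by (intro ge_one_powr_ge_zero) auto
      then have P: "2 \<le> 256 powr q * p" using p mult_mono[of 1 "256 powr q" 2 p] by simp
      have "H \<le> 8 / 3 * p * (1089 * 256 powr q)"
        unfolding H_def using K2 p by (intro mult_mono) auto
      then have "H * ln (2 * real (card A)) \<le> 8 / 3 * p * (1089 * 256 powr q) * (4 * lm)"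
        using lA p lm ln_ge_zero[OF cA] by (intro mult_mono) auto
      \<comment> \<open>\<open>69696\<close> is \<open>6 * 8/3 * 1089 * 4\<close>: the prefactor
        \<open>2 / \<delta>\<close>, the code length, the bound on \<open>K\<^sup>2\<close> and the
        cost of a letter.\<close>
      then have "2 / (1/3) * (4 + 2 * lm + H * ln (2 * real (card A))) + 2 \<le> 26 + 12 * lm + 69696 * (256 powr q * p * lm)"
        by (simp add: field_simps)
      also have "\<dots> \<le> 32 * (256 powr q * p * lm) + 69696 * (256 powr q * p * lm)"
        using mult_right_mono[OF P, of lm] lm by linarith
      also have "\<dots> \<le> 300000 * (256 powr q * p * lm)"
        using P lm by (simp add: mult.commute)
      finally show ?thesis by (simp add: lm_def mult_ac)
      qed
    qed auto
    finally show ?thesis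
      by (simp add: R(2) V_def image_image mult_ac)
  qed
qed

section \<open>Symmetrization with an offset\<close>

text \<open>Two independent copies are stored as one product over \<open>bool \<times> I\<close>. In
  this form an exchange of rows between the copies is a permutation of coordinates, which preserves
  the measure by \<open>distr_PiM_reindex\<close>.\<close>

lemma distr_pair_PiM_bool:
  fixes N :: "'a measure" and I :: "'i set"
  assumes N: "prob_space N" and I: "finite I"
  defines "P \<equiv> PiM I (\<lambda>_. N)" and "B \<equiv> (UNIV :: bool set) \<times> I"
  shows "distr (P \<Otimes>\<^sub>M P) (PiM B (\<lambda>_. N)) (\<lambda>(x, x'). \<lambda>(b, k)\<in>B. if b then x k else x' k) = PiM B (\<lambda>_. N)"
    and "(\<lambda>(x, x'). \<lambda>(b, k)\<in>B. if b then x k else x' k) \<in> measurable (P \<Otimes>\<^sub>M P) (PiM B (\<lambda>_. N))"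
proof -
  interpret N: prob_space N by fact
  interpret product_prob_space "\<lambda>_. N" B by unfold_locales
  interpret PI: product_prob_space "\<lambda>_. N" I by unfold_locales
  interpret Pr: prob_space P unfolding P_def by (rule prob_space_PiM) (rule N)
  have B: "finite B" using I by (simp add: B_def)
  define \<Phi> where "\<Phi> = (\<lambda>(x, x'). \<lambda>(b, k)\<in>B. if b then x k else x' k :: 'a)"
  have \<Phi>_alt: "\<Phi> z = (\<lambda>bk\<in>B. if fst bk then fst z (snd bk) else snd z (snd bk))" for z
    by (auto simp: \<Phi>_def split: prod.splits)
  show \<Phi>: "(\<lambda>(x, x'). \<lambda>(b, k)\<in>B. if b then x k else x' k) \<in> measurable (P \<Otimes>\<^sub>M P) (PiM B (\<lambda>_. N))"
    unfolding \<Phi>_def[symmetric] \<Phi>_alt[abs_def]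
  proof (rule measurable_restrict)
    fix bk assume bk: "bk \<in> B"
    then have k: "snd bk \<in> I" by (auto simp: B_def)
    show "(\<lambda>z. if fst bk then fst z (snd bk) else snd z (snd bk)) \<in> measurable (P \<Otimes>\<^sub>M P) N"
      unfolding P_def using k
      by (cases "fst bk") (auto intro: measurable_compose[OF measurable_fst] measurable_compose[OF measurable_snd])
  qed
  have "distr (P \<Otimes>\<^sub>M P) (PiM B (\<lambda>_. N)) \<Phi> = PiM B (\<lambda>_. N)"
  proof (rule PiM_eqI[OF B])
    show "sets (distr (P \<Otimes>\<^sub>M P) (PiM B (\<lambda>_. N)) \<Phi>) = sets (PiM B (\<lambda>_. N))" by simp
    fix A :: "bool \<times> 'i \<Rightarrow> 'a set" assume A: "\<And>i. i \<in> B \<Longrightarrow> A i \<in> sets N"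
    have A': "A (b, k) \<in> sets N" "A (b, k) \<subseteq> space N" if "k \<in> I" for b k
      using A[of "(b, k)"] that sets.sets_into_space by (auto simp: B_def)
    have "\<Phi> -` Pi\<^sub>E B A \<inter> space (P \<Otimes>\<^sub>M P) = Pi\<^sub>E I (\<lambda>k. A (True, k)) \<times> Pi\<^sub>E I (\<lambda>k. A (False, k))"
      unfolding \<Phi>_alt[abs_def]
      by (auto simp: B_def space_pair_measure P_def space_PiM PiE_iff all_bool_eq intro: subsetD[OF A'(2)])
    then have "emeasure (distr (P \<Otimes>\<^sub>M P) (PiM B (\<lambda>_. N)) \<Phi>) (Pi\<^sub>E B A)
        = emeasure (P \<Otimes>\<^sub>M P) (Pi\<^sub>E I (\<lambda>k. A (True, k)) \<times> Pi\<^sub>E I (\<lambda>k. A (False, k)))"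
      using \<Phi> A B by (subst emeasure_distr) (auto simp: \<Phi>_def intro!: sets_PiM_I_finite)
    also have "\<dots> = emeasure P (Pi\<^sub>E I (\<lambda>k. A (True, k))) * emeasure P (Pi\<^sub>E I (\<lambda>k. A (False, k)))"
      using A' I by (intro Pr.emeasure_pair_measure_Times) (auto simp: P_def intro!: sets_PiM_I_finite)
    also have "\<dots> = (\<Prod>k\<in>I. emeasure N (A (True, k))) * (\<Prod>k\<in>I. emeasure N (A (False, k)))"
      unfolding P_def using A' I by (subst (1 2) PI.emeasure_PiM) auto
    also have "\<dots> = (\<Prod>b\<in>UNIV. \<Prod>k\<in>I. emeasure N (A (b, k)))"
      by (simp add: UNIV_bool mult.commute)
    also have "\<dots> = (\<Prod>i\<in>B. emeasure N (A i))"
      unfolding B_def by (simp add: prod.cartesian_product case_prod_beta)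
    finally show "emeasure (distr (P \<Otimes>\<^sub>M P) (PiM B (\<lambda>_. N)) \<Phi>) (Pi\<^sub>E B A) = (\<Prod>i\<in>B. emeasure N (A i))" .
  qed
  then show "distr (P \<Otimes>\<^sub>M P) (PiM B (\<lambda>_. N)) (\<lambda>(x, x'). \<lambda>(b, k)\<in>B. if b then x k else x' k) = PiM B (\<lambda>_. N)"
    by (simp add: \<Phi>_def)
qed

text \<open>
  Comparing with an independent copy of the rows, and exchanging the rows outside a random \<open>S\<close>. The offset
  \<open>\<delta> = 1 / 3\<close> later produces the factor \<open>(1 + \<delta>) / (1 - \<delta>) = 2\<close> in front of the column term.
\<close>

lemma offset_symmetrization:
  fixes N :: "'a measure" and I :: "('i \<times> 'j) set" and f :: "'i \<Rightarrow> 'y \<Rightarrow> ('i \<times> 'j \<Rightarrow> 'a) \<Rightarrow> real"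
  assumes N: "prob_space N" and I: "finite I" and K: "finite K" and Y: "finite Y" "Y \<noteq> {}" and \<delta>: "0 \<le> \<delta>"
  defines "P \<equiv> PiM I (\<lambda>_. N)"
  assumes f: "\<And>i y. i \<in> K \<Longrightarrow> y \<in> Y \<Longrightarrow> integrable P (f i y)"
    and loc: "\<And>i y x x'. i \<in> K \<Longrightarrow> y \<in> Y \<Longrightarrow> (\<And>j. (i, j) \<in> I \<Longrightarrow> x (i, j) = x' (i, j)) \<Longrightarrow> f i y x = f i y x'"
  shows "2 ^ card K * (\<integral>x. (MAX y\<in>Y. \<Sum>i\<in>K. (1 - \<delta>) * f i y x - (1 + \<delta>) * (\<integral>x'. f i y x' \<partial>P)) \<partial>P)
    \<le> 2 * (\<integral>x. (\<Sum>S\<in>Pow K. MAX y\<in>Y. \<Sum>i\<in>K. (rsign S i - \<delta>) * f i y x) \<partial>P)"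
proof -
  interpret N: prob_space N by fact
  interpret P: prob_space P unfolding P_def by (rule prob_space_PiM) (rule N)
  interpret PP: pair_prob_space P P ..
  define B where "B = (UNIV :: bool set) \<times> I"
  define P2 where "P2 = PiM B (\<lambda>_. N)"
  interpret P2: prob_space P2 unfolding P2_def by (rule prob_space_PiM) (rule N)
  \<comment> \<open>Rows in \<open>S\<close> are read from the copy \<open>True\<close> and the
    others from the copy \<open>False\<close>; \<open>u UNIV\<close> and \<open>u {}\<close> are the
    two copies themselves.\<close>
  define u where "u S x = (\<lambda>k\<in>I. x (fst k \<in> S, k))" for S :: "'i set" and x :: "bool \<times> 'i \<times> 'j \<Rightarrow> 'a"
  have u_distr: "distr P2 P (u S) = P" for S
    unfolding P2_def P_def u_def[abs_def]
    by (rule distr_PiM_reindex) (auto simp: N B_def inj_on_def)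
  have u_meas: "u S \<in> measurable P2 P" for S
    unfolding P2_def P_def u_def[abs_def]
    by (rule measurable_restrict) (auto simp: B_def)
  have fu: "integrable P2 (\<lambda>x. f i y (u S x))" if "i \<in> K" "y \<in> Y" for i y S
    using f[OF that] u_distr[of S] u_meas[of S] by (metis integrable_distr)
  define H where "H x x' = (MAX y\<in>Y. \<Sum>i\<in>K. (1 - \<delta>) * f i y x - (1 + \<delta>) * f i y x')" for x x'
  define a where "a S = (\<integral>x. (MAX y\<in>Y. \<Sum>i\<in>K. (rsign S i - \<delta>) * f i y x) \<partial>P)" for S
  have a_int: "integrable P (\<lambda>x. MAX y\<in>Y. \<Sum>i\<in>K. (rsign S i - \<delta>) * f i y x)" for S
    using Y f by (intro integrable_MAX Bochner_Integration.integrable_sum integrable_mult_right)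
  have H_meas: "(\<lambda>z. H (fst z) (snd z)) \<in> borel_measurable (P \<Otimes>\<^sub>M P)"
  proof -
    have [measurable]: "f i y \<in> borel_measurable P" if "i \<in> K" "y \<in> Y" for i y
      using f[OF that] by auto
    show ?thesis unfolding H_def using Y by (intro borel_measurable_Max) measurable
  qed
  define J where "J = (\<integral>z. H (fst z) (snd z) \<partial>(P \<Otimes>\<^sub>M P))"
  have fst_int: "integrable (P \<Otimes>\<^sub>M P) (\<lambda>z. f i y (fst z))" if "i \<in> K" "y \<in> Y" for i y
    using f[OF that] P.distr_pair_fst[of P] integrable_distr[of fst "P \<Otimes>\<^sub>M P" P "f i y"] by simp
  have pair_int: "integrable (P \<Otimes>\<^sub>M P) (\<lambda>z. f i y (fst z))" "integrable (P \<Otimes>\<^sub>M P) (\<lambda>z. f i y (snd z))"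
    if "i \<in> K" "y \<in> Y" for i y
    using fst_int[OF that] PP.integrable_product_swap[OF fst_int[OF that]] by (simp_all add: case_prod_beta')
  have H_int: "integrable (P \<Otimes>\<^sub>M P) (\<lambda>z. H (fst z) (snd z))"
    unfolding H_def using Y pair_int
    by (intro integrable_MAX Bochner_Integration.integrable_sum Bochner_Integration.integrable_diff integrable_mult_right)
  \<comment> \<open>For fixed \<open>x\<close>, a maximum of integrals over \<open>x'\<close> is at
    most the integral of the maximum; this replaces the mean by an independent copy.\<close>
  have lower: "(\<integral>x. (MAX y\<in>Y. \<Sum>i\<in>K. (1 - \<delta>) * f i y x - (1 + \<delta>) * (\<integral>x'. f i y x' \<partial>P)) \<partial>P) \<le> J"
  proof -
    have "J = (\<integral>x. (\<integral>x'. H x x' \<partial>P) \<partial>P)"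
      unfolding J_def using PP.integral_fst'[OF H_int] by simp
    also have "\<dots> \<ge> (\<integral>x. (MAX y\<in>Y. \<Sum>i\<in>K. (1 - \<delta>) * f i y x - (1 + \<delta>) * (\<integral>x'. f i y x' \<partial>P)) \<partial>P)"
    proof (rule integral_mono)
      show "integrable P (\<lambda>x. MAX y\<in>Y. \<Sum>i\<in>K. (1 - \<delta>) * f i y x - (1 + \<delta>) * (\<integral>x'. f i y x' \<partial>P))"
        using Y f by (intro integrable_MAX Bochner_Integration.integrable_sum Bochner_Integration.integrable_diff integrable_mult_right) auto
      show "integrable P (\<lambda>x. \<integral>x'. H x x' \<partial>P)"
        using PP.integrable_fst'[OF H_int] by simp
      fix x
      have int: "integrable P (\<lambda>x'. \<Sum>i\<in>K. (1 - \<delta>) * f i y x - (1 + \<delta>) * f i y x')" if "y \<in> Y" for y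
        using f that by (intro Bochner_Integration.integrable_sum Bochner_Integration.integrable_diff integrable_mult_right) auto
      show "(MAX y\<in>Y. \<Sum>i\<in>K. (1 - \<delta>) * f i y x - (1 + \<delta>) * (\<integral>x'. f i y x' \<partial>P)) \<le> (\<integral>x'. H x x' \<partial>P)"
      proof (rule Max.boundedI)
        fix t assume "t \<in> (\<lambda>y. \<Sum>i\<in>K. (1 - \<delta>) * f i y x - (1 + \<delta>) * (\<integral>x'. f i y x' \<partial>P)) ` Y"
        then obtain y where y: "y \<in> Y" "t = (\<Sum>i\<in>K. (1 - \<delta>) * f i y x - (1 + \<delta>) * (\<integral>x'. f i y x' \<partial>P))" by blast
        have "t = (\<integral>x'. (\<Sum>i\<in>K. (1 - \<delta>) * f i y x - (1 + \<delta>) * f i y x') \<partial>P)"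
          using y f by (simp add: Bochner_Integration.integral_sum Bochner_Integration.integral_diff P.prob_space)
        also have "\<dots> \<le> (\<integral>x'. H x x' \<partial>P)"
          unfolding H_def using Y y int by (intro integral_mono integrable_MAX) auto
        finally show "t \<le> (\<integral>x'. H x x' \<partial>P)" .
      qed (use Y in auto)
    qed
    finally show ?thesis .
  qed
  define h where "h x = H (u UNIV x) (u {} x)" for x
  have h_meas: "h \<in> borel_measurable P2"
    using measurable_compose[OF measurable_Pair[OF u_meas[of UNIV] u_meas[of "{}"]] H_meas]
    by (simp add: h_def[abs_def])
  have J_h: "J = (\<integral>x. h x \<partial>P2)"
  proof -
    note D = distr_pair_PiM_bool[OF N I, folded B_def P_def, folded P2_def]
    have "(\<integral>x. h x \<partial>P2) = (\<integral>z. h ((\<lambda>(x, x'). \<lambda>(b, k)\<in>B. if b then x k else x' k) z) \<partial>(P \<Otimes>\<^sub>M P))"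
      by (subst D(1)[symmetric], rule integral_distr[OF D(2) h_meas])
    also have "\<dots> = J"
      unfolding J_def
    proof (rule Bochner_Integration.integral_cong[OF refl])
      fix z assume "z \<in> space (P \<Otimes>\<^sub>M P)"
      then have "fst z \<in> extensional I" "snd z \<in> extensional I"
        by (auto simp: space_pair_measure P_def space_PiM PiE_iff)
      then have "u UNIV ((\<lambda>(x, x'). \<lambda>(b, k)\<in>B. if b then x k else x' k) z) = fst z"
        "u {} ((\<lambda>(x, x'). \<lambda>(b, k)\<in>B. if b then x k else x' k) z) = snd z"
        by (auto simp: u_def B_def fun_eq_iff restrict_def extensional_def split: prod.splits)
      then show "h ((\<lambda>(x, x'). \<lambda>(b, k)\<in>B. if b then x k else x' k) z) = H (fst z) (snd z)"
        by (simp add: h_def)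
    qed
    finally show ?thesis ..
  qed
  have J_S: "J \<le> a S + a (K - S)" if S: "S \<subseteq> K" for S
  proof -
    \<comment> \<open>The first component is an equality of booleans: it keeps the copy label of a
      row in \<open>S\<close> and negates that of any other row.\<close>
    define \<pi> where "\<pi> bk = (fst bk = (fst (snd bk) \<in> S), snd bk)" for bk :: "bool \<times> 'i \<times> 'j"
    have "distr P2 P2 (\<lambda>x. \<lambda>bk\<in>B. x (\<pi> bk)) = P2"
      unfolding P2_def by (rule distr_PiM_reindex) (auto simp: N B_def inj_on_def \<pi>_def)
    moreover have "(\<lambda>x. \<lambda>bk\<in>B. x (\<pi> bk)) \<in> measurable P2 P2"
      unfolding P2_def by (rule measurable_restrict) (auto simp: B_def \<pi>_def)
    ultimately have "J = (\<integral>x. h (\<lambda>bk\<in>B. x (\<pi> bk)) \<partial>P2)"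
      unfolding J_h using integral_distr[OF _ h_meas] by metis
    also have "\<dots> = (\<integral>x. H (u S x) (u (- S) x) \<partial>P2)"
    proof -
      have "u UNIV (\<lambda>bk\<in>B. x (\<pi> bk)) = u S x" "u {} (\<lambda>bk\<in>B. x (\<pi> bk)) = u (- S) x" for x
        by (auto simp: u_def B_def \<pi>_def restrict_def)
      then show ?thesis by (simp add: h_def)
    qed
    also have "\<dots> \<le> (\<integral>x. (MAX y\<in>Y. \<Sum>i\<in>K. (rsign S i - \<delta>) * f i y (u UNIV x))
        + (MAX y\<in>Y. \<Sum>i\<in>K. (rsign (K - S) i - \<delta>) * f i y (u {} x)) \<partial>P2)"
    proof (rule integral_mono)
      show "integrable P2 (\<lambda>x. H (u S x) (u (- S) x))"
        unfolding H_def using Y fu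
        by (intro integrable_MAX Bochner_Integration.integrable_sum Bochner_Integration.integrable_diff integrable_mult_right)
      show "integrable P2 (\<lambda>x. (MAX y\<in>Y. \<Sum>i\<in>K. (rsign S i - \<delta>) * f i y (u UNIV x))
        + (MAX y\<in>Y. \<Sum>i\<in>K. (rsign (K - S) i - \<delta>) * f i y (u {} x)))"
        using Y fu
        by (intro Bochner_Integration.integrable_add integrable_MAX Bochner_Integration.integrable_sum integrable_mult_right)
      fix x
      show "H (u S x) (u (- S) x) \<le> (MAX y\<in>Y. \<Sum>i\<in>K. (rsign S i - \<delta>) * f i y (u UNIV x))
        + (MAX y\<in>Y. \<Sum>i\<in>K. (rsign (K - S) i - \<delta>) * f i y (u {} x))"
        unfolding H_def
      proof (rule Max.boundedI)
        fix t assume "t \<in> (\<lambda>y. \<Sum>i\<in>K. (1 - \<delta>) * f i y (u S x) - (1 + \<delta>) * f i y (u (- S) x)) ` Y"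
        then obtain y where y: "y \<in> Y" "t = (\<Sum>i\<in>K. (1 - \<delta>) * f i y (u S x) - (1 + \<delta>) * f i y (u (- S) x))" by blast
        \<comment> \<open>Each row contributes \<open>1 - \<delta>\<close> from one copy and
          \<open>- (1 + \<delta>)\<close> from the other. Sorted by copy, these are the patterns
          \<open>S\<close> and \<open>K - S\<close>, both with offset
          \<open>\<delta>\<close>.\<close>
        have "t = (\<Sum>i\<in>K. (rsign S i - \<delta>) * f i y (u UNIV x) + (rsign (K - S) i - \<delta>) * f i y (u {} x))"
          unfolding y(2)
        proof (rule sum.cong[OF refl])
          fix i assume i: "i \<in> K"
          have "f i y (u S x) = f i y (u (if i \<in> S then UNIV else {}) x)"
            "f i y (u (- S) x) = f i y (u (if i \<in> S then {} else UNIV) x)"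
            by (rule loc[OF i y(1)], simp add: u_def)+
          then show "(1 - \<delta>) * f i y (u S x) - (1 + \<delta>) * f i y (u (- S) x) =
            (rsign S i - \<delta>) * f i y (u UNIV x) + (rsign (K - S) i - \<delta>) * f i y (u {} x)"
            using i by (auto simp: rsign_def algebra_simps)
        qed
        also have "\<dots> \<le> (MAX y\<in>Y. \<Sum>i\<in>K. (rsign S i - \<delta>) * f i y (u UNIV x))
            + (MAX y\<in>Y. \<Sum>i\<in>K. (rsign (K - S) i - \<delta>) * f i y (u {} x))"
          unfolding sum.distrib using Y y by (intro add_mono Max_ge) auto
        finally show "t \<le> (MAX y\<in>Y. \<Sum>i\<in>K. (rsign S i - \<delta>) * f i y (u UNIV x))
            + (MAX y\<in>Y. \<Sum>i\<in>K. (rsign (K - S) i - \<delta>) * f i y (u {} x))" .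
      qed (use Y in auto)
    qed
    also have "\<dots> = a S + a (K - S)"
    proof -
      have "(\<integral>x. (MAX y\<in>Y. \<Sum>i\<in>K. (rsign T i - \<delta>) * f i y (u U x)) \<partial>P2) = a T" for T U
      proof -
        have "a T = (\<integral>x. (MAX y\<in>Y. \<Sum>i\<in>K. (rsign T i - \<delta>) * f i y x) \<partial>distr P2 P (u U))"
          by (simp only: a_def u_distr)
        also have "\<dots> = (\<integral>x. (MAX y\<in>Y. \<Sum>i\<in>K. (rsign T i - \<delta>) * f i y (u U x)) \<partial>P2)"
          by (rule integral_distr[OF u_meas]) (rule borel_measurable_integrable[OF a_int])
        finally show ?thesis ..
      qed
      moreover have "integrable P2 (\<lambda>x. MAX y\<in>Y. \<Sum>i\<in>K. (rsign T i - \<delta>) * f i y (u U x))" for T U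
        using Y fu by (intro integrable_MAX Bochner_Integration.integrable_sum integrable_mult_right)
      ultimately show ?thesis by simp
    qed
    finally show ?thesis .
  qed
  have "2 ^ card K * J = (\<Sum>S\<in>Pow K. J)" using K by (simp add: card_Pow)
  also have "\<dots> \<le> (\<Sum>S\<in>Pow K. a S + a (K - S))"
    using J_S by (intro sum_mono) auto
  also have "\<dots> = (\<Sum>S\<in>Pow K. a S) + (\<Sum>S\<in>Pow K. a (K - S))" by (rule sum.distrib)
  also have "(\<Sum>S\<in>Pow K. a (K - S)) = (\<Sum>S\<in>Pow K. a S)"
    by (rule sum.reindex_bij_witness[of _ "\<lambda>S. K - S" "\<lambda>S. K - S"]) auto
  also have "(\<Sum>S\<in>Pow K. a S) + (\<Sum>S\<in>Pow K. a S) = 2 * (\<integral>x. (\<Sum>S\<in>Pow K. MAX y\<in>Y. \<Sum>i\<in>K. (rsign S i - \<delta>) * f i y x) \<partial>P)"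
    unfolding a_def using a_int by (simp add: Bochner_Integration.integral_sum)
  finally show ?thesis
    using mult_left_mono[OF lower, of "2 ^ card K"] by (meson order_trans zero_le_numeral zero_le_power)
qed

section \<open>Gaussian moments and row norms\<close>

lemma prob_space_std_normal: "prob_space std_normal_distribution"
  by (rule prob_space_normal_density) simp

text \<open>The density is bounded below on \<open>{t<..t+1}\<close>. Asking for the exponent
  \<open>t\<^sup>2\<close> and not \<open>t\<^sup>2 / 2\<close> leaves room for
  \<open>(t + 1)\<^sup>2 \<le> 2 * t\<^sup>2 + 2\<close>; then \<open>sqrt (2 * pi) \<le> 3\<close>
  and \<open>exp 1 \<le> 3\<close> keep the constant within 16.\<close>

lemma std_normal_tail_lower:
  assumes t: "t \<ge> 0"
  shows "exp (- (t\<^sup>2)) / 16 \<le> measure std_normal_distribution {x. t < \<bar>x\<bar>}"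
proof -
  interpret prob_space std_normal_distribution by (rule prob_space_std_normal)
  have "sqrt (2 * pi) \<le> sqrt 9" using pi_less_4 by (intro real_sqrt_le_mono) auto
  then have sq: "sqrt (2 * pi) \<le> 3" by simp
  have dens: "exp (- (t\<^sup>2)) / 16 \<le> std_normal_density x" if "x \<in> {t<..t+1}" for x
  proof -
    have "x\<^sup>2 \<le> (t + 1)\<^sup>2" using that t by (intro power_mono) auto
    also have "\<dots> \<le> 2 * t\<^sup>2 + 2"
      using zero_le_power2[of "t - 1"] by (simp add: power2_eq_square algebra_simps)
    finally have e: "exp (- (t\<^sup>2) - 1) \<le> exp (- x\<^sup>2 / 2)" by simp
    have "exp (- (t\<^sup>2)) / 16 \<le> exp (- (t\<^sup>2)) / (3 * exp 1)"
      using exp_le by (intro divide_left_mono) auto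
    also have "\<dots> = exp (- (t\<^sup>2) - 1) / 3" by (simp add: exp_diff)
    also have "\<dots> \<le> exp (- x\<^sup>2 / 2) / sqrt (2 * pi)"
      using e sq by (intro frac_le) auto
    finally show ?thesis by (simp add: std_normal_density_def)
  qed
  have "ennreal (exp (- (t\<^sup>2)) / 16) = (\<integral>\<^sup>+x. ennreal (exp (- (t\<^sup>2)) / 16) * indicator {t<..t+1} x \<partial>lborel)"
    by (simp add: nn_integral_cmult_indicator)
  also have "\<dots> \<le> (\<integral>\<^sup>+x. ennreal (std_normal_density x) * indicator {t<..t+1} x \<partial>lborel)"
    using dens by (intro nn_integral_mono) (auto simp: indicator_def intro!: ennreal_leI)
  also have "\<dots> = emeasure std_normal_distribution {t<..t+1}"
    by (simp add: emeasure_density)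
  also have "\<dots> \<le> emeasure std_normal_distribution {x. t < \<bar>x\<bar>}"
    using t by (intro emeasure_mono) auto
  finally show ?thesis
    by (simp add: emeasure_eq_measure)
qed

lemma integrable_std_normal_abs_powr:
  assumes "r \<ge> 0"
  shows "integrable std_normal_distribution (\<lambda>x. \<bar>x\<bar> powr r)"
proof -
  define k where "k = nat \<lceil>r\<rceil>"
  interpret prob_space std_normal_distribution by (rule prob_space_std_normal)
  have "integrable std_normal_distribution (\<lambda>x. \<bar>x\<bar> ^ k)"
    using integrable_std_normal_moment_abs[of k] by (subst integrable_density) auto
  then have "integrable std_normal_distribution (\<lambda>x. 1 + \<bar>x\<bar> ^ k)" by simp
  then show ?thesis
  proof (rule Bochner_Integration.integrable_bound)
    show "AE x in std_normal_distribution. norm (\<bar>x\<bar> powr r) \<le> norm (1 + \<bar>x\<bar> ^ k)"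
    proof (rule AE_I2)
      fix x :: real
      have "\<bar>x\<bar> powr r \<le> 1 + \<bar>x\<bar> ^ k"
      proof (cases "\<bar>x\<bar> \<le> 1")
        case True
        then have "\<bar>x\<bar> powr r \<le> 1 powr r" using assms by (intro powr_mono2) auto
        then show ?thesis by (simp add: add_increasing2)
      next
        case False
        then have "\<bar>x\<bar> powr r \<le> \<bar>x\<bar> powr real k" using assms by (intro powr_mono) (auto simp: k_def)
        then show ?thesis using False by (simp add: powr_realpow)
      qed
      then show "norm (\<bar>x\<bar> powr r) \<le> norm (1 + \<bar>x\<bar> ^ k)" by simp
    qed
  qed simp
qed

lemma gauss_norm_powr:
  "r > 0 \<Longrightarrow> gauss_norm r powr r = (\<integral>x. \<bar>x\<bar> powr r \<partial>std_normal_distribution)"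
  by (simp add: gauss_norm_def powr_powr integral_nonneg_AE)

text \<open>Markov's inequality at the level \<open>sqrt q\<close>. It allows
  \<open>gauss_norm q powr q\<close> to absorb the factors of size \<open>q powr (q / 2)\<close>
  that exponential tails produce.\<close>

lemma gauss_norm_lower:
  assumes q: "q > 0"
  shows "q powr (q / 2) * exp (- q) / 16 \<le> gauss_norm q powr q"
proof -
  interpret prob_space std_normal_distribution by (rule prob_space_std_normal)
  have "q powr (q / 2) * (exp (- ((sqrt q)\<^sup>2)) / 16) \<le> q powr (q / 2) * measure std_normal_distribution {x. sqrt q < \<bar>x\<bar>}"
    using q by (intro mult_left_mono std_normal_tail_lower) auto
  also have "\<dots> = (\<integral>x. q powr (q / 2) * indicator {x. sqrt q < \<bar>x\<bar>} x \<partial>std_normal_distribution)"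
    by simp
  also have "\<dots> \<le> (\<integral>x. \<bar>x\<bar> powr q \<partial>std_normal_distribution)"
  proof (rule integral_mono)
    show "integrable std_normal_distribution (\<lambda>x. q powr (q / 2) * indicator {x. sqrt q < \<bar>x\<bar>} x)"
      by (intro integrable_mult_right integrable_real_indicator) (auto simp: emeasure_eq_measure)
    fix x :: real
    have "q powr (q / 2) \<le> \<bar>x\<bar> powr q" if "sqrt q < \<bar>x\<bar>"
    proof -
      have "q powr (q / 2) = sqrt q powr q" using powr_powr[of q "1/2" q] powr_half_sqrt[of q] q by simp
      also have "\<dots> \<le> \<bar>x\<bar> powr q" using that q by (intro powr_mono2) auto
      finally show ?thesis .
    qed
    then show "q powr (q / 2) * indicator {x. sqrt q < \<bar>x\<bar>} x \<le> \<bar>x\<bar> powr q"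
      by (auto simp: indicator_def)
  qed (use q in \<open>auto intro: integrable_std_normal_abs_powr\<close>)
  finally show ?thesis using q by (simp add: gauss_norm_powr)
qed

lemma gauss_norm_pos: "q > 0 \<Longrightarrow> gauss_norm q > 0"
proof -
  assume q: "q > 0"
  then have "0 < q powr (q / 2) * exp (- q) / 16" by simp
  with gauss_norm_lower[OF q] have "gauss_norm q powr q > 0" by linarith
  then have "gauss_norm q \<noteq> 0" by auto
  moreover have "gauss_norm q \<ge> 0" by (simp add: gauss_norm_def)
  ultimately show ?thesis by simp
qed

text \<open>The weight \<open>exp (x\<^sup>2 / 4)\<close> halves the exponent of the density. The
  substitution \<open>x = sqrt 2 * z\<close> restores it and costs
  \<open>sqrt 2 powr (p + 1) \<le> 2 powr p\<close>.\<close>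

lemma nn_integral_abs_powr_exp:
  assumes p: "p \<ge> 2"
  shows "(\<integral>\<^sup>+x. ennreal (\<bar>x\<bar> powr p * exp (x\<^sup>2 / 4)) \<partial>std_normal_distribution)
    \<le> ennreal (2 powr p * gauss_norm p powr p)"
proof -
  have gm: "(\<integral>\<^sup>+x. ennreal (\<bar>x\<bar> powr p) \<partial>std_normal_distribution) = ennreal (gauss_norm p powr p)"
    using p integrable_std_normal_abs_powr[of p]
    by (simp add: nn_integral_eq_integral gauss_norm_powr)
  have "(\<integral>\<^sup>+x. ennreal (\<bar>x\<bar> powr p * exp (x\<^sup>2 / 4)) \<partial>std_normal_distribution)
     = (\<integral>\<^sup>+x. ennreal (std_normal_density x * (\<bar>x\<bar> powr p * exp (x\<^sup>2 / 4))) \<partial>lborel)"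
    by (subst nn_integral_density) (auto simp: ennreal_mult')
  also have "\<dots> = ennreal (sqrt 2) * (\<integral>\<^sup>+x. ennreal (std_normal_density (sqrt 2 * x) *
       (\<bar>sqrt 2 * x\<bar> powr p * exp ((sqrt 2 * x)\<^sup>2 / 4))) \<partial>lborel)"
    using nn_integral_real_affine[of "\<lambda>x. ennreal (std_normal_density x * (\<bar>x\<bar> powr p * exp (x\<^sup>2 / 4)))" "sqrt 2" 0]
    by simp
  also have "(\<lambda>x. std_normal_density (sqrt 2 * x) * (\<bar>sqrt 2 * x\<bar> powr p * exp ((sqrt 2 * x)\<^sup>2 / 4)))
      = (\<lambda>x. sqrt 2 powr p * (std_normal_density x * \<bar>x\<bar> powr p))"
  proof
    fix x :: real
    have "exp (- (x\<^sup>2)) * exp (x\<^sup>2 / 2) = exp (- (x\<^sup>2 / 2))" by (simp flip: exp_add)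
    then show "std_normal_density (sqrt 2 * x) * (\<bar>sqrt 2 * x\<bar> powr p * exp ((sqrt 2 * x)\<^sup>2 / 4))
      = sqrt 2 powr p * (std_normal_density x * \<bar>x\<bar> powr p)"
      by (simp add: std_normal_density_def abs_mult powr_mult power_mult_distrib)
  qed
  also have "(\<integral>\<^sup>+x. ennreal (sqrt 2 powr p * (std_normal_density x * \<bar>x\<bar> powr p)) \<partial>lborel)
      = ennreal (sqrt 2 powr p) * (\<integral>\<^sup>+x. ennreal (\<bar>x\<bar> powr p) \<partial>std_normal_distribution)"
    by (subst nn_integral_density) (auto simp: ennreal_mult' nn_integral_cmult)
  also have "ennreal (sqrt 2) * (ennreal (sqrt 2 powr p) * (\<integral>\<^sup>+x. ennreal (\<bar>x\<bar> powr p) \<partial>std_normal_distribution))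
      = ennreal (sqrt 2 * sqrt 2 powr p * gauss_norm p powr p)"
    by (simp add: gm mult.assoc flip: ennreal_mult)
  also have "\<dots> \<le> ennreal (2 powr p * gauss_norm p powr p)"
  proof (intro ennreal_leI mult_right_mono)
    have "sqrt 2 * sqrt 2 powr p = sqrt 2 powr (1 + p)" by (simp add: powr_add)
    also have "\<dots> \<le> sqrt 2 powr (2 * p)" using p by (intro powr_mono) auto
    also have "\<dots> = 2 powr p" by (simp flip: powr_powr)
    finally show "sqrt 2 * sqrt 2 powr p \<le> 2 powr p" .
  qed simp
  finally show ?thesis .
qed

section \<open>Truncation and exponential moments of Gaussian vectors\<close>

lemma powr_add_le_add_powr:
  fixes x y s :: real
  assumes "x \<ge> 0" "y \<ge> 0" "0 < s" "s \<le> 1"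
  shows "(x + y) powr s \<le> x powr s + y powr s"
proof (cases "x + y = 0")
  case False
  with assms have xy: "x + y > 0" by linarith
  have *: "t \<le> t powr s" if "0 \<le> t" "t \<le> 1" for t :: real
    using that assms powr_mono_both[of s 1 t t] powr_mono'[of s 1 t] by (cases "t = 0") auto
  have "1 = x / (x + y) + y / (x + y)" using xy by (simp flip: add_divide_distrib)
  also have "\<dots> \<le> (x / (x + y)) powr s + (y / (x + y)) powr s"
    using assms xy by (intro add_mono *) auto
  also have "\<dots> = (x powr s + y powr s) / (x + y) powr s"
    using assms xy by (simp add: powr_divide add_divide_distrib)
  finally show ?thesis using xy by (simp add: field_simps)
qed (use assms in auto)

lemma powr_sum_le_sum_powr:
  fixes x :: "'a \<Rightarrow> real"
  assumes "\<And>i. i \<in> I \<Longrightarrow> x i \<ge> 0" "0 < s" "s \<le> 1"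
  shows "(\<Sum>i\<in>I. x i) powr s \<le> (\<Sum>i\<in>I. x i powr s)"
  using assms(1)
proof (induction I rule: infinite_finite_induct)
  case (insert i I)
  have "(x i + (\<Sum>i\<in>I. x i)) powr s \<le> x i powr s + (\<Sum>i\<in>I. x i) powr s"
    using insert assms by (intro powr_add_le_add_powr sum_nonneg) auto
  with insert show ?case by simp
qed auto

text \<open>The coordinates are split at the level \<open>D\<close>. For the small ones, with sum of
  powers \<open>A\<close>, either \<open>A \<le> D powr p\<close> and they contribute at most
  \<open>D\<^sup>2\<close>, or \<open>A powr (2 / p - 1) \<le> D powr (2 - p)\<close>. For the large
  ones, subadditivity of the power \<open>2 / p\<close> gives the sum of squares. On each side the
  minimum is the member that occurs.\<close>

lemma ell_norm_square_le_truncated: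
  assumes p: "p \<ge> 2" and D: "D > 0"
  shows "(ell_norm p n x)\<^sup>2 \<le> D\<^sup>2 + (\<Sum>j<n. min ((x j)\<^sup>2) (\<bar>x j\<bar> powr p * D powr (2 - p)))"
proof -
  define J where "J = {j\<in>{..<n}. \<bar>x j\<bar> \<le> D}"
  have J: "finite J" "J \<subseteq> {..<n}" by (auto simp: J_def)
  define A where "A = (\<Sum>j\<in>J. \<bar>x j\<bar> powr p)"
  define B where "B = (\<Sum>j\<in>{..<n} - J. \<bar>x j\<bar> powr p)"
  have AB: "A \<ge> 0" "B \<ge> 0" by (auto simp: A_def B_def intro: sum_nonneg)
  have sq: "(\<bar>z\<bar> powr p) powr (2 / p) = z\<^sup>2" for z using p by (simp add: powr_powr)
  have "(ell_norm p n x)\<^sup>2 = (\<Sum>j<n. \<bar>x j\<bar> powr p) powr (2 / p)"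
    using powr_powr[of "\<Sum>j<n. \<bar>x j\<bar> powr p" "1/p" 2] by (simp add: ell_norm_def sum_nonneg)
  also have "(\<Sum>j<n. \<bar>x j\<bar> powr p) = A + B"
    using J by (simp add: A_def B_def sum.subset_diff[of J "{..<n}"] add.commute)
  also have "(A + B) powr (2 / p) \<le> A powr (2 / p) + B powr (2 / p)"
    using AB p by (intro powr_add_le_add_powr) auto
  also have "A powr (2 / p) \<le> D\<^sup>2 + A * D powr (2 - p)"
  proof (cases "A \<le> D powr p")
    case True
    then have "A powr (2 / p) \<le> (D powr p) powr (2 / p)" using AB p by (intro powr_mono2) auto
    also have "\<dots> = D\<^sup>2" using sq[of D] D by simp
    finally show ?thesis using AB D by (simp add: add_increasing2)
  next
    case False
    then have "A > 0" using D by (smt (verit) powr_ge_zero)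
    then have "A powr (2 / p) = A * A powr (2 / p - 1)" by (simp add: powr_mult_base)
    also have "\<dots> \<le> A * (D powr p) powr (2 / p - 1)"
      using False p D AB by (intro mult_left_mono powr_mono2') auto
    also have "(D powr p) powr (2 / p - 1) = D powr (2 - p)"
      using p by (simp add: powr_powr right_diff_distrib)
    finally show ?thesis by (simp add: add_increasing)
  qed
  also have "A * D powr (2 - p) \<le> (\<Sum>j\<in>J. min ((x j)\<^sup>2) (\<bar>x j\<bar> powr p * D powr (2 - p)))"
    unfolding A_def sum_distrib_right
  proof (rule sum_mono)
    fix j assume "j \<in> J"
    then have "\<bar>x j\<bar> \<le> D" by (simp add: J_def)
    have "\<bar>x j\<bar> powr p * D powr (2 - p) \<le> (x j)\<^sup>2"
    proof (cases "x j = 0")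
      case False
      then have "\<bar>x j\<bar> powr p * D powr (2 - p) \<le> \<bar>x j\<bar> powr p * \<bar>x j\<bar> powr (2 - p)"
        using \<open>\<bar>x j\<bar> \<le> D\<close> p by (intro mult_left_mono powr_mono2') auto
      also have "\<dots> = (x j)\<^sup>2" using False by (simp flip: powr_add)
      finally show ?thesis .
    qed (use p in simp)
    then show "\<bar>x j\<bar> powr p * D powr (2 - p) \<le> min ((x j)\<^sup>2) (\<bar>x j\<bar> powr p * D powr (2 - p))" by simp
  qed
  also have "B powr (2 / p) \<le> (\<Sum>j\<in>{..<n} - J. min ((x j)\<^sup>2) (\<bar>x j\<bar> powr p * D powr (2 - p)))"
  proof -
    have "B powr (2 / p) \<le> (\<Sum>j\<in>{..<n} - J. (\<bar>x j\<bar> powr p) powr (2 / p))"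
      unfolding B_def using p by (intro powr_sum_le_sum_powr) auto
    also have "\<dots> \<le> (\<Sum>j\<in>{..<n} - J. min ((x j)\<^sup>2) (\<bar>x j\<bar> powr p * D powr (2 - p)))"
      unfolding sq
    proof (rule sum_mono)
      fix j assume "j \<in> {..<n} - J"
      then have j: "\<bar>x j\<bar> > D" by (auto simp: J_def)
      have "\<bar>x j\<bar> powr (p - 2) \<ge> D powr (p - 2)" using j D p by (intro powr_mono2) auto
      then have "(x j)\<^sup>2 * D powr (p - 2) * D powr (2 - p) \<le> (x j)\<^sup>2 * \<bar>x j\<bar> powr (p - 2) * D powr (2 - p)"
        by (intro mult_left_mono mult_right_mono) auto
      also have "(x j)\<^sup>2 * \<bar>x j\<bar> powr (p - 2) = \<bar>x j\<bar> powr 2 * \<bar>x j\<bar> powr (p - 2)" using j D by simp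
      also have "\<dots> = \<bar>x j\<bar> powr p" by (simp only: powr_add[symmetric]) simp
      also have "(x j)\<^sup>2 * D powr (p - 2) * D powr (2 - p) = (x j)\<^sup>2 * D powr 0"
        by (simp only: mult.assoc flip: powr_add) simp
      finally show "(x j)\<^sup>2 \<le> min ((x j)\<^sup>2) (\<bar>x j\<bar> powr p * D powr (2 - p))" using D by simp
    qed
    finally show ?thesis .
  qed
  finally show ?thesis
    using sum.subset_diff[OF J(2), of "\<lambda>j. min ((x j)\<^sup>2) (\<bar>x j\<bar> powr p * D powr (2 - p))"] by simp
qed

lemma powr_le_powr_exp:
  fixes x k :: real
  assumes "x \<ge> 0" "k > 0"
  shows "x powr k \<le> k powr k * exp x"
proof -
  have "x / k \<le> exp (x / k)" using exp_ge_add_one_self[of "x / k"] by linarith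
  then have "(x / k) powr k \<le> exp (x / k) powr k" using assms by (intro powr_mono2) auto
  also have "\<dots> = exp x" using assms by (simp add: powr_def)
  finally show ?thesis using assms by (simp add: powr_divide field_simps)
qed

text \<open>
  Truncating at the level \<open>D\<close>, which is proportional to the mean of the norm, makes the square of the norm
  subexponential with scale \<open>b\<^sup>2\<close>: the truncated summands are below both \<open>x\<^sup>2\<close>, which keeps
  \<open>exp (\<psi> / 4 b\<^sup>2)\<close> integrable, and \<open>\<bar>x\<bar> powr p * D powr (2 - p)\<close>, whose sum has mean of order \<open>D\<^sup>2\<close>.
\<close>

context prob_space
begin

lemma nn_integral_std_normal:
  assumes "distributed M lborel X std_normal_density" "f \<in> borel_measurable borel"
  shows "(\<integral>\<^sup>+\<omega>. f (X \<omega>) \<partial>M) = (\<integral>\<^sup>+x. f x \<partial>std_normal_distribution)"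
  using assms distributed_distr_eq_density[OF assms(1), symmetric] distributed_measurable[OF assms(1)]
  by (simp add: nn_integral_distr)

lemma integral_std_normal:
  fixes f :: "real \<Rightarrow> real"
  assumes "distributed M lborel X std_normal_density" "f \<in> borel_measurable borel"
  shows "(\<integral>\<omega>. f (X \<omega>) \<partial>M) = (\<integral>x. f x \<partial>std_normal_distribution)"
    and "integrable M (\<lambda>\<omega>. f (X \<omega>)) \<longleftrightarrow> integrable std_normal_distribution f"
  using assms distributed_distr_eq_density[OF assms(1), symmetric] distributed_measurable[OF assms(1)]
  by (simp_all add: integral_distr integrable_distr_eq)

lemma gaussian_vector_exp_moment:
  assumes indep: "indep_vars (\<lambda>_. borel) G {..<n}"
    and dist: "\<And>j. j < n \<Longrightarrow> distributed M lborel (G j) std_normal_density"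
    and p: "p \<ge> 2" and b: "b > 0" and a: "\<And>j. j < n \<Longrightarrow> \<bar>a j\<bar> \<le> b"
    and D: "2 * gauss_norm p * ell_norm p n a \<le> D" "D > 0"
  shows "(\<integral>\<^sup>+\<omega>. ennreal (exp (((ell_norm p n (\<lambda>j. a j * G j \<omega>))\<^sup>2 - 2 * D\<^sup>2) / (4 * b\<^sup>2))) \<partial>M) \<le> 1"
proof -
  define \<psi> where "\<psi> x = min (x\<^sup>2) (\<bar>x\<bar> powr p * D powr (2 - p))" for x :: real
  define \<gamma> where "\<gamma> = gauss_norm p powr p"
  define \<kappa> where "\<kappa> j = D powr (2 - p) * \<bar>a j\<bar> powr p / (4 * b\<^sup>2)" for j
  have \<kappa>0: "\<kappa> j \<ge> 0" for j by (simp add: \<kappa>_def)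
  have \<psi>0: "\<psi> x \<ge> 0" for x by (simp add: \<psi>_def)
  have \<psi>_meas [measurable]: "\<psi> \<in> borel_measurable borel" unfolding \<psi>_def by measurable
  have one: "(\<integral>\<^sup>+x. ennreal (exp (\<psi> (a j * x) / (4 * b\<^sup>2))) \<partial>std_normal_distribution)
      \<le> ennreal (exp (\<kappa> j * (2 powr p * \<gamma>)))" if j: "j < n" for j
  proof -
    \<comment> \<open>In \<open>exp w \<le> 1 + w * exp w\<close> the factor \<open>w\<close> is
      bounded by the second member of the minimum and the exponent by the first, which leaves the
      integral of \<open>nn_integral_abs_powr_exp\<close>.\<close>
    have pt: "exp (\<psi> (a j * x) / (4 * b\<^sup>2)) \<le> 1 + \<kappa> j * (\<bar>x\<bar> powr p * exp (x\<^sup>2 / 4))" for x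
    proof -
      define w where "w = \<psi> (a j * x) / (4 * b\<^sup>2)"
      have "\<bar>a j\<bar>\<^sup>2 \<le> b\<^sup>2" using a[OF j] by (intro power_mono) auto
      then have ab: "(a j)\<^sup>2 * x\<^sup>2 \<le> b\<^sup>2 * x\<^sup>2" by (intro mult_right_mono) auto
      have w0: "w \<ge> 0" using \<psi>0 by (simp add: w_def)
      have w1: "w \<le> \<kappa> j * \<bar>x\<bar> powr p"
        unfolding w_def \<kappa>_def \<psi>_def using b by (simp add: divide_right_mono abs_mult powr_mult mult_ac)
      have "w \<le> (a j * x)\<^sup>2 / (4 * b\<^sup>2)"
        unfolding w_def \<psi>_def using b by (intro divide_right_mono) auto
      also have "\<dots> \<le> x\<^sup>2 / 4" using ab b by (simp add: field_simps)
      finally have w2: "w \<le> x\<^sup>2 / 4" .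
      have "exp w \<le> 1 + w * exp w"
        using exp_ge_add_one_self[of "-w"] by (simp add: exp_minus field_simps)
      also have "\<dots> \<le> 1 + (\<kappa> j * \<bar>x\<bar> powr p) * exp (x\<^sup>2 / 4)"
        using w0 w1 w2 by (intro add_left_mono mult_mono) auto
      finally show ?thesis by (simp add: w_def mult_ac)
    qed
    have "(\<integral>\<^sup>+x. ennreal (exp (\<psi> (a j * x) / (4 * b\<^sup>2))) \<partial>std_normal_distribution)
      \<le> (\<integral>\<^sup>+x. 1 + ennreal (\<kappa> j) * ennreal (\<bar>x\<bar> powr p * exp (x\<^sup>2 / 4)) \<partial>std_normal_distribution)"
    proof (rule nn_integral_mono)
      fix x :: real
      have "ennreal (exp (\<psi> (a j * x) / (4 * b\<^sup>2))) \<le> ennreal (1 + \<kappa> j * (\<bar>x\<bar> powr p * exp (x\<^sup>2 / 4)))"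
        by (rule ennreal_leI[OF pt])
      also have "\<dots> = 1 + ennreal (\<kappa> j) * ennreal (\<bar>x\<bar> powr p * exp (x\<^sup>2 / 4))"
        using \<kappa>0 by (subst ennreal_plus) (auto simp: ennreal_mult)
      finally show "ennreal (exp (\<psi> (a j * x) / (4 * b\<^sup>2))) \<le> 1 + ennreal (\<kappa> j) * ennreal (\<bar>x\<bar> powr p * exp (x\<^sup>2 / 4))" .
    qed
    also have "\<dots> = 1 + ennreal (\<kappa> j) * (\<integral>\<^sup>+x. ennreal (\<bar>x\<bar> powr p * exp (x\<^sup>2 / 4)) \<partial>std_normal_distribution)"
      using prob_space.emeasure_space_1[OF prob_space_std_normal]
      by (simp add: nn_integral_add nn_integral_cmult)
    also have "\<dots> \<le> 1 + ennreal (\<kappa> j) * ennreal (2 powr p * \<gamma>)"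
      unfolding \<gamma>_def using nn_integral_abs_powr_exp[OF p] by (intro add_left_mono mult_left_mono) auto
    also have "\<dots> = ennreal (1 + \<kappa> j * (2 powr p * \<gamma>))"
      using \<kappa>0 by (subst ennreal_plus) (auto simp: ennreal_mult \<gamma>_def)
    also have "\<dots> \<le> ennreal (exp (\<kappa> j * (2 powr p * \<gamma>)))"
      by (intro ennreal_leI) simp
    finally show ?thesis .
  qed
  \<comment> \<open>The factor 2 in the assumption on \<open>D\<close> cancels
    \<open>2 powr p\<close>. Of the \<open>2 * D\<^sup>2\<close> subtracted in the claim, one half
    pays for this sum and the other for the truncation.\<close>
  have \<Sigma>: "(\<Sum>j<n. \<kappa> j * (2 powr p * \<gamma>)) \<le> D\<^sup>2 / (4 * b\<^sup>2)"
  proof -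
    have "(\<Sum>j<n. \<kappa> j * (2 powr p * \<gamma>)) = D powr (2 - p) / (4 * b\<^sup>2) * ((\<Sum>j<n. \<bar>a j\<bar> powr p) * (2 powr p * \<gamma>))"
      by (simp add: \<kappa>_def sum_distrib_left sum_distrib_right sum_divide_distrib mult_ac)
    also have "(\<Sum>j<n. \<bar>a j\<bar> powr p) = ell_norm p n a powr p" using p by (simp add: ell_norm_powr)
    also have "ell_norm p n a powr p * (2 powr p * \<gamma>) = (2 * gauss_norm p * ell_norm p n a) powr p"
      using gauss_norm_pos[of p] p ell_norm_nonneg[of p n a] by (simp add: \<gamma>_def powr_mult mult_ac)
    also have "D powr (2 - p) / (4 * b\<^sup>2) * (2 * gauss_norm p * ell_norm p n a) powr p
        \<le> D powr (2 - p) / (4 * b\<^sup>2) * D powr p"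
      using D p gauss_norm_pos[of p] ell_norm_nonneg[of p n a]
      by (intro mult_left_mono powr_mono2) auto
    also have "\<dots> = D\<^sup>2 / (4 * b\<^sup>2)"
      using D by (simp flip: powr_add)
    finally show ?thesis .
  qed
  have "indep_vars (\<lambda>_. borel) (\<lambda>j \<omega>. ennreal (exp (\<psi> (a j * G j \<omega>) / (4 * b\<^sup>2)))) {..<n}"
    by (rule indep_vars_compose2[OF indep, of "\<lambda>j x. ennreal (exp (\<psi> (a j * x) / (4 * b\<^sup>2)))"]) measurable
  then have "(\<integral>\<^sup>+\<omega>. (\<Prod>j<n. ennreal (exp (\<psi> (a j * G j \<omega>) / (4 * b\<^sup>2)))) \<partial>M) =
      (\<Prod>j<n. \<integral>\<^sup>+\<omega>. ennreal (exp (\<psi> (a j * G j \<omega>) / (4 * b\<^sup>2))) \<partial>M)"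
    by (intro indep_vars_nn_integral) auto
  also have "\<dots> = (\<Prod>j<n. \<integral>\<^sup>+x. ennreal (exp (\<psi> (a j * x) / (4 * b\<^sup>2))) \<partial>std_normal_distribution)"
    by (intro prod.cong refl nn_integral_std_normal dist) auto
  also have "\<dots> \<le> (\<Prod>j<n. ennreal (exp (\<kappa> j * (2 powr p * \<gamma>))))"
    by (intro prod_mono_ennreal one) auto
  also have "\<dots> = ennreal (exp (\<Sum>j<n. \<kappa> j * (2 powr p * \<gamma>)))"
    by (simp add: prod_ennreal exp_sum)
  also have "\<dots> \<le> ennreal (exp (D\<^sup>2 / (4 * b\<^sup>2)))"
    using \<Sigma> by (intro ennreal_leI) simp
  finally have prod: "(\<integral>\<^sup>+\<omega>. (\<Prod>j<n. ennreal (exp (\<psi> (a j * G j \<omega>) / (4 * b\<^sup>2)))) \<partial>M) \<le> ennreal (exp (D\<^sup>2 / (4 * b\<^sup>2)))" .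
  have G_meas: "G j \<in> borel_measurable M" if "j < n" for j
    using distributed_measurable[OF dist[OF that]] by simp
  have "(\<integral>\<^sup>+\<omega>. ennreal (exp (((ell_norm p n (\<lambda>j. a j * G j \<omega>))\<^sup>2 - 2 * D\<^sup>2) / (4 * b\<^sup>2))) \<partial>M)
    \<le> (\<integral>\<^sup>+\<omega>. ennreal (exp (- (D\<^sup>2 / (4 * b\<^sup>2)))) * (\<Prod>j<n. ennreal (exp (\<psi> (a j * G j \<omega>) / (4 * b\<^sup>2)))) \<partial>M)"
  proof (rule nn_integral_mono)
    fix \<omega>
    have "(ell_norm p n (\<lambda>j. a j * G j \<omega>))\<^sup>2 - 2 * D\<^sup>2 \<le> (\<Sum>j<n. \<psi> (a j * G j \<omega>)) - D\<^sup>2"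
      using ell_norm_square_le_truncated[OF p D(2), of n "\<lambda>j. a j * G j \<omega>"] by (simp add: \<psi>_def)
    then have "((ell_norm p n (\<lambda>j. a j * G j \<omega>))\<^sup>2 - 2 * D\<^sup>2) / (4 * b\<^sup>2) \<le> ((\<Sum>j<n. \<psi> (a j * G j \<omega>)) - D\<^sup>2) / (4 * b\<^sup>2)"
      using b by (intro divide_right_mono) auto
    also have "\<dots> = - (D\<^sup>2 / (4 * b\<^sup>2)) + (\<Sum>j<n. \<psi> (a j * G j \<omega>) / (4 * b\<^sup>2))"
      by (simp add: diff_divide_distrib sum_divide_distrib)
    finally have "exp (((ell_norm p n (\<lambda>j. a j * G j \<omega>))\<^sup>2 - 2 * D\<^sup>2) / (4 * b\<^sup>2)) \<le>
        exp (- (D\<^sup>2 / (4 * b\<^sup>2))) * (\<Prod>j<n. exp (\<psi> (a j * G j \<omega>) / (4 * b\<^sup>2)))"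
      by (simp flip: exp_sum exp_add)
    then show "ennreal (exp (((ell_norm p n (\<lambda>j. a j * G j \<omega>))\<^sup>2 - 2 * D\<^sup>2) / (4 * b\<^sup>2)))
      \<le> ennreal (exp (- (D\<^sup>2 / (4 * b\<^sup>2)))) * (\<Prod>j<n. ennreal (exp (\<psi> (a j * G j \<omega>) / (4 * b\<^sup>2))))"
      by (simp add: prod_ennreal ennreal_leI prod_nonneg flip: ennreal_mult)
  qed
  also have "\<dots> = ennreal (exp (- (D\<^sup>2 / (4 * b\<^sup>2)))) * (\<integral>\<^sup>+\<omega>. (\<Prod>j<n. ennreal (exp (\<psi> (a j * G j \<omega>) / (4 * b\<^sup>2)))) \<partial>M)"
    using G_meas by (intro nn_integral_cmult borel_measurable_prod_ennreal) (measurable, auto)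
  also have "\<dots> \<le> ennreal (exp (- (D\<^sup>2 / (4 * b\<^sup>2)))) * ennreal (exp (D\<^sup>2 / (4 * b\<^sup>2)))"
    by (intro mult_left_mono prod) auto
  also have "\<dots> = 1" by (simp flip: ennreal_mult exp_add)
  finally show ?thesis .
qed

end

section \<open>The largest entry and the largest row norm of a Gaussian matrix\<close>

lemma (in prob_space) indep_vars_reindex_inj:
  assumes f: "inj_on f I" and X: "indep_vars M' X (f ` I)"
  shows "indep_vars (\<lambda>i. M' (f i)) (\<lambda>i. X (f i)) I"
  unfolding indep_vars_def2
proof (intro conjI ballI indep_setsI)
  show "random_variable (M' (f i)) (X (f i))" if "i \<in> I" for i
    using X that by (auto simp: indep_vars_def2)
  then show "{X (f i) -` A \<inter> space M |A. A \<in> sets (M' (f i))} \<subseteq> events" if "i \<in> I" for i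
    using that by (auto intro: measurable_sets)
  fix A J assume J: "J \<noteq> {}" "J \<subseteq> I" "finite J"
    and A: "\<forall>j\<in>J. A j \<in> {X (f j) -` A \<inter> space M |A. A \<in> sets (M' (f j))}"
  have inj: "inj_on f J" using f J by (blast intro: inj_on_subset)
  define B where "B k = A (the_inv_into J f k)" for k
  have B: "B (f j) = A j" if "j \<in> J" for j using inj that by (simp add: B_def the_inv_into_f_f)
  have "prob (\<Inter>k\<in>f ` J. B k) = (\<Prod>k\<in>f ` J. prob (B k))"
    using X J A B unfolding indep_vars_def2 by (intro indep_setsD) auto
  then show "prob (\<Inter>j\<in>J. A j) = (\<Prod>j\<in>J. prob (A j))"
    using B inj by (simp add: prod.reindex)
qed

locale gaussian_matrix = prob_space M for M :: "'w measure" +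
  fixes m n :: nat and g :: "nat \<Rightarrow> nat \<Rightarrow> 'w \<Rightarrow> real"
  assumes indep: "indep_vars (\<lambda>_. borel) (\<lambda>(i, j). g i j) ({..<m} \<times> {..<n})"
    and dist: "i < m \<Longrightarrow> j < n \<Longrightarrow> distributed M lborel (g i j) std_normal_density"
    and mn: "m \<ge> 1" "n \<ge> 1"
begin

lemma g_meas: "i < m \<Longrightarrow> j < n \<Longrightarrow> g i j \<in> borel_measurable M"
  using distributed_measurable[OF dist] by simp

lemma indep_row:
  assumes i: "i < m"
  shows "indep_vars (\<lambda>_. borel) (g i) {..<n}"
proof -
  have "inj_on (\<lambda>j. (i, j)) {..<n}" by (simp add: inj_on_def)
  moreover have "indep_vars (\<lambda>_. borel) (\<lambda>(i, j). g i j) ((\<lambda>j. (i, j)) ` {..<n})"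
    using i by (intro indep_vars_subset[OF indep]) auto
  ultimately show ?thesis
    using indep_vars_reindex_inj[of "\<lambda>j. (i, j)" "{..<n}" "\<lambda>_. borel" "\<lambda>(i, j). g i j"] by simp
qed

lemma integrable_entry_powr:
  assumes "i < m" "j < n" "r \<ge> 0"
  shows "integrable M (\<lambda>\<omega>. \<bar>g i j \<omega>\<bar> powr r)"
  using integral_std_normal(2)[OF dist[OF assms(1,2)], of "\<lambda>x. \<bar>x\<bar> powr r"] assms
    integrable_std_normal_abs_powr[of r] by simp

lemma integrable_entry: "i < m \<Longrightarrow> j < n \<Longrightarrow> integrable M (\<lambda>\<omega>. \<bar>c * g i j \<omega>\<bar>)"
  using integrable_entry_powr[of i j 1] by (simp add: abs_mult)

abbreviation "idx \<equiv> {..<m} \<times> {..<n}"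

lemma idx_ne: "idx \<noteq> {}"
  using mn by (auto simp: lessThan_empty_iff)

lemma integrable_max_entry:
  "integrable M (\<lambda>\<omega>. MAX (i, j)\<in>idx. \<bar>a i j * g i j \<omega>\<bar>)"
proof -
  have "integrable M (\<lambda>\<omega>. MAX k\<in>idx. \<bar>a (fst k) (snd k) * g (fst k) (snd k) \<omega>\<bar>)"
    using idx_ne by (intro integrable_MAX integrable_entry) auto
  then show ?thesis by (simp add: case_prod_beta')
qed

lemma abs_entry_le_max_entry:
  "i < m \<Longrightarrow> j < n \<Longrightarrow> \<bar>a i j * g i j \<omega>\<bar> \<le> (MAX (i, j)\<in>idx. \<bar>a i j * g i j \<omega>\<bar>)"
  by (intro Max_ge) force+

text \<open>The mean of \<open>\<bar>g\<bar>\<close> is \<open>sqrt (2 / pi)\<close>, which is at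
  least 1/2. Consequently the width of every row is at most twice the mean of the largest
  entry.\<close>

lemma max_entry_mean_ge:
  assumes "i < m" "j < n"
  shows "\<bar>a i j\<bar> / 2 \<le> (\<integral>\<omega>. (MAX (i, j)\<in>idx. \<bar>a i j * g i j \<omega>\<bar>) \<partial>M)"
proof -
  have "sqrt (2 / pi) \<ge> sqrt ((1 / 2)\<^sup>2)" using pi_less_4 by (intro real_sqrt_le_mono) (simp add: field_simps)
  then have s: "1 / 2 \<le> sqrt (2 / pi)" by simp
  have "(\<integral>x. \<bar>x\<bar> \<partial>std_normal_distribution) = sqrt (2 / pi)"
    using integral_std_normal_moment_abs_odd[of 0] by (subst integral_density) auto
  then have "(\<integral>\<omega>. \<bar>g i j \<omega>\<bar> \<partial>M) = sqrt (2 / pi)"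
    using integral_std_normal(1)[OF dist[OF assms], of abs] by simp
  then have "(\<integral>\<omega>. \<bar>a i j * g i j \<omega>\<bar> \<partial>M) = \<bar>a i j\<bar> * sqrt (2 / pi)"
    by (simp add: abs_mult)
  moreover have "\<bar>a i j\<bar> * (1 / 2) \<le> \<bar>a i j\<bar> * sqrt (2 / pi)" using s by (intro mult_left_mono) auto
  moreover have "(\<integral>\<omega>. \<bar>a i j * g i j \<omega>\<bar> \<partial>M) \<le> (\<integral>\<omega>. (MAX (i, j)\<in>idx. \<bar>a i j * g i j \<omega>\<bar>) \<partial>M)"
    using assms by (intro integral_mono integrable_entry integrable_max_entry abs_entry_le_max_entry)
  ultimately show ?thesis by simp
qed

text \<open>By Markov's inequality all entries are at most \<open>2 * T\<close> with probability at
  least 1/2. Independence makes this a product of factors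
  \<open>1 - bad k \<le> exp (- bad k)\<close>, so the \<open>bad k\<close> sum to at most 1, and
  \<open>std_normal_tail_lower\<close> bounds each of them below by the summand divided by
  16.\<close>

lemma sum_exp_max_entry_le:
  fixes a :: "nat \<Rightarrow> nat \<Rightarrow> real"
  defines "T \<equiv> \<integral>\<omega>. (MAX (i, j)\<in>idx. \<bar>a i j * g i j \<omega>\<bar>) \<partial>M"
  assumes T: "T > 0"
  shows "(\<Sum>(i, j)\<in>{(i, j)\<in>idx. a i j \<noteq> 0}. exp (- (4 * T\<^sup>2 / (a i j)\<^sup>2))) \<le> 16"
proof -
  define X where "X \<omega> = (MAX (i, j)\<in>idx. \<bar>a i j * g i j \<omega>\<bar>)" for \<omega>
  have X_int: "integrable M X" unfolding X_def by (rule integrable_max_entry)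
  have X0: "X \<omega> \<ge> 0" for \<omega>
    using abs_entry_le_max_entry[of 0 0 a \<omega>] mn unfolding X_def by force
  have X_T: "(\<integral>\<omega>. X \<omega> \<partial>M) = T" by (simp add: T_def X_def)
  define bad where "bad k = prob {\<omega>\<in>space M. 2 * T < \<bar>case k of (i, j) \<Rightarrow> a i j * g i j \<omega>\<bar>}" for k
  define Z where "Z k = {x::real. \<bar>(case k of (i, j) \<Rightarrow> a i j) * x\<bar> \<le> 2 * T}" for k
  have Z: "Z k \<in> sets borel" for k unfolding Z_def by measurable
  define gg where "gg = (\<lambda>(i, j). g i j)"
  have gg_meas: "gg k \<in> borel_measurable M" if "k \<in> idx" for k
    using that g_meas by (auto simp: gg_def)
  have good: "prob (gg k -` Z k \<inter> space M) = 1 - bad k" if k: "k \<in> idx" for k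
  proof -
    have "gg k -` Z k \<inter> space M = space M - {\<omega>\<in>space M. 2 * T < \<bar>case k of (i, j) \<Rightarrow> a i j * g i j \<omega>\<bar>}"
      by (auto simp: gg_def Z_def split: prod.splits)
    moreover have "{\<omega>\<in>space M. 2 * T < \<bar>case k of (i, j) \<Rightarrow> a i j * g i j \<omega>\<bar>} \<in> events"
    proof -
      obtain i j where ij: "k = (i, j)" by force
      then have [measurable]: "g i j \<in> borel_measurable M" using k g_meas by auto
      show ?thesis unfolding ij by simp
    qed
    ultimately show ?thesis by (simp add: bad_def prob_compl)
  qed
  have "prob {\<omega>\<in>space M. X \<omega> \<ge> 2 * T} \<le> T / (2 * T)"
    using integral_Markov_inequality_measure[OF X_int, of "{}" "2 * T"] X0 T X_T by simp
  then have "prob {\<omega>\<in>space M. X \<omega> \<ge> 2 * T} \<le> 1 / 2" using T by simp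
  moreover have "{\<omega>\<in>space M. X \<omega> \<ge> 2 * T} \<in> events" using X_int by measurable
  ultimately have "1 / 2 \<le> prob (space M - {\<omega>\<in>space M. X \<omega> \<ge> 2 * T})"
    by (simp add: prob_compl)
  also have "\<dots> \<le> prob (\<Inter>k\<in>idx. gg k -` Z k \<inter> space M)"
  proof (rule finite_measure_mono)
    show "space M - {\<omega>\<in>space M. X \<omega> \<ge> 2 * T} \<subseteq> (\<Inter>k\<in>idx. gg k -` Z k \<inter> space M)"
      using abs_entry_le_max_entry[where a = a] unfolding X_def gg_def Z_def
      by (auto simp: not_le) (meson less_imp_le order_trans)
    show "(\<Inter>k\<in>idx. gg k -` Z k \<inter> space M) \<in> events"
      using idx_ne gg_meas Z by (intro sets.finite_INT) (auto intro: measurable_sets)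
  qed
  also have "\<dots> = (\<Prod>k\<in>idx. prob (gg k -` Z k \<inter> space M))"
    using idx_ne Z by (intro indep_varsD[OF indep, folded gg_def]) auto
  also have "\<dots> = (\<Prod>k\<in>idx. 1 - bad k)" by (intro prod.cong good) auto
  also have "\<dots> \<le> (\<Prod>k\<in>idx. exp (- bad k))"
    using exp_ge_add_one_self[of "- bad k" for k] by (intro prod_mono) (auto simp: bad_def)
  also have "\<dots> = exp (- (\<Sum>k\<in>idx. bad k))" by (simp add: exp_sum sum_negf[symmetric] del: sum_negf)
  finally have "exp (\<Sum>k\<in>idx. bad k) \<le> 2" by (simp add: exp_minus field_simps)
  also have "\<dots> \<le> exp 1" using exp_ge_add_one_self[of 1] by simp
  finally have sum_bad: "(\<Sum>k\<in>idx. bad k) \<le> 1" by simp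
  have low: "exp (- (4 * T\<^sup>2 / (a i j)\<^sup>2)) / 16 \<le> bad (i, j)" if "i < m" "j < n" "a i j \<noteq> 0" for i j
  proof -
    define t where "t = 2 * T / \<bar>a i j\<bar>"
    have "exp (- (t\<^sup>2)) / 16 \<le> measure std_normal_distribution {x. t < \<bar>x\<bar>}"
      using T by (intro std_normal_tail_lower) (auto simp: t_def)
    also have "\<dots> = measure (distr M lborel (g i j)) {x. t < \<bar>x\<bar>}"
      using distributed_distr_eq_density[OF dist[OF that(1,2)]] by simp
    also have "\<dots> = prob (g i j -` {x. t < \<bar>x\<bar>} \<inter> space M)"
      using g_meas[OF that(1,2)] by (intro measure_distr) auto
    also have "g i j -` {x. t < \<bar>x\<bar>} \<inter> space M = {\<omega>\<in>space M. 2 * T < \<bar>a i j * g i j \<omega>\<bar>}"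
      using that(3) by (auto simp: t_def abs_mult field_simps)
    finally show ?thesis
      by (simp add: bad_def t_def power_divide power_mult_distrib)
  qed
  have "(\<Sum>(i, j)\<in>{(i, j)\<in>idx. a i j \<noteq> 0}. exp (- (4 * T\<^sup>2 / (a i j)\<^sup>2)) / 16) \<le> (\<Sum>k\<in>{(i, j)\<in>idx. a i j \<noteq> 0}. bad k)"
    using low by (intro sum_mono) auto
  also have "\<dots> \<le> (\<Sum>k\<in>idx. bad k)"
    by (intro sum_mono2) (auto simp: bad_def)
  finally show ?thesis using sum_bad
    by (simp add: case_prod_beta' flip: sum_divide_distrib)
qed

lemma ell_norm_row_meas: "i < m \<Longrightarrow> (\<lambda>\<omega>. ell_norm p n (\<lambda>j. a i j * g i j \<omega>)) \<in> borel_measurable M"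
proof -
  assume "i < m"
  then have [measurable]: "g i j \<in> borel_measurable M" if "j \<in> {..<n}" for j using that g_meas by auto
  show ?thesis unfolding ell_norm_def by measurable
qed

text \<open>Each \<open>exp (Z i)\<close> has mean at most 1, but an unweighted union bound would
  lose the number of rows. The shift by \<open>\<tau> i\<close> gives row \<open>i\<close> the
  weight \<open>exp (- \<tau> i)\<close>, and \<open>sum_exp_max_entry_le\<close> bounds the total
  weight independently of \<open>m\<close>.\<close>

lemma max_row_norm_moment:
  fixes a :: "nat \<Rightarrow> nat \<Rightarrow> real" and p q :: real
  defines "T \<equiv> \<integral>\<omega>. (MAX (i, j)\<in>idx. \<bar>a i j * g i j \<omega>\<bar>) \<partial>M"
    and "\<rho> \<equiv> MAX i\<in>{..<m}. ell_norm p n (a i)"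
  assumes p: "p \<ge> 2" and q: "q \<ge> 2"
  shows "(\<integral>\<^sup>+\<omega>. ennreal (MAX i\<in>{..<m}. ell_norm p n (\<lambda>j. a i j * g i j \<omega>) powr q) \<partial>M)
    \<le> ennreal (300 * 30 powr q * ((gauss_norm p * \<rho>) powr q + (gauss_norm q * T) powr q))"
proof (cases "\<exists>i<m. \<exists>j<n. a i j \<noteq> 0")
  case False
  then have "ell_norm p n (\<lambda>j. a i j * g i j \<omega>) = 0" if "i < m" for i \<omega>
    using that by (simp add: ell_norm_def)
  then have "(\<lambda>i. ell_norm p n (\<lambda>j. a i j * g i j \<omega>) powr q) ` {..<m} = {0}" for \<omega>
    using mn q by (auto simp: image_iff intro!: exI[of _ 0])
  then show ?thesis by simp
next
  case True
  define S where "S i \<omega> = ell_norm p n (\<lambda>j. a i j * g i j \<omega>)" for i \<omega>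
  define b where "b i = (MAX j\<in>{..<n}. \<bar>a i j\<bar>)" for i
  define D where "D = 2 * gauss_norm p * \<rho>"
  define k where "k = q / 2"
  define W where "W = {i\<in>{..<m}. b i \<noteq> 0}"
  \<comment> \<open>Chosen so that \<open>4 * (b i)\<^sup>2 * \<tau> i\<close> is
    \<open>16 * T\<^sup>2\<close> for every row of nonzero width, while
    \<open>exp (- \<tau> i)\<close> is a summand of \<open>sum_exp_max_entry_le\<close>.\<close>
  define \<tau> where "\<tau> i = 4 * T\<^sup>2 / (b i)\<^sup>2" for i
  define Z where "Z i \<omega> = ((S i \<omega>)\<^sup>2 - 2 * D\<^sup>2) / (4 * (b i)\<^sup>2)" for i \<omega>
  have ne: "{..<n} \<noteq> {}" "{..<m} \<noteq> {}" using mn by (auto simp: lessThan_empty_iff)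
  have k: "k \<ge> 1" using q by (simp add: k_def)
  have ab: "\<bar>a i j\<bar> \<le> b i" if "j < n" for i j
    using that by (auto simp: b_def intro!: Max_ge)
  have b_ex: "\<exists>j<n. \<bar>a i j\<bar> = b i" for i
  proof -
    have "b i \<in> (\<lambda>j. \<bar>a i j\<bar>) ` {..<n}" unfolding b_def using ne by (intro Max_in) auto
    then show ?thesis by auto
  qed
  have b0: "b i \<ge> 0" for i using b_ex[of i] by (metis abs_ge_zero)
  have aT: "\<bar>a i j\<bar> / 2 \<le> T" if "i < m" "j < n" for i j
    unfolding T_def by (rule max_entry_mean_ge[OF that])
  have bT: "b i \<le> 2 * T" if "i < m" for i
    using b_ex[of i] aT[OF that] by force
  obtain i0 j0 where ij0: "i0 < m" "j0 < n" "a i0 j0 \<noteq> 0" using True by blast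
  then have T: "T > 0" using aT[of i0 j0] by (smt (z3) zero_less_abs_iff divide_pos_pos)
  have \<rho>_ge: "ell_norm p n (a i) \<le> \<rho>" if "i < m" for i
    using that by (auto simp: \<rho>_def intro!: Max_ge)
  have "ell_norm p n (a i0) > 0"
  proof -
    have "(\<Sum>j<n. \<bar>a i0 j\<bar> powr p) > 0"
      using ij0 by (intro sum_pos2[of _ j0]) auto
    then show ?thesis by (simp add: ell_norm_def)
  qed
  then have \<rho>: "\<rho> > 0" using \<rho>_ge[OF ij0(1)] by linarith
  have D: "D > 0" using \<rho> gauss_norm_pos[of p] p by (simp add: D_def)
  have Zexp: "(\<integral>\<^sup>+\<omega>. ennreal (exp (Z i \<omega>)) \<partial>M) \<le> 1" if i: "i \<in> W" for i
  proof -
    have im: "i < m" "b i > 0" using i b0[of i] by (auto simp: W_def)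
    have "2 * gauss_norm p * ell_norm p n (a i) \<le> D"
      unfolding D_def using \<rho>_ge[OF im(1)] gauss_norm_pos[of p] p by simp
    then show ?thesis unfolding Z_def S_def
      using ab im D p by (intro gaussian_vector_exp_moment indep_row dist) auto
  qed
  have sumW: "(\<Sum>i\<in>W. exp (- \<tau> i)) \<le> 16"
  proof -
    have "\<forall>i. \<exists>j. j < n \<and> \<bar>a i j\<bar> = b i" using b_ex by blast
    \<comment> \<open>One maximal entry per row embeds the sum over rows into the sum over
      entries.\<close>
    then obtain J where J: "\<And>i. J i < n" "\<And>i. \<bar>a i (J i)\<bar> = b i" by metis
    have bJ: "(b i)\<^sup>2 = (a i (J i))\<^sup>2" for i using J(2)[of i] by (metis power2_abs)
    have aJ: "a i (J i) \<noteq> 0" if "i \<in> W" for i using that J(2)[of i] by (auto simp: W_def)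
    have "(\<Sum>i\<in>W. exp (- \<tau> i)) = (\<Sum>(i, j)\<in>(\<lambda>i. (i, J i)) ` W. exp (- (4 * T\<^sup>2 / (a i j)\<^sup>2)))"
      by (subst sum.reindex) (auto simp: inj_on_def \<tau>_def bJ)
    also have "\<dots> \<le> (\<Sum>(i, j)\<in>{(i, j)\<in>idx. a i j \<noteq> 0}. exp (- (4 * T\<^sup>2 / (a i j)\<^sup>2)))"
      using J aJ by (intro sum_mono2) (auto simp: W_def intro: finite_subset[of _ idx])
    also have "\<dots> \<le> 16" using sum_exp_max_entry_le[of a] T by (simp add: T_def)
    finally show ?thesis .
  qed
  have pt: "S i \<omega> powr q \<le> 3 powr k * ((2 * D\<^sup>2) powr k + (16 * T\<^sup>2) powr k + (16 * T\<^sup>2) powr k * (k powr k * (\<Sum>i\<in>W. exp (Z i \<omega> - \<tau> i))))"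
    if i: "i < m" for i \<omega>
  proof (cases "i \<in> W")
    case False
    then have "b i = 0" using i by (simp add: W_def)
    then have "a i j = 0" if "j < n" for j using ab[OF that, of i] by simp
    then have "S i \<omega> = 0" by (simp add: S_def ell_norm_def)
    then show ?thesis using q by (auto intro!: mult_nonneg_nonneg add_nonneg_nonneg sum_nonneg)
  next
    case True
    have bi: "b i > 0" using True b0[of i] by (auto simp: W_def)
    define r where "r = max 0 (Z i \<omega> - \<tau> i)"
    have r: "r \<ge> 0" by (simp add: r_def)
    have "(S i \<omega>)\<^sup>2 = 2 * D\<^sup>2 + 16 * T\<^sup>2 + 4 * (b i)\<^sup>2 * (Z i \<omega> - \<tau> i)"
      using bi by (simp add: Z_def \<tau>_def field_simps)
    also have "4 * (b i)\<^sup>2 * (Z i \<omega> - \<tau> i) \<le> 4 * (b i)\<^sup>2 * r"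
      by (intro mult_left_mono) (auto simp: r_def)
    also have "\<dots> \<le> 4 * (2 * T)\<^sup>2 * r"
      using bT[OF i] bi r by (intro mult_right_mono mult_left_mono power_mono) auto
    finally have S2: "(S i \<omega>)\<^sup>2 \<le> 2 * D\<^sup>2 + 16 * T\<^sup>2 + 16 * T\<^sup>2 * r" by (simp add: power_mult_distrib)
    \<comment> \<open>A sum of three terms is at most three times the largest, so its
      \<open>k\<close>-th power splits at the price of \<open>3 powr k\<close>.\<close>
    define u where "u = Max {2 * D\<^sup>2, 16 * T\<^sup>2, 16 * T\<^sup>2 * r}"
    have u: "u \<ge> 0" "u powr k \<le> (2 * D\<^sup>2) powr k + (16 * T\<^sup>2) powr k + (16 * T\<^sup>2 * r) powr k"
      unfolding u_def using r by (auto simp: max_def)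
    have "S i \<omega> \<ge> 0" by (simp add: S_def ell_norm_nonneg)
    then have "S i \<omega> powr q = ((S i \<omega>)\<^sup>2) powr k"
      using powr_powr[of "S i \<omega>" 2 k] by (simp add: k_def)
    also have "\<dots> \<le> (3 * u) powr k"
      using S2 k by (intro powr_mono2) (auto simp: u_def)
    also have "\<dots> = 3 powr k * u powr k" using u by (simp add: powr_mult)
    also have "\<dots> \<le> 3 powr k * ((2 * D\<^sup>2) powr k + (16 * T\<^sup>2) powr k + (16 * T\<^sup>2 * r) powr k)"
      using u by (intro mult_left_mono) auto
    also have "(16 * T\<^sup>2 * r) powr k = (16 * T\<^sup>2) powr k * r powr k" using r by (simp add: powr_mult)
    also have "r powr k \<le> k powr k * (\<Sum>i\<in>W. exp (Z i \<omega> - \<tau> i))"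
    proof (cases "Z i \<omega> - \<tau> i \<le> 0")
      case True
      then have "r = 0" by (simp add: r_def)
      then show ?thesis using k by (auto intro!: mult_nonneg_nonneg sum_nonneg)
    next
      case False
      have "exp (Z i \<omega> - \<tau> i) \<le> (\<Sum>i\<in>W. exp (Z i \<omega> - \<tau> i))"
        using True by (intro member_le_sum) (auto simp: W_def)
      moreover have "r = Z i \<omega> - \<tau> i" using False by (simp add: r_def)
      ultimately have "k powr k * exp r \<le> k powr k * (\<Sum>i\<in>W. exp (Z i \<omega> - \<tau> i))"
        by (intro mult_left_mono) auto
      moreover have "r powr k \<le> k powr k * exp r" using r k by (intro powr_le_powr_exp) auto
      ultimately show ?thesis by linarith
    qed
    finally show ?thesis by (simp add: mult_left_mono)
  qed
  define c1 where "c1 = 3 powr k * ((2 * D\<^sup>2) powr k + (16 * T\<^sup>2) powr k)"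
  define c2 where "c2 = 3 powr k * ((16 * T\<^sup>2) powr k * k powr k)"
  have c: "c1 \<ge> 0" "c2 \<ge> 0" by (auto simp: c1_def c2_def)
  have Z_meas: "Z i \<in> borel_measurable M" if "i \<in> W" for i
  proof -
    have [measurable]: "S i \<in> borel_measurable M" unfolding S_def using that by (intro ell_norm_row_meas) (auto simp: W_def)
    show ?thesis unfolding Z_def[abs_def] by measurable
  qed
  have "(\<integral>\<^sup>+\<omega>. ennreal (MAX i\<in>{..<m}. S i \<omega> powr q) \<partial>M) \<le> (\<integral>\<^sup>+\<omega>. ennreal c1 + ennreal c2 * (\<Sum>i\<in>W. ennreal (exp (- \<tau> i)) * ennreal (exp (Z i \<omega>))) \<partial>M)"
  proof (rule nn_integral_mono)
    fix \<omega>
    have "(MAX i\<in>{..<m}. S i \<omega> powr q) \<le> c1 + c2 * (\<Sum>i\<in>W. exp (- \<tau> i) * exp (Z i \<omega>))"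
      using ne pt[of _ \<omega>] by (intro Max.boundedI) (auto simp: c1_def c2_def algebra_simps simp flip: exp_add)
    then have "ennreal (MAX i\<in>{..<m}. S i \<omega> powr q) \<le> ennreal (c1 + c2 * (\<Sum>i\<in>W. exp (- \<tau> i) * exp (Z i \<omega>)))"
      by (rule ennreal_leI)
    also have "\<dots> = ennreal c1 + ennreal c2 * (\<Sum>i\<in>W. ennreal (exp (- \<tau> i)) * ennreal (exp (Z i \<omega>)))"
      using c by (simp add: ennreal_plus ennreal_mult sum_nonneg mult_nonneg_nonneg flip: ennreal_mult)
    finally show "ennreal (MAX i\<in>{..<m}. S i \<omega> powr q) \<le> ennreal c1 + ennreal c2 * (\<Sum>i\<in>W. ennreal (exp (- \<tau> i)) * ennreal (exp (Z i \<omega>)))" .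
  qed
  also have "\<dots> = ennreal c1 + ennreal c2 * (\<Sum>i\<in>W. ennreal (exp (- \<tau> i)) * (\<integral>\<^sup>+\<omega>. ennreal (exp (Z i \<omega>)) \<partial>M))"
    using Z_meas by (simp add: nn_integral_add nn_integral_cmult nn_integral_sum emeasure_space_1)
  also have "\<dots> \<le> ennreal c1 + ennreal c2 * (\<Sum>i\<in>W. ennreal (exp (- \<tau> i)) * 1)"
    by (intro add_left_mono mult_left_mono sum_mono Zexp) auto
  also have "\<dots> = ennreal (c1 + c2 * (\<Sum>i\<in>W. exp (- \<tau> i)))"
    using c by (simp add: ennreal_plus ennreal_mult sum_nonneg)
  also have "\<dots> \<le> ennreal (c1 + c2 * 16)"
    using sumW c by (intro ennreal_leI add_left_mono mult_left_mono) auto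
  also have "\<dots> \<le> ennreal (300 * 30 powr q * ((gauss_norm p * \<rho>) powr q + (gauss_norm q * T) powr q))"
  proof (rule ennreal_leI)
    have "exp q = exp 1 powr q" by (simp add: powr_def)
    also have "\<dots> \<le> 3 powr q" using exp_le q by (intro powr_mono2) auto
    finally have e3: "exp q \<le> 3 powr q" .
    have sqr: "(z\<^sup>2) powr k = z powr q" if "z \<ge> 0" for z :: real
      using powr_powr[of z 2 k] that by (simp add: k_def)
    have t1: "3 powr k * (2 * D\<^sup>2) powr k \<le> 30 powr q * (gauss_norm p * \<rho>) powr q"
    proof -
      have "3 powr k * (2 * D\<^sup>2) powr k = ((3 * 2 * 4) * (gauss_norm p * \<rho>)\<^sup>2) powr k"
        by (simp add: D_def power_mult_distrib powr_mult[symmetric])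
      also have "\<dots> \<le> (30\<^sup>2 * (gauss_norm p * \<rho>)\<^sup>2) powr k"
        using k by (intro powr_mono2 mult_right_mono) auto
      also have "\<dots> = ((30 * (gauss_norm p * \<rho>))\<^sup>2) powr k" by (simp add: power_mult_distrib)
      also have "\<dots> = (30 * (gauss_norm p * \<rho>)) powr q"
        using gauss_norm_pos[of p] p \<rho> by (intro sqr) auto
      also have "\<dots> = 30 powr q * (gauss_norm p * \<rho>) powr q"
        by (rule powr_mult)
      finally show ?thesis .
    qed
    have t2: "3 powr k * (16 * T\<^sup>2) powr k \<le> 10 powr q * T powr q"
    proof -
      have "3 powr k * (16 * T\<^sup>2) powr k = (48 * T\<^sup>2) powr k"
        by (simp add: powr_mult[symmetric])
      also have "\<dots> \<le> (10\<^sup>2 * T\<^sup>2) powr k" using k by (intro powr_mono2 mult_right_mono) auto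
      also have "\<dots> = ((10 * T)\<^sup>2) powr k" by (simp add: power_mult_distrib)
      also have "\<dots> = (10 * T) powr q" using T by (intro sqr) auto
      also have "\<dots> = 10 powr q * T powr q" by (rule powr_mult)
      finally show ?thesis .
    qed
    \<comment> \<open>\<open>k powr k\<close> came from turning exponential into polynomial moments
      and is now traded for \<open>gauss_norm q powr q\<close>, up to
      \<open>exp q \<le> 3 powr q\<close>. Together with the base 10 of \<open>t2\<close>, which
      rests on \<open>3 * 16 \<le> 10\<^sup>2\<close>, this gives the base 30; the factor is
      \<open>17 * 16 \<le> 300\<close>.\<close>
    have "q powr k * exp (- q) / 16 \<le> gauss_norm q powr q" using gauss_norm_lower[of q] q by (simp add: k_def)
    then have qk: "q powr k \<le> 16 * exp q * gauss_norm q powr q" by (simp add: exp_minus field_simps)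
    have "k powr k \<le> q powr k" using q by (intro powr_mono2) (auto simp: k_def)
    moreover have "1 \<le> q powr k" using q k by (intro ge_one_powr_ge_zero) auto
    ultimately have "1 + k powr k * 16 \<le> 17 * q powr k" by linarith
    also have "\<dots> \<le> 17 * (16 * exp q * gauss_norm q powr q)" using qk by simp
    also have "\<dots> \<le> 300 * (3 powr q * gauss_norm q powr q)"
      using e3 by (simp add: mult_mono)
    finally have "1 + k powr k * 16 \<le> 300 * (3 powr q * gauss_norm q powr q)" .
    then have "10 powr q * T powr q * (1 + k powr k * 16) \<le> 10 powr q * T powr q * (300 * (3 powr q * gauss_norm q powr q))"
      by (intro mult_left_mono) auto
    also have "\<dots> = 300 * ((10 * 3) powr q * (gauss_norm q * T) powr q)"
      unfolding powr_mult by (simp only: mult_ac)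
    finally have t3: "10 powr q * T powr q * (1 + k powr k * 16) \<le> 300 * (30 powr q * (gauss_norm q * T) powr q)" by simp
    have "c1 + c2 * 16 = 3 powr k * (2 * D\<^sup>2) powr k + 3 powr k * (16 * T\<^sup>2) powr k * (1 + k powr k * 16)"
      by (simp add: c1_def c2_def algebra_simps)
    also have "\<dots> \<le> 30 powr q * (gauss_norm p * \<rho>) powr q + 10 powr q * T powr q * (1 + k powr k * 16)"
      using t1 t2 by (intro add_mono mult_right_mono) auto
    also have "\<dots> \<le> 300 * (30 powr q * (gauss_norm p * \<rho>) powr q) + 300 * (30 powr q * (gauss_norm q * T) powr q)"
      using t3 by (intro add_mono) auto
    finally show "c1 + c2 * 16 \<le> 300 * 30 powr q * ((gauss_norm p * \<rho>) powr q + (gauss_norm q * T) powr q)"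
      by (simp add: algebra_simps)
  qed
  finally show ?thesis by (simp add: S_def)
qed

lemma linear_form_moment:
  assumes i: "i < m" and q: "q > 0"
  shows "(\<integral>\<omega>. \<bar>\<Sum>j<n. c j * g i j \<omega>\<bar> powr q \<partial>M) = gauss_norm q powr q * (\<Sum>j<n. (c j)\<^sup>2) powr (q / 2)"
    and "integrable M (\<lambda>\<omega>. \<bar>\<Sum>j<n. c j * g i j \<omega>\<bar> powr q)"
proof -
  \<comment> \<open>Zero coefficients are discarded because a degenerate summand has no normal
    density.\<close>
  define J where "J = {j\<in>{..<n}. c j \<noteq> 0}"
  have sumJ: "(\<Sum>j<n. c j * h j) = (\<Sum>j\<in>J. c j * h j)" for h :: "nat \<Rightarrow> real"
    by (rule sum.mono_neutral_right) (auto simp: J_def)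
  have sumJ2: "(\<Sum>j<n. (c j)\<^sup>2) = (\<Sum>j\<in>J. (c j)\<^sup>2)"
    by (rule sum.mono_neutral_right) (auto simp: J_def)
  have "(\<integral>\<omega>. \<bar>\<Sum>j<n. c j * g i j \<omega>\<bar> powr q \<partial>M) = gauss_norm q powr q * (\<Sum>j<n. (c j)\<^sup>2) powr (q / 2) \<and>
    integrable M (\<lambda>\<omega>. \<bar>\<Sum>j<n. c j * g i j \<omega>\<bar> powr q)"
  proof (cases "J = {}")
    case True
    then show ?thesis using q by (simp add: sumJ sumJ2)
  next
    case False
    define s where "s = sqrt (\<Sum>j\<in>J. (c j)\<^sup>2)"
    have "(\<Sum>j\<in>J. (c j)\<^sup>2) > 0" using False by (intro sum_pos) (auto simp: J_def)
    then have s: "s > 0" by (simp add: s_def)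
    have d1: "distributed M lborel (\<lambda>\<omega>. c j * g i j \<omega>) (normal_density 0 \<bar>c j\<bar>)" if "j \<in> J" for j
      using normal_density_affine[OF dist[of i j], of "c j" 0] that i by (simp add: J_def)
    have "indep_vars (\<lambda>_. borel) (\<lambda>j \<omega>. c j * g i j \<omega>) J"
      by (rule indep_vars_compose2[OF indep_vars_subset[OF indep_row[OF i]], of J "\<lambda>j x. c j * x"]) (auto simp: J_def)
    then have "distributed M lborel (\<lambda>\<omega>. \<Sum>j\<in>J. c j * g i j \<omega>) (normal_density (\<Sum>j\<in>J. 0) (sqrt (\<Sum>j\<in>J. \<bar>c j\<bar>\<^sup>2)))"
      using False d1 by (intro sum_indep_normal) (auto simp: J_def)
    then have "distributed M lborel (\<lambda>\<omega>. \<Sum>j\<in>J. c j * g i j \<omega>) (normal_density 0 s)"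
      by (simp add: s_def)
    then have d: "distributed M lborel (\<lambda>\<omega>. ((\<Sum>j\<in>J. c j * g i j \<omega>) - 0) / s) std_normal_density"
      using normal_standard_normal_convert[OF s, where X = "\<lambda>\<omega>. \<Sum>j\<in>J. c j * g i j \<omega>" and \<mu> = 0] by blast
    have eq: "\<bar>\<Sum>j<n. c j * g i j \<omega>\<bar> powr q = s powr q * \<bar>((\<Sum>j\<in>J. c j * g i j \<omega>) - 0) / s\<bar> powr q" for \<omega>
      using s by (simp add: sumJ powr_mult[symmetric])
    have sq: "s powr q = (\<Sum>j<n. (c j)\<^sup>2) powr (q / 2)"
      using powr_powr[of "\<Sum>j\<in>J. (c j)\<^sup>2" "1/2" q] by (simp add: s_def sumJ2 powr_half_sqrt sum_nonneg)
    show ?thesis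
      unfolding eq sq using integral_std_normal[OF d, of "\<lambda>x. \<bar>x\<bar> powr q"] q integrable_std_normal_abs_powr[of q]
      by (simp add: gauss_norm_powr)
  qed
  then show "(\<integral>\<omega>. \<bar>\<Sum>j<n. c j * g i j \<omega>\<bar> powr q \<partial>M) = gauss_norm q powr q * (\<Sum>j<n. (c j)\<^sup>2) powr (q / 2)"
    "integrable M (\<lambda>\<omega>. \<bar>\<Sum>j<n. c j * g i j \<omega>\<bar> powr q)" by auto
qed

end

section \<open>Supremum over the unit ball\<close>

lemma abs_le_one_of_ell_norm:
  assumes "s > 0" "ell_norm s n y \<le> 1" "j < n"
  shows "\<bar>y j\<bar> \<le> 1" and "(\<Sum>j<n. \<bar>y j\<bar> powr s) \<le> 1"
proof -
  have "(\<Sum>j<n. \<bar>y j\<bar> powr s) = ell_norm s n y powr s" using assms by (simp add: ell_norm_powr)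
  also have "\<dots> \<le> 1 powr s" using assms ell_norm_nonneg by (intro powr_mono2) auto
  finally show le: "(\<Sum>j<n. \<bar>y j\<bar> powr s) \<le> 1" by simp
  have "\<bar>y j\<bar> powr s \<le> (\<Sum>j<n. \<bar>y j\<bar> powr s)" using assms by (intro member_le_sum) auto
  with le have "\<bar>y j\<bar> powr s \<le> 1" by linarith
  then show "\<bar>y j\<bar> \<le> 1" using assms(1) gr_one_powr[of "\<bar>y j\<bar>" s] by linarith
qed

lemma sum_squares_le_one_of_ell_norm:
  assumes "0 < s" "s \<le> 2" "ell_norm s n y \<le> 1"
  shows "(\<Sum>j<n. (y j)\<^sup>2) \<le> 1"
proof (cases "n = 0")
  case False
  have "(y j)\<^sup>2 \<le> \<bar>y j\<bar> powr s" if "j < n" for j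
  proof (cases "y j = 0")
    case False
    have "\<bar>y j\<bar> powr 2 \<le> \<bar>y j\<bar> powr s"
      using abs_le_one_of_ell_norm(1)[OF assms(1,3) that] assms by (intro powr_mono') auto
    then show ?thesis using False by simp
  qed simp
  then have "(\<Sum>j<n. (y j)\<^sup>2) \<le> (\<Sum>j<n. \<bar>y j\<bar> powr s)" by (intro sum_mono) auto
  then show ?thesis using abs_le_one_of_ell_norm(2)[OF assms(1,3), of 0] False by simp
qed simp

text \<open>Jensen's inequality for the power \<open>k = q / 2\<close> with weights
  \<open>(y j)\<^sup>2\<close> of total mass \<open>\<theta> \<le> 1\<close>, from the tangent at
  \<open>S\<close>. The missing mass is harmless, since it enters through
  \<open>\<theta> + k * (1 - \<theta>)\<close>, which is at least 1. At \<open>q = 2\<close> the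
  power is linear and \<open>powr_tangent\<close> does not apply.\<close>

lemma powr_sum_weighted_squares_le:
  fixes a y :: "'a \<Rightarrow> real"
  assumes q: "q \<ge> 2" and y: "(\<Sum>j\<in>J. (y j)\<^sup>2) \<le> 1"
  shows "(\<Sum>j\<in>J. (a j * y j)\<^sup>2) powr (q / 2) \<le> (\<Sum>j\<in>J. (y j)\<^sup>2 * \<bar>a j\<bar> powr q)"
proof (cases "q = 2")
  case True
  then show ?thesis by (simp add: sum_nonneg power_mult_distrib mult.commute)
next
  case False
  define k where "k = q / 2"
  have k: "k > 1" using q False by (simp add: k_def)
  define S where "S = (\<Sum>j\<in>J. (a j * y j)\<^sup>2)"
  have S: "S \<ge> 0" by (simp add: S_def sum_nonneg)
  define \<theta> where "\<theta> = (\<Sum>j\<in>J. (y j)\<^sup>2)"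
  have "S powr k \<le> S powr k * (\<theta> + k * (1 - \<theta>))"
  proof -
    have "0 \<le> (k - 1) * (1 - \<theta>)" using k y by (simp add: \<theta>_def)
    then have "1 \<le> \<theta> + k * (1 - \<theta>)" by (simp add: algebra_simps)
    then have "S powr k * 1 \<le> S powr k * (\<theta> + k * (1 - \<theta>))" by (intro mult_left_mono) auto
    then show ?thesis by simp
  qed
  also have "\<dots> = \<theta> * S powr k + k * S powr (k - 1) * (S - S * \<theta>)"
    using S powr_mult_base[of S "k - 1"] by (cases "S = 0") (simp_all add: algebra_simps)
  also have "\<dots> = (\<Sum>j\<in>J. (y j)\<^sup>2 * (S powr k + k * S powr (k - 1) * ((a j)\<^sup>2 - S)))"
    unfolding \<theta>_def by (subst (2) S_def) (simp add: sum.distrib sum_distrib_left sum_distrib_right right_diff_distrib sum_subtractf algebra_simps power_mult_distrib)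
  also have "\<dots> \<le> (\<Sum>j\<in>J. (y j)\<^sup>2 * ((a j)\<^sup>2) powr k)"
    using S k by (intro sum_mono mult_left_mono powr_tangent) auto
  also have "\<dots> = (\<Sum>j\<in>J. (y j)\<^sup>2 * \<bar>a j\<bar> powr q)"
  proof -
    have "((a j)\<^sup>2) powr k = \<bar>a j\<bar> powr q" for j using powr_powr[of "\<bar>a j\<bar>" 2 k] by (simp add: k_def)
    then show ?thesis by simp
  qed
  finally show ?thesis by (simp add: S_def k_def)
qed

section \<open>The operator norm as a countable supremum\<close>

lemma continuous_ell_norm_image:
  fixes A :: "nat \<Rightarrow> nat \<Rightarrow> real"
  assumes "q > 0"
  shows "continuous_on UNIV (\<lambda>y :: nat \<Rightarrow> real. ell_norm q m (\<lambda>i. \<Sum>j<n. A i j * y j))"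
proof -
  have c: "continuous_on UNIV (\<lambda>y :: nat \<Rightarrow> real. \<bar>\<Sum>j<n. A i j * y j\<bar>)" for i
    by (intro continuous_intros continuous_on_product_coordinates)
  have "continuous_on UNIV (\<lambda>y :: nat \<Rightarrow> real. \<Sum>i<m. \<bar>\<Sum>j<n. A i j * y j\<bar> powr q)"
    using assms by (intro continuous_on_sum continuous_on_powr' c continuous_on_const) auto
  then show ?thesis
    unfolding ell_norm_def using assms
    by (intro continuous_on_powr' continuous_on_const) (auto simp: sum_nonneg)
qed

text \<open>A crude entrywise bound whose purpose is finiteness: it makes the suprema bounded and
  the norm integrable.\<close>

lemma ell_norm_image_le:
  assumes s: "s > 0" and q: "q > 0" and y: "ell_norm s n y \<le> 1"
  shows "ell_norm q m (\<lambda>i. \<Sum>j<n. A i j * y j) \<le> (real m * (\<Sum>i<m. \<Sum>j<n. \<bar>A i j\<bar>) powr q) powr (1 / q)"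
proof -
  have "\<bar>\<Sum>j<n. A i j * y j\<bar> \<le> (\<Sum>i<m. \<Sum>j<n. \<bar>A i j\<bar>)" if "i < m" for i
  proof -
    have "\<bar>\<Sum>j<n. A i j * y j\<bar> \<le> (\<Sum>j<n. \<bar>A i j * y j\<bar>)" by (rule sum_abs)
    also have "\<dots> \<le> (\<Sum>j<n. \<bar>A i j\<bar>)"
      using abs_le_one_of_ell_norm(1)[OF s y] by (intro sum_mono) (auto simp: abs_mult mult_left_le)
    also have "\<dots> \<le> (\<Sum>i<m. \<Sum>j<n. \<bar>A i j\<bar>)"
      using that by (intro member_le_sum[of i "{..<m}" "\<lambda>i. \<Sum>j<n. \<bar>A i j\<bar>"]) (auto intro: sum_nonneg)
    finally show ?thesis .
  qed
  then have "(\<Sum>i<m. \<bar>\<Sum>j<n. A i j * y j\<bar> powr q) \<le> (\<Sum>i<m. (\<Sum>i<m. \<Sum>j<n. \<bar>A i j\<bar>) powr q)"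
    using q by (intro sum_mono powr_mono2) auto
  then show ?thesis
    unfolding ell_norm_def using q by (intro powr_mono2) (auto simp: sum_nonneg)
qed

text \<open>In the product topology the ball has a countable dense subset, and the image norm is
  continuous. The same sequence serves every matrix, so the norm of a random matrix is measurable
  and a limit of finite maxima. Coordinates from \<open>n\<close> on are unrestricted, so
  boundedness comes from \<open>ell_norm_image_le\<close> and not from compactness.\<close>

lemma mat_op_norm_countable:
  assumes s: "s > 0" and q: "q > 0"
  shows "\<exists>e :: nat \<Rightarrow> nat \<Rightarrow> real. (\<forall>k. ell_norm s n (e k) \<le> 1) \<and>
    (\<forall>A. mat_op_norm s q m n A = (SUP k. ell_norm q m (\<lambda>i. \<Sum>j<n. A i j * e k j))) \<and>
    (\<forall>A. bdd_above (range (\<lambda>k. ell_norm q m (\<lambda>i. \<Sum>j<n. A i j * e k j))))"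
proof -
  define B where "B = {y :: nat \<Rightarrow> real. ell_norm s n y \<le> 1}"
  obtain T where T: "countable T" "T \<subseteq> B" "B \<subseteq> closure T" using separable by blast
  have "(\<lambda>_. 0) \<in> B" by (simp add: B_def ell_norm_def)
  then have "T \<noteq> {}" using T by auto
  define e where "e = from_nat_into T"
  have re: "range e = T" unfolding e_def using T \<open>T \<noteq> {}\<close> by (intro range_from_nat_into)
  show ?thesis
  proof (intro exI[of _ e] conjI allI)
    show eB: "ell_norm s n (e k) \<le> 1" for k
      using re T(2) by (auto simp: B_def)
    show bdd: "bdd_above (range (\<lambda>k. ell_norm q m (\<lambda>i. \<Sum>j<n. A i j * e k j)))" for A
      using ell_norm_image_le[OF s q eB] by (intro bdd_aboveI2)
    fix A
    define \<Phi> where "\<Phi> y = ell_norm q m (\<lambda>i. \<Sum>j<n. A i j * y j)" for y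
    define c where "c = (SUP k. \<Phi> (e k))"
    have bddB: "bdd_above (\<Phi> ` B)"
      using ell_norm_image_le[OF s q] unfolding B_def \<Phi>_def by (intro bdd_aboveI2) auto
    have cl: "closed {y. \<Phi> y \<le> c}"
      unfolding \<Phi>_def[abs_def]
      by (intro closed_Collect_le continuous_ell_norm_image q continuous_on_const)
    have "\<Phi> y \<le> c" if "y \<in> T" for y
      using that bdd[of A] re unfolding c_def \<Phi>_def by (auto intro: cSUP_upper)
    then have "closure T \<subseteq> {y. \<Phi> y \<le> c}" using cl by (intro closure_minimal) auto
    then have "(SUP y\<in>B. \<Phi> y) \<le> c" using T \<open>(\<lambda>_. 0) \<in> B\<close> by (intro cSUP_least) auto
    moreover have "c \<le> (SUP y\<in>B. \<Phi> y)"
      unfolding c_def using eB bddB by (intro cSUP_least cSUP_upper) (auto simp: B_def)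
    ultimately show "mat_op_norm s q m n A = (SUP k. ell_norm q m (\<lambda>i. \<Sum>j<n. A i j * e k j))"
      by (simp add: mat_op_norm_def B_def \<Phi>_def c_def)
  qed
qed

section \<open>Moments of maxima over finite subsets of the ball\<close>

context gaussian_matrix
begin

text \<open>Symmetrization takes place on a product space; this transfers expectations over
  \<open>M\<close> to it.\<close>

lemma distr_entries:
  defines "P \<equiv> PiM idx (\<lambda>_. std_normal_distribution)"
  shows "distr M P (\<lambda>\<omega>. \<lambda>k\<in>idx. g (fst k) (snd k) \<omega>) = P"
    and "(\<lambda>\<omega>. \<lambda>k\<in>idx. g (fst k) (snd k) \<omega>) \<in> measurable M P"
proof -
  have sP: "sets P = sets (PiM idx (\<lambda>_. borel))"
    unfolding P_def by (rule sets_PiM_cong) auto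
  have rv: "random_variable borel (case k of (i, j) \<Rightarrow> g i j)" if "k \<in> idx" for k
    using that g_meas by auto
  have "distr M P (\<lambda>\<omega>. \<lambda>k\<in>idx. g (fst k) (snd k) \<omega>) = distr M (PiM idx (\<lambda>_. borel)) (\<lambda>\<omega>. \<lambda>k\<in>idx. (case k of (i, j) \<Rightarrow> g i j) \<omega>)"
    by (rule distr_cong[OF refl sP]) (simp add: case_prod_beta')
  also have "\<dots> = PiM idx (\<lambda>k. distr M borel (case k of (i, j) \<Rightarrow> g i j))"
    using indep indep_vars_iff_distr_eq_PiM'[OF idx_ne rv, of "\<lambda>x. x"] by simp
  also have "\<dots> = P"
    unfolding P_def
  proof (rule PiM_cong[OF refl])
    fix k assume "k \<in> idx"
    then obtain i j where k: "k = (i, j)" "i < m" "j < n" by auto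
    have "distr M borel (g i j) = distr M lborel (g i j)" by (rule distr_cong) auto
    then show "distr M borel (case k of (i, j) \<Rightarrow> g i j) = std_normal_distribution"
      using distributed_distr_eq_density[OF dist[OF k(2,3)]] k by simp
  qed
  finally show "distr M P (\<lambda>\<omega>. \<lambda>k\<in>idx. g (fst k) (snd k) \<omega>) = P" .
  show "(\<lambda>\<omega>. \<lambda>k\<in>idx. g (fst k) (snd k) \<omega>) \<in> measurable M P"
    unfolding P_def by (rule measurable_restrict) (use g_meas in auto)
qed

text \<open>With \<open>F\<close> the maximum and \<open>E\<close> the column term, symmetrization
  bounds \<open>2/3 * (\<integral>x. F x \<partial>P) - 4/3 * E\<close> by
  \<open>2 * (U * R)\<close>, where \<open>U\<close> stems from fixed rows and \<open>R\<close> from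
  the moment of the largest row norm. The result is uniform in \<open>Y\<close>.\<close>

lemma max_finite_moment_le:
  fixes a :: "nat \<Rightarrow> nat \<Rightarrow> real" and p q ps :: real
  defines "T \<equiv> \<integral>\<omega>. (MAX (i, j)\<in>idx. \<bar>a i j * g i j \<omega>\<bar>) \<partial>M"
    and "\<rho> \<equiv> MAX i\<in>{..<m}. ell_norm p n (a i)"
    and "\<sigma> \<equiv> MAX j\<in>{..<n}. ell_norm q m (\<lambda>i. a i j)"
  assumes p: "p \<ge> 2" and ps: "0 < ps" "ps \<le> 2" and pps: "1 / p + 1 / ps = 1" and q: "q \<ge> 2" and m: "m \<ge> 2"
    and Y: "finite Y" "Y \<noteq> {}" "\<And>y. y \<in> Y \<Longrightarrow> ell_norm ps n y \<le> 1"
  shows "(\<integral>\<omega>. (MAX y\<in>Y. \<Sum>i<m. \<bar>\<Sum>j<n. a i j * g i j \<omega> * y j\<bar> powr q) \<partial>M) \<le>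
    2 * (gauss_norm q * \<sigma>) powr q +
    270000000 * 7680 powr q * p * ln (real m) * ((gauss_norm p * \<rho>) powr q + (gauss_norm q * T) powr q)"
    (is "?L \<le> _")
proof -
  define P where "P = PiM idx (\<lambda>_. std_normal_distribution)"
  interpret P: prob_space P unfolding P_def by (rule prob_space_PiM) (rule prob_space_std_normal)
  define G where "G \<omega> = (\<lambda>k\<in>idx. g (fst k) (snd k) \<omega>)" for \<omega>
  note G = distr_entries[folded P_def G_def[abs_def]]
  define f where "f i y x = \<bar>\<Sum>j<n. a i j * x (i, j) * y j\<bar> powr q" for i and y :: "nat \<Rightarrow> real" and x :: "nat \<times> nat \<Rightarrow> real"
  have x_meas: "(\<lambda>x. x (i, j)) \<in> borel_measurable P" if "i < m" "j < n" for i j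
    using measurable_component_singleton[of "(i, j)" idx "\<lambda>_. std_normal_distribution"] that by (simp add: P_def)
  have f_meas: "f i y \<in> borel_measurable P" if "i < m" for i y
  proof -
    have [measurable]: "(\<lambda>x. x (i, j)) \<in> borel_measurable P" if "j \<in> {..<n}" for j
      using that x_meas \<open>i < m\<close> by auto
    show ?thesis unfolding f_def by measurable
  qed
  have fG: "f i y (G \<omega>) = \<bar>\<Sum>j<n. (a i j * y j) * g i j \<omega>\<bar> powr q" if "i < m" for i y \<omega>
    using that by (simp add: f_def G_def mult_ac)
  have f_intM: "integrable M (\<lambda>\<omega>. f i y (G \<omega>))" if "i < m" for i y
    using linear_form_moment(2)[OF that, of q "\<lambda>j. a i j * y j"] q that by (simp add: fG)
  have f_int: "integrable P (f i y)" if "i < m" for i y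
    using integrable_distr_eq[OF G(2) f_meas[OF that]] f_intM[OF that] G(1) by simp
  have f_E: "(\<integral>x. f i y x \<partial>P) = gauss_norm q powr q * (\<Sum>j<n. (a i j * y j)\<^sup>2) powr (q / 2)" if "i < m" for i y
    using integral_distr[OF G(2) f_meas[OF that]] linear_form_moment(1)[OF that, of q "\<lambda>j. a i j * y j"] q that G(1)
    by (simp add: fG)
  have \<sigma>0: "\<sigma> \<ge> 0"
  proof -
    have "ell_norm q m (\<lambda>i. a i 0) \<le> \<sigma>" unfolding \<sigma>_def using mn by (intro Max_ge) auto
    then show ?thesis using ell_norm_nonneg order_trans by blast
  qed
  \<comment> \<open>Since \<open>ps \<le> 2\<close>, the squares \<open>(y j)\<^sup>2\<close> sum to
    at most 1. Convexity then moves them out of the power, and interchanging the sums leaves a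
    weighted sum of column norms.\<close>
  have E_le: "(\<Sum>i<m. (\<integral>x. f i y x \<partial>P)) \<le> (gauss_norm q * \<sigma>) powr q" if y: "y \<in> Y" for y
  proof -
    have y2: "(\<Sum>j<n. (y j)\<^sup>2) \<le> 1" using ps Y(3)[OF y] by (rule sum_squares_le_one_of_ell_norm)
    have col: "(\<Sum>i<m. \<bar>a i j\<bar> powr q) \<le> \<sigma> powr q" if "j < n" for j
    proof -
      have "ell_norm q m (\<lambda>i. a i j) \<le> \<sigma>" unfolding \<sigma>_def using that by (intro Max_ge) auto
      then have "ell_norm q m (\<lambda>i. a i j) powr q \<le> \<sigma> powr q"
        using q ell_norm_nonneg by (intro powr_mono2) auto
      then show ?thesis using q by (simp add: ell_norm_powr)
    qed
    have "(\<Sum>i<m. (\<integral>x. f i y x \<partial>P)) = gauss_norm q powr q * (\<Sum>i<m. (\<Sum>j<n. (a i j * y j)\<^sup>2) powr (q / 2))"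
      by (simp add: f_E sum_distrib_left)
    also have "\<dots> \<le> gauss_norm q powr q * (\<Sum>i<m. \<Sum>j<n. (y j)\<^sup>2 * \<bar>a i j\<bar> powr q)"
      using y2 q by (intro mult_left_mono sum_mono powr_sum_weighted_squares_le) auto
    also have "(\<Sum>i<m. \<Sum>j<n. (y j)\<^sup>2 * \<bar>a i j\<bar> powr q) = (\<Sum>j<n. (y j)\<^sup>2 * (\<Sum>i<m. \<bar>a i j\<bar> powr q))"
      unfolding sum_distrib_left by (rule sum.swap)
    also have "\<dots> \<le> (\<Sum>j<n. (y j)\<^sup>2 * \<sigma> powr q)"
      using col by (intro sum_mono mult_left_mono) auto
    also have "\<dots> = (\<Sum>j<n. (y j)\<^sup>2) * \<sigma> powr q" by (simp add: sum_distrib_right)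
    also have "\<dots> \<le> 1 * \<sigma> powr q" using y2 by (intro mult_right_mono) auto
    finally have "(\<Sum>i<m. (\<integral>x. f i y x \<partial>P)) \<le> gauss_norm q powr q * (1 * \<sigma> powr q)"
      by (simp add: mult_left_mono)
    then show ?thesis using q gauss_norm_pos[of q] \<sigma>0 by (simp add: powr_mult)
  qed
  define r where "r x = (MAX i\<in>{..<m}. ell_norm p n (\<lambda>j. a i j * x (i, j)) powr q)" for x :: "nat \<times> nat \<Rightarrow> real"
  define R where "R = 300 * 30 powr q * ((gauss_norm p * \<rho>) powr q + (gauss_norm q * T) powr q)"
  have R0: "R \<ge> 0" by (simp add: R_def)
  have r0: "r x \<ge> 0" for x
  proof -
    have "ell_norm p n (\<lambda>j. a 0 j * x (0, j)) powr q \<le> r x" unfolding r_def using mn by (intro Max_ge) auto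
    then show ?thesis using powr_ge_zero order_trans by blast
  qed
  have r_meas: "r \<in> borel_measurable P"
  proof -
    have [measurable]: "(\<lambda>x. x (i, j)) \<in> borel_measurable P" if "i \<in> {..<m}" "j \<in> {..<n}" for i j
      using that x_meas by auto
    show ?thesis unfolding r_def[abs_def] ell_norm_def by (intro borel_measurable_Max) measurable
  qed
  have "(\<integral>\<^sup>+x. ennreal (r x) \<partial>P) = (\<integral>\<^sup>+\<omega>. ennreal (r (G \<omega>)) \<partial>M)"
    by (subst G(1)[symmetric], rule nn_integral_distr[OF G(2)]) (use r_meas in measurable)
  also have "\<dots> = (\<integral>\<^sup>+\<omega>. ennreal (MAX i\<in>{..<m}. ell_norm p n (\<lambda>j. a i j * g i j \<omega>) powr q) \<partial>M)"
  proof (rule nn_integral_cong)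
    fix \<omega>
    have "ell_norm p n (\<lambda>j. a i j * G \<omega> (i, j)) = ell_norm p n (\<lambda>j. a i j * g i j \<omega>)" if "i < m" for i
      using that by (simp add: ell_norm_def G_def)
    then show "ennreal (r (G \<omega>)) = ennreal (MAX i\<in>{..<m}. ell_norm p n (\<lambda>j. a i j * g i j \<omega>) powr q)"
      by (simp add: r_def)
  qed
  also have "\<dots> \<le> ennreal R"
    unfolding R_def T_def \<rho>_def by (rule max_row_norm_moment[OF p q])
  finally have r_nn: "(\<integral>\<^sup>+x. ennreal (r x) \<partial>P) \<le> ennreal R" .
  then have r_int: "integrable P r"
    using r_meas r0 by (intro integrableI_nonneg) (auto simp: less_top[symmetric] top_unique)
  have r_le: "(\<integral>x. r x \<partial>P) \<le> R"
    using r_nn r0 R0 nn_integral_eq_integral[OF r_int] by simp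
  define U where "U = 300000 * 256 powr q * p * ln (real m)"
  have U0: "U \<ge> 0" using p m by (simp add: U_def)
  have sym: "2 ^ m * (\<integral>x. (MAX y\<in>Y. \<Sum>i<m. (1 - 1/3) * f i y x - (1 + 1/3) * (\<integral>x'. f i y x' \<partial>P)) \<partial>P)
    \<le> 2 * (\<integral>x. (\<Sum>S\<in>Pow {..<m}. MAX y\<in>Y. \<Sum>i<m. (rsign S i - 1/3) * f i y x) \<partial>P)"
  proof -
    have "2 ^ card {..<m} * (\<integral>x. (MAX y\<in>Y. \<Sum>i<m. (1 - 1/3) * f i y x - (1 + 1/3) * (\<integral>x'. f i y x' \<partial>P)) \<partial>P)
      \<le> 2 * (\<integral>x. (\<Sum>S\<in>Pow {..<m}. MAX y\<in>Y. \<Sum>i<m. (rsign S i - 1/3) * f i y x) \<partial>P)"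
      unfolding P_def
    proof (rule offset_symmetrization)
      show "integrable (PiM idx (\<lambda>_. std_normal_distribution)) (f i y)" if "i \<in> {..<m}" for i y
        using f_int[of i y] that by (simp add: P_def)
      show "f i y x = f i y x'" if "i \<in> {..<m}" "\<And>j. (i, j) \<in> idx \<Longrightarrow> x (i, j) = x' (i, j)" for i y x x'
        using that by (simp add: f_def)
    qed (use Y prob_space_std_normal in auto)
    then show ?thesis by simp
  qed
  have "(\<integral>x. (\<Sum>S\<in>Pow {..<m}. MAX y\<in>Y. \<Sum>i<m. (rsign S i - 1/3) * f i y x) \<partial>P) \<le> (\<integral>x. 2 ^ m * (U * r x) \<partial>P)"
  proof (rule integral_mono)
    show "integrable P (\<lambda>x. \<Sum>S\<in>Pow {..<m}. MAX y\<in>Y. \<Sum>i<m. (rsign S i - 1/3) * f i y x)"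
      using Y f_int by (intro Bochner_Integration.integrable_sum integrable_MAX integrable_mult_right) auto
    show "integrable P (\<lambda>x. 2 ^ m * (U * r x))" using r_int by simp
    fix x
    have "(\<Sum>S\<in>Pow {..<m}. MAX y\<in>Y. \<Sum>i<m. (rsign S i - 1 / 3) * \<bar>\<Sum>j<n. (a i j * x (i, j)) * y j\<bar> powr q) \<le>
      2 ^ m * (300000 * 256 powr q * p * ln (real m) * r x)"
      using mn(2) Y by (intro rademacher_rows[OF p pps _ m q]) (auto simp: r_def)
    then show "(\<Sum>S\<in>Pow {..<m}. MAX y\<in>Y. \<Sum>i<m. (rsign S i - 1/3) * f i y x) \<le> 2 ^ m * (U * r x)"
      by (simp add: f_def U_def)
  qed
  also have "\<dots> = 2 ^ m * (U * (\<integral>x. r x \<partial>P))" by simp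
  also have "\<dots> \<le> 2 ^ m * (U * R)" using r_le U0 by (intro mult_left_mono) auto
  finally have "2 ^ m * (\<integral>x. (MAX y\<in>Y. \<Sum>i<m. (1 - 1/3) * f i y x - (1 + 1/3) * (\<integral>x'. f i y x' \<partial>P)) \<partial>P)
      \<le> 2 ^ m * (2 * (U * R))" using sym by linarith
  then have key: "(\<integral>x. (MAX y\<in>Y. \<Sum>i<m. (1 - 1/3) * f i y x - (1 + 1/3) * (\<integral>x'. f i y x' \<partial>P)) \<partial>P) \<le> 2 * (U * R)"
    by simp
  define F where "F x = (MAX y\<in>Y. \<Sum>i<m. f i y x)" for x
  have F_int: "integrable P F"
    unfolding F_def using Y f_int by (intro integrable_MAX Bochner_Integration.integrable_sum) auto
  define E where "E = (gauss_norm q * \<sigma>) powr q"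
  have "2/3 * (\<integral>x. F x \<partial>P) - 4/3 * E = (\<integral>x. 2/3 * F x - 4/3 * E \<partial>P)"
    using F_int by (simp add: Bochner_Integration.integral_diff P.prob_space)
  also have "\<dots> \<le> (\<integral>x. (MAX y\<in>Y. \<Sum>i<m. (1 - 1/3) * f i y x - (1 + 1/3) * (\<integral>x'. f i y x' \<partial>P)) \<partial>P)"
  proof (rule integral_mono)
    show "integrable P (\<lambda>x. 2/3 * F x - 4/3 * E)" using F_int by simp
    show "integrable P (\<lambda>x. MAX y\<in>Y. \<Sum>i<m. (1 - 1/3) * f i y x - (1 + 1/3) * (\<integral>x'. f i y x' \<partial>P))"
      using Y f_int by (intro integrable_MAX Bochner_Integration.integrable_sum Bochner_Integration.integrable_diff integrable_mult_right) auto
    fix x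
    have "F x \<in> (\<lambda>y. \<Sum>i<m. f i y x) ` Y" unfolding F_def using Y by (intro Max_in) auto
    then obtain y where y: "y \<in> Y" "F x = (\<Sum>i<m. f i y x)" by blast
    have "2/3 * F x - 4/3 * E \<le> 2/3 * (\<Sum>i<m. f i y x) - 4/3 * (\<Sum>i<m. (\<integral>x'. f i y x' \<partial>P))"
      using E_le[OF y(1)] y by (simp add: E_def)
    also have "\<dots> = (\<Sum>i<m. (1 - 1/3) * f i y x - (1 + 1/3) * (\<integral>x'. f i y x' \<partial>P))"
      by (simp add: sum_subtractf sum_distrib_left sum_divide_distrib)
    also have "\<dots> \<le> (MAX y\<in>Y. \<Sum>i<m. (1 - 1/3) * f i y x - (1 + 1/3) * (\<integral>x'. f i y x' \<partial>P))"
      using Y y by (intro Max_ge) auto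
    finally show "2/3 * F x - 4/3 * E \<le> (MAX y\<in>Y. \<Sum>i<m. (1 - 1/3) * f i y x - (1 + 1/3) * (\<integral>x'. f i y x' \<partial>P))" .
  qed
  also note key
  finally have FP: "(\<integral>x. F x \<partial>P) \<le> 2 * E + 3 * (U * R)" by simp
  have "?L = (\<integral>\<omega>. F (G \<omega>) \<partial>M)"
    unfolding F_def by (simp add: fG mult_ac)
  also have "\<dots> = (\<integral>x. F x \<partial>P)"
    using integral_distr[OF G(2) borel_measurable_integrable[OF F_int]] G(1) by simp
  also note FP
  \<comment> \<open>\<open>270000000 = 3 * 300000 * 300\<close>, with the last two factors from
    \<open>U\<close> and \<open>R\<close>; likewise \<open>7680 = 256 * 30\<close> below.\<close>
  also have "3 * (U * R) = 270000000 * (256 powr q * 30 powr q) * p * ln (real m) * ((gauss_norm p * \<rho>) powr q + (gauss_norm q * T) powr q)"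
    by (simp add: U_def R_def)
  also have "(256::real) powr q * 30 powr q = 7680 powr q" by (simp flip: powr_mult)
  finally show ?thesis by (simp add: E_def)
qed

end

section \<open>From finite sets to the whole ball\<close>

context gaussian_matrix
begin

lemma mat_op_norm_meas_integrable:
  fixes a :: "nat \<Rightarrow> nat \<Rightarrow> real"
  assumes s: "s > 0" and q: "q \<ge> 1"
  defines "Nrm \<equiv> \<lambda>\<omega>. mat_op_norm s q m n (\<lambda>i j. a i j * g i j \<omega>)"
  shows "Nrm \<in> borel_measurable M" and "\<And>\<omega>. Nrm \<omega> \<ge> 0" and "integrable M (\<lambda>\<omega>. Nrm \<omega> powr q)" and "integrable M Nrm"
proof -
  have q0: "q > 0" using q by simp
  obtain e :: "nat \<Rightarrow> nat \<Rightarrow> real" where e': "\<forall>k. ell_norm s n (e k) \<le> 1"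
    "\<forall>A. mat_op_norm s q m n A = (SUP k. ell_norm q m (\<lambda>i. \<Sum>j<n. A i j * e k j))"
    "\<forall>A. bdd_above (range (\<lambda>k. ell_norm q m (\<lambda>i. \<Sum>j<n. A i j * e k j)))"
    using mat_op_norm_countable[OF s q0, where m = m and n = n] by (elim exE conjE)
  note e = e'[rule_format]
  have [measurable]: "g i j \<in> borel_measurable M" if "i \<in> {..<m}" "j \<in> {..<n}" for i j
    using that g_meas by auto
  show meas: "Nrm \<in> borel_measurable M"
    unfolding Nrm_def e(2)
  proof (rule borel_measurable_cSUP)
    fix k
    show "(\<lambda>\<omega>. ell_norm q m (\<lambda>i. \<Sum>j<n. a i j * g i j \<omega> * e k j)) \<in> borel_measurable M"
      unfolding ell_norm_def by measurable
  qed (use e(3) in auto)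
  show nonneg: "Nrm \<omega> \<ge> 0" for \<omega>
    unfolding Nrm_def e(2) using e(3) ell_norm_nonneg
    by (meson UNIV_I cSUP_upper order_trans)
  define W where "W \<omega> = (\<Sum>i<m. \<Sum>j<n. \<bar>a i j * g i j \<omega>\<bar>)" for \<omega>
  define c where "c = real (card idx) powr q * real m"
  have bound: "Nrm \<omega> powr q \<le> c * (\<Sum>k\<in>idx. \<bar>a (fst k) (snd k)\<bar> powr q * \<bar>g (fst k) (snd k) \<omega>\<bar> powr q)" for \<omega>
  proof -
    have "Nrm \<omega> \<le> (real m * W \<omega> powr q) powr (1 / q)"
      unfolding Nrm_def e(2) W_def using ell_norm_image_le[OF s q0 e(1)] by (intro cSUP_least) auto
    then have "Nrm \<omega> powr q \<le> ((real m * W \<omega> powr q) powr (1 / q)) powr q"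
      using nonneg q by (intro powr_mono2) auto
    also have "\<dots> = real m * W \<omega> powr q" using q by (simp add: powr_powr)
    also have "\<dots> \<le> real m * ((real (card idx)) powr q * (\<Sum>k\<in>idx. \<bar>a (fst k) (snd k) * g (fst k) (snd k) \<omega>\<bar> powr q))"
    proof (rule mult_left_mono)
      define v where "v k = \<bar>a (fst k) (snd k) * g (fst k) (snd k) \<omega>\<bar>" for k
      define t where "t = Max (v ` idx)"
      have "t \<in> v ` idx" unfolding t_def using idx_ne by (intro Max_in) auto
      then obtain k where k: "k \<in> idx" "t = v k" by blast
      have "W \<omega> = (\<Sum>k\<in>idx. v k)" by (simp add: W_def v_def sum.cartesian_product case_prod_beta')
      also have "\<dots> \<le> real (card idx) * t"
        by (rule sum_bounded_above) (auto simp: t_def)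
      finally have "W \<omega> powr q \<le> (real (card idx) * t) powr q"
        using q by (intro powr_mono2) (auto simp: W_def sum_nonneg)
      also have "\<dots> = real (card idx) powr q * v k powr q" by (simp add: k(2) powr_mult)
      also have "\<dots> \<le> real (card idx) powr q * (\<Sum>k\<in>idx. v k powr q)"
        using k by (intro mult_left_mono member_le_sum) auto
      finally show "W \<omega> powr q \<le> (real (card idx)) powr q * (\<Sum>k\<in>idx. \<bar>a (fst k) (snd k) * g (fst k) (snd k) \<omega>\<bar> powr q)"
        by (simp add: v_def)
    qed simp
    finally show ?thesis
      by (simp add: c_def abs_mult powr_mult mult_ac)
  qed
  show int: "integrable M (\<lambda>\<omega>. Nrm \<omega> powr q)"
  proof (rule Bochner_Integration.integrable_bound)
    show "integrable M (\<lambda>\<omega>. c * (\<Sum>k\<in>idx. \<bar>a (fst k) (snd k)\<bar> powr q * \<bar>g (fst k) (snd k) \<omega>\<bar> powr q))"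
      using q by (intro integrable_mult_right Bochner_Integration.integrable_sum integrable_entry_powr) auto
    show "(\<lambda>\<omega>. Nrm \<omega> powr q) \<in> borel_measurable M" using meas by measurable
    show "AE \<omega> in M. norm (Nrm \<omega> powr q) \<le> norm (c * (\<Sum>k\<in>idx. \<bar>a (fst k) (snd k)\<bar> powr q * \<bar>g (fst k) (snd k) \<omega>\<bar> powr q))"
      using bound by (intro AE_I2) (auto intro: order_trans[OF _ abs_ge_self])
  qed
  show "integrable M Nrm"
  proof (rule Bochner_Integration.integrable_bound)
    show "integrable M (\<lambda>\<omega>. 1 + Nrm \<omega> powr q)" using int by simp
    show "AE \<omega> in M. norm (Nrm \<omega>) \<le> norm (1 + Nrm \<omega> powr q)"
    proof (rule AE_I2)
      fix \<omega>
      have "Nrm \<omega> \<le> 1 + Nrm \<omega> powr q"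
      proof (cases "Nrm \<omega> \<le> 1")
        case False
        then have "Nrm \<omega> powr 1 \<le> Nrm \<omega> powr q" using q by (intro powr_mono) auto
        then show ?thesis using False by simp
      qed (simp add: add_increasing2)
      then show "norm (Nrm \<omega>) \<le> norm (1 + Nrm \<omega> powr q)" using nonneg[of \<omega>] by simp
    qed
  qed (rule meas)
qed

text \<open>The bound for finite sets is uniform, so monotone convergence along initial segments of
  the dense sequence carries it to the supremum. The limit is taken in \<open>ennreal\<close>, where
  it exists without knowing that the maxima stay bounded.\<close>

lemma mat_op_norm_moment_le:
  fixes a :: "nat \<Rightarrow> nat \<Rightarrow> real" and p q ps :: real
  defines "T \<equiv> \<integral>\<omega>. (MAX (i, j)\<in>idx. \<bar>a i j * g i j \<omega>\<bar>) \<partial>M"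
    and "\<rho> \<equiv> MAX i\<in>{..<m}. ell_norm p n (a i)"
    and "\<sigma> \<equiv> MAX j\<in>{..<n}. ell_norm q m (\<lambda>i. a i j)"
  assumes p: "p \<ge> 2" and ps: "0 < ps" "ps \<le> 2" and pps: "1 / p + 1 / ps = 1" and q: "q \<ge> 2" and m: "m \<ge> 2"
  shows "(\<integral>\<omega>. mat_op_norm ps q m n (\<lambda>i j. a i j * g i j \<omega>) powr q \<partial>M) \<le>
    2 * (gauss_norm q * \<sigma>) powr q +
    270000000 * 7680 powr q * p * ln (real m) * ((gauss_norm p * \<rho>) powr q + (gauss_norm q * T) powr q)"
    (is "_ \<le> ?R")
proof -
  define Nrm where "Nrm \<omega> = mat_op_norm ps q m n (\<lambda>i j. a i j * g i j \<omega>)" for \<omega>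
  have q0: "q > 0" "q \<ge> 1" using q by auto
  note Nm = mat_op_norm_meas_integrable[OF ps(1) q0(2), of a, folded Nrm_def]
  obtain e :: "nat \<Rightarrow> nat \<Rightarrow> real" where e': "\<forall>k. ell_norm ps n (e k) \<le> 1"
    "\<forall>A. mat_op_norm ps q m n A = (SUP k. ell_norm q m (\<lambda>i. \<Sum>j<n. A i j * e k j))"
    "\<forall>A. bdd_above (range (\<lambda>k. ell_norm q m (\<lambda>i. \<Sum>j<n. A i j * e k j)))"
    using mat_op_norm_countable[OF ps(1) q0(1), where m = m and n = n] by (elim exE conjE)
  note e = e'[rule_format]
  define F where "F y \<omega> = (\<Sum>i<m. \<bar>\<Sum>j<n. a i j * g i j \<omega> * y j\<bar> powr q)" for y :: "nat \<Rightarrow> real" and \<omega>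
  define X where "X k \<omega> = (MAX y\<in>e ` {..k}. F y \<omega>)" for k \<omega>
  have F0: "F y \<omega> \<ge> 0" for y \<omega> by (simp add: F_def sum_nonneg)
  have F_int: "integrable M (F y)" for y
    unfolding F_def
  proof (intro Bochner_Integration.integrable_sum)
    fix i assume "i \<in> {..<m}"
    then show "integrable M (\<lambda>\<omega>. \<bar>\<Sum>j<n. a i j * g i j \<omega> * y j\<bar> powr q)"
      using linear_form_moment(2)[of i q "\<lambda>j. a i j * y j"] q by (simp add: mult_ac)
  qed
  have X_int: "integrable M (X k)" for k
    unfolding X_def using F_int by (intro integrable_MAX) auto
  have X_ge: "F (e j) \<omega> \<le> X k \<omega>" if "j \<le> k" for j k \<omega>
    unfolding X_def using that by (intro Max_ge) auto
  have X0: "X k \<omega> \<ge> 0" for k \<omega> using X_ge[of k k \<omega>] F0 order_trans by blast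
  have R0: "?R \<ge> 0" using p m by (intro add_nonneg_nonneg mult_nonneg_nonneg) auto
  have X_le: "(\<integral>\<omega>. X k \<omega> \<partial>M) \<le> ?R" for k
    unfolding X_def F_def T_def \<rho>_def \<sigma>_def using e(1)
    by (intro max_finite_moment_le[OF p ps pps q m]) auto
  have "ennreal (\<integral>\<omega>. Nrm \<omega> powr q \<partial>M) = (\<integral>\<^sup>+\<omega>. ennreal (Nrm \<omega> powr q) \<partial>M)"
    using Nm(3) by (subst nn_integral_eq_integral) auto
  also have "\<dots> \<le> (\<integral>\<^sup>+\<omega>. (SUP k. ennreal (X k \<omega>)) \<partial>M)"
  proof (rule nn_integral_mono)
    fix \<omega>
    show "ennreal (Nrm \<omega> powr q) \<le> (SUP k. ennreal (X k \<omega>))"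
    proof (cases "(SUP k. ennreal (X k \<omega>)) = top")
      case False
      then obtain u where u: "(SUP k. ennreal (X k \<omega>)) = ennreal u" "u \<ge> 0"
        by (cases "SUP k. ennreal (X k \<omega>)") auto
      have "Nrm \<omega> \<le> u powr (1 / q)"
        unfolding Nrm_def e(2)
      proof (rule cSUP_least)
        fix k
        have "ennreal (X k \<omega>) \<le> ennreal u" unfolding u(1)[symmetric] by (intro SUP_upper) auto
        then have "F (e k) \<omega> \<le> u" using X_ge[of k k \<omega>] u(2) by simp
        then have "F (e k) \<omega> powr (1 / q) \<le> u powr (1 / q)" using F0 q0 by (intro powr_mono2) auto
        then show "ell_norm q m (\<lambda>i. \<Sum>j<n. a i j * g i j \<omega> * e k j) \<le> u powr (1 / q)"
          by (simp add: F_def ell_norm_def)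
      qed simp
      then have "Nrm \<omega> powr q \<le> (u powr (1 / q)) powr q" using Nm(2) q0 by (intro powr_mono2) auto
      also have "\<dots> = u" using u(2) q0 by (simp add: powr_powr)
      finally show ?thesis using u by (simp add: ennreal_leI)
    next
      case True
      show ?thesis unfolding True by simp
    qed
  qed
  also have "\<dots> = (SUP k. \<integral>\<^sup>+\<omega>. ennreal (X k \<omega>) \<partial>M)"
  proof (rule nn_integral_monotone_convergence_SUP)
    have "X k \<omega> \<le> X (Suc k) \<omega>" for k \<omega>
      unfolding X_def by (intro Max_mono) auto
    then show "incseq (\<lambda>k \<omega>. ennreal (X k \<omega>))"
      by (intro incseq_SucI le_funI ennreal_leI)
    show "(\<lambda>\<omega>. ennreal (X k \<omega>)) \<in> borel_measurable M" for k
      using X_int[of k] by measurable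
  qed
  also have "\<dots> \<le> ennreal ?R"
  proof (rule SUP_least)
    fix k
    have "(\<integral>\<^sup>+\<omega>. ennreal (X k \<omega>) \<partial>M) = ennreal (\<integral>\<omega>. X k \<omega> \<partial>M)"
      using X_int X0 by (intro nn_integral_eq_integral) auto
    also have "\<dots> \<le> ennreal ?R" using X_le by (intro ennreal_leI)
    finally show "(\<integral>\<^sup>+\<omega>. ennreal (X k \<omega>) \<partial>M) \<le> ennreal ?R" .
  qed
  finally show ?thesis using R0 by (simp add: Nrm_def)
qed

end

section \<open>Passing to the \<open>q\<close>-th root\<close>

lemma (in prob_space) expectation_le_powr_mean:
  fixes X :: "'a \<Rightarrow> real"
  assumes q: "q > 1" and X: "integrable M X" "integrable M (\<lambda>\<omega>. X \<omega> powr q)" "\<And>\<omega>. X \<omega> \<ge> 0"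
  shows "expectation X \<le> expectation (\<lambda>\<omega>. X \<omega> powr q) powr (1 / q)"
proof -
  define \<mu> where "\<mu> = expectation X"
  have \<mu>: "\<mu> \<ge> 0" unfolding \<mu>_def by (intro integral_nonneg_AE AE_I2 X(3))
  \<comment> \<open>The linear part of the tangent at the mean integrates to 0.\<close>
  have "\<mu> powr q = expectation (\<lambda>\<omega>. \<mu> powr q + q * \<mu> powr (q - 1) * (X \<omega> - \<mu>))"
    using X by (simp add: prob_space \<mu>_def)
  also have "\<dots> \<le> expectation (\<lambda>\<omega>. X \<omega> powr q)"
    using X q \<mu> by (intro integral_mono powr_tangent) auto
  finally have "(\<mu> powr q) powr (1 / q) \<le> expectation (\<lambda>\<omega>. X \<omega> powr q) powr (1 / q)"
    using q by (intro powr_mono2) auto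
  then show ?thesis using q \<mu> by (simp add: powr_powr \<mu>_def)
qed

lemma powr_add_powr_le:
  fixes x y q :: real
  assumes "x \<ge> 0" "y \<ge> 0" "q \<ge> 1"
  shows "x powr q + y powr q \<le> (x + y) powr q"
proof -
  have "((x powr q) + (y powr q)) powr (1 / q) \<le> (x powr q) powr (1 / q) + (y powr q) powr (1 / q)"
    using assms by (intro powr_add_le_add_powr) auto
  also have "\<dots> = x + y" using assms by (simp add: powr_powr)
  finally have "(((x powr q) + (y powr q)) powr (1 / q)) powr q \<le> (x + y) powr q"
    using assms by (intro powr_mono2) auto
  then show ?thesis using assms by (simp add: powr_powr)
qed

text \<open>Factors exponential in \<open>q\<close> become absolute here;
  \<open>2073600000000\<close> is \<open>270000000 * 7680\<close>. Subadditivity of the power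
  \<open>1 / q\<close> splits off the column term with exactly \<open>2 powr (1 / q)\<close>, and
  superadditivity of the power \<open>q\<close> merges the other two terms into
  \<open>u + v\<close>.\<close>

lemma root_of_moment_bound:
  fixes p q s lm u v E :: real
  assumes p: "p \<ge> 1" and q: "q \<ge> 1" and nn: "s \<ge> 0" "lm \<ge> 0" "u \<ge> 0" "v \<ge> 0" "E \<ge> 0"
    and E: "E \<le> 2 * s powr q + 270000000 * 7680 powr q * p * lm * (u powr q + v powr q)"
  shows "E powr (1 / q) \<le> 2073600000000 * p powr (5 / q) * lm powr (1 / q) * (u + v) + 2 powr (1 / q) * s"
proof -
  have root: "(z powr q) powr (1 / q) = z" if "z \<ge> 0" for z using that q by (simp add: powr_powr)
  have "(270000000::real) powr 1 \<le> 270000000 powr q" using q by (intro powr_mono) auto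
  then have "270000000 * 7680 powr q \<le> 270000000 powr q * 7680 powr q" by (intro mult_right_mono) auto
  also have "\<dots> = (270000000 * 7680) powr q" by (rule powr_mult[symmetric])
  finally have C: "270000000 * 7680 powr q \<le> 2073600000000 powr q" by simp
  have "270000000 * 7680 powr q * p * lm * (u powr q + v powr q) \<le> 2073600000000 powr q * p * lm * (u + v) powr q"
    using C p nn q by (intro mult_mono powr_add_powr_le mult_right_mono) auto
  with E have "E powr (1 / q) \<le> (2073600000000 powr q * p * lm * (u + v) powr q + 2 * s powr q) powr (1 / q)"
    using nn q by (intro powr_mono2) auto
  also have "\<dots> \<le> (2073600000000 powr q * p * lm * (u + v) powr q) powr (1 / q) + (2 * s powr q) powr (1 / q)"
    using p nn q by (intro powr_add_le_add_powr) auto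
  also have "(2 * s powr q) powr (1 / q) = 2 powr (1 / q) * s"
    using nn by (simp add: powr_mult root)
  also have "(2073600000000 powr q * p * lm * (u + v) powr q) powr (1 / q) = 2073600000000 * p powr (1 / q) * lm powr (1 / q) * (u + v)"
    using nn by (simp only: powr_mult root[of 2073600000000, simplified] root[of "u + v"] add_nonneg_nonneg)
  \<comment> \<open>The moment is linear in \<open>p\<close>, so its root carries
    \<open>p powr (1 / q)\<close>, which is at most the stated power because
    \<open>p \<ge> 1\<close>.\<close>
  also have "\<dots> \<le> 2073600000000 * p powr (5 / q) * lm powr (1 / q) * (u + v)"
    using p q nn by (intro mult_right_mono mult_left_mono powr_mono divide_right_mono) auto
  finally show ?thesis by simp
qed

text \<open>Integrability belongs to the conclusion because the integral of a non-integrable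
  function is 0 by convention. Positive dimensions keep the index sets of \<open>MAX\<close>
  nonempty. The second inequality asks for \<open>m \<ge> 2\<close>: at \<open>m = 1\<close> the
  factor \<open>ln m\<close> is 0 and would erase the row term, although the norm is then the p-norm
  of a Gaussian row.\<close>

theorem theorem1p1:
  "\<exists>C>0. \<forall>(m::nat) (n::nat) (a :: nat \<Rightarrow> nat \<Rightarrow> real) (ps::real) (p::real) (q::real)
      (M :: 'w measure) (g :: nat \<Rightarrow> nat \<Rightarrow> 'w \<Rightarrow> real).
    1 \<le> m \<longrightarrow> 1 \<le> n \<longrightarrow> 1 < ps \<longrightarrow> ps \<le> 2 \<longrightarrow> 2 \<le> q \<longrightarrow> 1 / p + 1 / ps = 1 \<longrightarrow>
    iid_std_gaussian M m n g \<longrightarrow>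
    (let G = (\<lambda>\<omega> i j. a i j * g i j \<omega>);
         N = (\<lambda>\<omega>. mat_op_norm ps q m n (G \<omega>));
         X = (\<lambda>\<omega>. MAX (i, j)\<in>{..<m} \<times> {..<n}. \<bar>a i j * g i j \<omega>\<bar>)
     in integrable M N \<and> integrable M (\<lambda>\<omega>. N \<omega> powr q) \<and> integrable M X \<and>
        (\<integral>\<omega>. N \<omega> \<partial>M) \<le> (\<integral>\<omega>. N \<omega> powr q \<partial>M) powr (1 / q) \<and>
        (2 \<le> m \<longrightarrow>
          (\<integral>\<omega>. N \<omega> powr q \<partial>M) powr (1 / q)
            \<le> C * p powr (5 / q) * ln (real m) powr (1 / q) *
                (gauss_norm p * (MAX i\<in>{..<m}. ell_norm p n (\<lambda>j. a i j))
                  + gauss_norm q * (\<integral>\<omega>. X \<omega> \<partial>M))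
              + 2 powr (1 / q) * gauss_norm q * (MAX j\<in>{..<n}. ell_norm q m (\<lambda>i. a i j))))"
proof (intro exI[of _ 2073600000000] conjI allI impI)
  fix m n :: nat and a :: "nat \<Rightarrow> nat \<Rightarrow> real" and ps p q :: real
    and M :: "'w measure" and g :: "nat \<Rightarrow> nat \<Rightarrow> 'w \<Rightarrow> real"
  assume mn: "1 \<le> m" "1 \<le> n" and ps: "1 < ps" "ps \<le> 2" and q: "2 \<le> q" and pps: "1 / p + 1 / ps = 1"
    and iid: "iid_std_gaussian M m n g"
  interpret prob_space M using iid by (simp add: iid_std_gaussian_def)
  interpret gaussian_matrix M m n g
    using iid mn by unfold_locales (auto simp: iid_std_gaussian_def)
  \<comment> \<open>The sign of \<open>p\<close> has to be derived: \<open>1 / ps < 1\<close> forces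
    \<open>1 / p > 0\<close>, which also excludes \<open>p = 0\<close>, where \<open>1 / p\<close>
    is 0 by convention.\<close>
  have "1 / ps \<ge> 1 / 2" "1 / ps < 1" using ps by (auto simp: field_simps)
  then have p1: "1 / p > 0" "1 / p \<le> 1 / 2" using pps by linarith+
  then have "p > 0" by (simp add: zero_less_divide_iff)
  with p1 have p: "p \<ge> 2" by (simp add: field_simps)
  define Nrm where "Nrm \<omega> = mat_op_norm ps q m n (\<lambda>i j. a i j * g i j \<omega>)" for \<omega>
  have ps0: "0 < ps" and q1: "q \<ge> 1" "q > 1" using ps q by auto
  note Nm = mat_op_norm_meas_integrable[OF ps0 q1(1), of a, folded Nrm_def]
  define T where "T = (\<integral>\<omega>. (MAX (i, j)\<in>{..<m} \<times> {..<n}. \<bar>a i j * g i j \<omega>\<bar>) \<partial>M)"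
  define \<rho> where "\<rho> = (MAX i\<in>{..<m}. ell_norm p n (\<lambda>j. a i j))"
  define \<sigma> where "\<sigma> = (MAX j\<in>{..<n}. ell_norm q m (\<lambda>i. a i j))"
  have "ell_norm p n (a 0) \<le> \<rho>" "ell_norm q m (\<lambda>i. a i 0) \<le> \<sigma>"
    unfolding \<rho>_def \<sigma>_def using mn by (auto intro!: Max_ge)
  then have nn: "\<rho> \<ge> 0" "\<sigma> \<ge> 0" using ell_norm_nonneg order_trans by blast+
  have T: "T \<ge> 0" using max_entry_mean_ge[of 0 0 a] mn by (simp add: T_def)
  have main: "(\<integral>\<omega>. Nrm \<omega> powr q \<partial>M) powr (1 / q) \<le> 2073600000000 * p powr (5 / q) * ln (real m) powr (1 / q) *
      (gauss_norm p * \<rho> + gauss_norm q * T) + 2 powr (1 / q) * (gauss_norm q * \<sigma>)" if m: "2 \<le> m"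
  proof (rule root_of_moment_bound)
    show "(\<integral>\<omega>. Nrm \<omega> powr q \<partial>M) \<le> 2 * (gauss_norm q * \<sigma>) powr q +
      270000000 * 7680 powr q * p * ln (real m) * ((gauss_norm p * \<rho>) powr q + (gauss_norm q * T) powr q)"
      unfolding Nrm_def T_def \<rho>_def \<sigma>_def by (rule mat_op_norm_moment_le[OF p ps0 ps(2) pps q m])
  qed (use p q m nn T gauss_norm_pos[of p] gauss_norm_pos[of q] in auto)
  show "let G = (\<lambda>\<omega> i j. a i j * g i j \<omega>);
         N = (\<lambda>\<omega>. mat_op_norm ps q m n (G \<omega>));
         X = (\<lambda>\<omega>. MAX (i, j)\<in>{..<m} \<times> {..<n}. \<bar>a i j * g i j \<omega>\<bar>)
     in integrable M N \<and> integrable M (\<lambda>\<omega>. N \<omega> powr q) \<and> integrable M X \<and>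
        (\<integral>\<omega>. N \<omega> \<partial>M) \<le> (\<integral>\<omega>. N \<omega> powr q \<partial>M) powr (1 / q) \<and>
        (2 \<le> m \<longrightarrow>
          (\<integral>\<omega>. N \<omega> powr q \<partial>M) powr (1 / q)
            \<le> 2073600000000 * p powr (5 / q) * ln (real m) powr (1 / q) *
                (gauss_norm p * (MAX i\<in>{..<m}. ell_norm p n (\<lambda>j. a i j))
                  + gauss_norm q * (\<integral>\<omega>. X \<omega> \<partial>M))
              + 2 powr (1 / q) * gauss_norm q * (MAX j\<in>{..<n}. ell_norm q m (\<lambda>i. a i j)))"
    unfolding Let_def Nrm_def[symmetric] T_def[symmetric] \<rho>_def[symmetric] \<sigma>_def[symmetric]
    using Nm(3,4) integrable_max_entry[of a] main expectation_le_powr_mean[OF q1(2) Nm(4,3,2)]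
    by (simp add: mult.assoc)
qed simp

end
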